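(* Let $\mathbb{K}$ be an algebraically closed field, let $q\in\mathbb{K}^*$ be such that $q^2$ is a primitive $l$-th root of unity with $l>1$, and let $\alpha,\beta,\gamma\in\mathbb{K}$. Then each simple $A(\alpha,\beta,\gamma)$-module on which $z$ acts invertibly is isomorphic to one of the following simple $A(\alpha,\beta,\gamma)$-modules: (i) $M_1(\mu_1,\mu_2,\mu_3)$ for some $(\mu_1,\mu_2,\mu_3)\in(\mathbb{K}^* )^2\times\mathbb{K}$; (ii) $M_2(\mu_1,\mu_2)$ for some $(\mu_1,\mu_2)\in(\mathbb{K}^* )^2$; (iii) $M_3(\mu,s)$ for some $\mu\in\mathbb{K}^*$, where $1\le s\le l$ is the integer attached to $\mu$ in the definition of $M_3(\mu,s)$.
   Context: For $\alpha,\beta,\gamma\in\mathbb{K}$ and $q\in\mathbb{K}^*$, $A(\alpha,\beta,\gamma)$ is the associative unital $\mathbb{K}$-algebra generated by $x,y,z$ subject to $xy=q^2yx+\alpha$, $xz=q^{-2}zx+\beta$, $yz=q^2zy+\gamma$. Modules are right modules (so in $m\,xy$ the element $x$ acts first). $M_1(\mu_1,\mu_2,\mu_3)$, for $(\mu_1,\mu_2,\mu_3)\in(\mathbb{K}^* )^2\times\mathbb{K}$: the $\mathbb{K}$-vector space with basis $m_k$, $0\le k\le l-1$ (indices read modulo $l$, so $m_{-1}=m_{l-1}$ and $m_l=m_0$), with $$m_kx=\mu_1^{-1}\mu_2^{-1}q^{-2(k-1)}\Big[q^{2k}\mu_3-\tfrac{q^{2k}-1}{q^2-1}\Big(q^{2k-2}\alpha\mu_2^2-\tfrac{\beta\gamma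 q^2}{q^2-1}\Big)\Big]m_{k-1}+\tfrac{\mu_2^{-1}\beta q^2}{q^2-1}q^{-2k}m_k,$$ $$m_ky=\mu_1\mu_2^{-1}q^{-2(k+1)}m_{k+1}-\tfrac{\mu_2^{-1}\gamma}{q^2-1}q^{-2k}m_k,\qquad m_kz=q^{2k}\mu_2m_k.$$ $M_2(\mu_1,\mu_2)$, for $(\mu_1,\mu_2)\in(\mathbb{K}^* )^2$: the $\mathbb{K}$-vector space with basis $m_k$, $0\le k\le l-1$ (with $m_l=m_0$), with $$m_kx=\mu_1\mu_2^{-1}q^{2(k+1)}m_{k+1}+\tfrac{\beta\mu_2^{-1}q^2}{q^2-1}q^{2k}m_k,\qquad m_kz=q^{-2k}\mu_2m_k,$$ $$m_ky=\mu_1^{-1}\mu_2^{-1}q^{2(k-1)}\tfrac{1-q^{-2k}}{1-q^{-2}}\Big[\alpha\mu_2^2q^{-2k}-\tfrac{\beta\gamma}{q^2-1}\Big]m_{k-1}-\tfrac{\gamma\mu_2^{-1}}{q^2-1}q^{2k}m_k\ (k\ne0),\qquad m_0y=-\tfrac{\gamma\mu_2^{-1}}{q^2-1}m_0.$$ $M_3(\mu,s)$, for $\mu\in\mathbb{K}^*$: put $F_{\alpha,\beta,\gamma}(k,\mu)=\alpha q^{-2k}\mu^2-\frac{\beta\gamma}{q^2-1}$ for $1\le k\le l$, and let $s=1$ if $\alpha=\beta\gamma=0$; $s=k$ if $\alpha,\beta,\gamma\in\mathbb{K}^*$ and $F_{\alpha,\beta,\gamma}(k,\mu)=0$ for some $1\le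 k\le l$ (such a $k$ is unique); $s=l$ otherwise. $M_3(\mu,s)$ is the $\mathbb{K}$-vector space with basis $m_k$, $0\le k\le s-1$, with $$m_kx=\mu^{-1}q^{2(k+1)}m_{k+1}+\tfrac{\beta\mu^{-1}}{q^2-1}q^{2k+2}m_k\ (k\neq s-1),\qquad m_{s-1}x=\tfrac{\beta\mu^{-1}}{q^2-1}q^{2s}m_{s-1},$$ $$m_ky=\mu^{-1}q^{2(k-1)}\tfrac{1-q^{-2k}}{1-q^{-2}}\Big[\alpha\mu^2q^{-2k}-\tfrac{\beta\gamma}{q^2-1}\Big]m_{k-1}-\tfrac{\gamma\mu^{-1}}{q^2-1}q^{2k}m_k\ (k\neq0),\qquad m_0y=-\tfrac{\gamma\mu^{-1}}{q^2-1}m_0,$$ $$m_kz=q^{-2k}\mu m_k.$$ *)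

theory Defs
  imports
    "HOL-Algebra.QuotRing"
    "HOL-Algebra.Algebraic_Closure_Type"
    "HOL-Library.Poly_Mapping"
    "HOL-Computational_Algebra.Polynomial"
begin

definition primitive_root_of_unity :: "nat \<Rightarrow> 'k::field \<Rightarrow> bool" where
  "primitive_root_of_unity l \<zeta> \<longleftrightarrow> l > 0 \<and> \<zeta> ^ l = 1 \<and> (\<forall>j. 0 < j \<and> j < l \<longrightarrow> \<zeta> ^ j \<noteq> 1)"


section \<open>Right modules\<close>

text \<open>
  The modules of HOL-Algebra are left modules over commutative rings, so right modules over an
  arbitrary ring are introduced here in the same style.  As there, the multiplicative fields
  inherited from the ring record are not used.
\<close>

record ('a, 'b) right_module = "'b ring" +
  ract :: "['b, 'a] \<Rightarrow> 'b" (infixl "\<triangleleft>\<index>" 70)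

locale right_module = R?: ring R + M?: abelian_group M
  for R :: "('a, 'c) ring_scheme" (structure)
  and M :: "('a, 'b, 'd) right_module_scheme" (structure) +
  assumes ract_closed:
      "\<lbrakk>m \<in> carrier M; a \<in> carrier R\<rbrakk> \<Longrightarrow> m \<triangleleft>\<^bsub>M\<^esub> a \<in> carrier M"
    and ract_add_left:
      "\<lbrakk>m \<in> carrier M; n \<in> carrier M; a \<in> carrier R\<rbrakk> \<Longrightarrow>
        (m \<oplus>\<^bsub>M\<^esub> n) \<triangleleft>\<^bsub>M\<^esub> a = (m \<triangleleft>\<^bsub>M\<^esub> a) \<oplus>\<^bsub>M\<^esub> (n \<triangleleft>\<^bsub>M\<^esub> a)"
    and ract_add_right:
      "\<lbrakk>m \<in> carrier M; a \<in> carrier R; b \<in> carrier R\<rbrakk> \<Longrightarrow>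
        m \<triangleleft>\<^bsub>M\<^esub> (a \<oplus>\<^bsub>R\<^esub> b) = (m \<triangleleft>\<^bsub>M\<^esub> a) \<oplus>\<^bsub>M\<^esub> (m \<triangleleft>\<^bsub>M\<^esub> b)"
    and ract_mult:
      "\<lbrakk>m \<in> carrier M; a \<in> carrier R; b \<in> carrier R\<rbrakk> \<Longrightarrow>
        m \<triangleleft>\<^bsub>M\<^esub> (a \<otimes>\<^bsub>R\<^esub> b) = (m \<triangleleft>\<^bsub>M\<^esub> a) \<triangleleft>\<^bsub>M\<^esub> b"
    and ract_one:
      "m \<in> carrier M \<Longrightarrow> m \<triangleleft>\<^bsub>M\<^esub> \<one>\<^bsub>R\<^esub> = m"

definition right_submodule ::
    "'b set \<Rightarrow> ('a, 'c) ring_scheme \<Rightarrow> ('a, 'b, 'd) right_module_scheme \<Rightarrow> bool" where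
  "right_submodule N R M \<longleftrightarrow>
     additive_subgroup N M \<and> (\<forall>n\<in>N. \<forall>a\<in>carrier R. n \<triangleleft>\<^bsub>M\<^esub> a \<in> N)"

definition simple_right_module ::
    "('a, 'c) ring_scheme \<Rightarrow> ('a, 'b, 'd) right_module_scheme \<Rightarrow> bool" where
  "simple_right_module R M \<longleftrightarrow>
     right_module R M \<and> carrier M \<noteq> {\<zero>\<^bsub>M\<^esub>} \<and>
     (\<forall>N. right_submodule N R M \<longrightarrow> N = {\<zero>\<^bsub>M\<^esub>} \<or> N = carrier M)"

definition isomorphic_right_modules ::
    "('a, 'c) ring_scheme \<Rightarrow> ('a, 'b, 'd) right_module_scheme \<Rightarrow>
     ('a, 'e, 'f) right_module_scheme \<Rightarrow> bool" where
  "isomorphic_right_modules R M N \<longleftrightarrow>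
     (\<exists>h. bij_betw h (carrier M) (carrier N) \<and>
          (\<forall>m\<in>carrier M. \<forall>n\<in>carrier M. h (m \<oplus>\<^bsub>M\<^esub> n) = h m \<oplus>\<^bsub>N\<^esub> h n) \<and>
          (\<forall>m\<in>carrier M. \<forall>a\<in>carrier R. h (m \<triangleleft>\<^bsub>M\<^esub> a) = h m \<triangleleft>\<^bsub>N\<^esub> a))"

definition acts_invertibly :: "('a, 'b, 'd) right_module_scheme \<Rightarrow> 'a \<Rightarrow> bool" where
  "acts_invertibly M a \<longleftrightarrow> bij_betw (\<lambda>m. m \<triangleleft>\<^bsub>M\<^esub> a) (carrier M) (carrier M)"


section \<open>The free algebra on three generators\<close>

datatype gen = Gx | Gy | Gz

datatype word = Word (letters: "gen list")

instantiation word :: monoid_add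
begin

definition zero_word :: word where
  "zero_word = Word []"

definition plus_word :: "word \<Rightarrow> word \<Rightarrow> word" where
  "plus_word u v = Word (letters u @ letters v)"

instance
  by standard (simp_all add: zero_word_def plus_word_def)

end

text \<open>
  The monoid of words is written additively because multiplication on the type of finitely
  supported functions is convolution with respect to addition.  Thus the following type is the
  monoid algebra of the free monoid, that is, the free unital algebra on the three generators.
\<close>

type_synonym 'k free_alg = "word \<Rightarrow>\<^sub>0 'k"

definition gen :: "gen \<Rightarrow> 'k::field free_alg" where
  "gen g = Poly_Mapping.single (Word [g]) 1"

definition const :: "'k::field \<Rightarrow> 'k free_alg" where
  "const c = Poly_Mapping.single 0 c"


section \<open>The algebra $A(\alpha,\beta,\gamma)$\<close>

definition relators :: "'k::field \<Rightarrow> 'k \<Rightarrow> 'k \<Rightarrow> 'k \<Rightarrow> 'k free_alg set" where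
  "relators q \<alpha> \<beta> \<gamma> =
     {gen Gx * gen Gy - (const (q powi 2) * gen Gy * gen Gx + const \<alpha>),
      gen Gx * gen Gz - (const (q powi (-2)) * gen Gz * gen Gx + const \<beta>),
      gen Gy * gen Gz - (const (q powi 2) * gen Gz * gen Gy + const \<gamma>)}"

definition relation_ideal :: "'k::field \<Rightarrow> 'k \<Rightarrow> 'k \<Rightarrow> 'k \<Rightarrow> 'k free_alg set" where
  "relation_ideal q \<alpha> \<beta> \<gamma> = Idl\<^bsub>ring_of_type_algebra\<^esub> (relators q \<alpha> \<beta> \<gamma>)"

text \<open>
  The scalars act on a right \<open>A_alg\<close>-module through the classes of the constants, so such a module is
  automatically a vector space and its submodules and module isomorphisms are linear.
\<close>

definition A_alg :: "'k::field \<Rightarrow> 'k \<Rightarrow> 'k \<Rightarrow> 'k \<Rightarrow> 'k free_alg set ring" where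
  "A_alg q \<alpha> \<beta> \<gamma> = ring_of_type_algebra Quot (relation_ideal q \<alpha> \<beta> \<gamma>)"

definition A_class :: "'k::field \<Rightarrow> 'k \<Rightarrow> 'k \<Rightarrow> 'k \<Rightarrow> 'k free_alg \<Rightarrow> 'k free_alg set" where
  "A_class q \<alpha> \<beta> \<gamma> p = relation_ideal q \<alpha> \<beta> \<gamma> +>\<^bsub>ring_of_type_algebra\<^esub> p"


section \<open>Modules given by the action of the generators on a basis\<close>

text \<open>
  A vector with finitely many coordinates is a finitely supported function, and the basis vector
  $m_k$ with coefficient $c$ is \<^term>\<open>Poly_Mapping.single k c\<close>.
\<close>

definition scale :: "'k::field \<Rightarrow> (nat \<Rightarrow>\<^sub>0 'k) \<Rightarrow> (nat \<Rightarrow>\<^sub>0 'k)" where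
  "scale c v = Poly_Mapping.map ((*) c) v"

definition lin_ext :: "(nat \<Rightarrow> (nat \<Rightarrow>\<^sub>0 'k)) \<Rightarrow> (nat \<Rightarrow>\<^sub>0 'k) \<Rightarrow> (nat \<Rightarrow>\<^sub>0 'k::field)" where
  "lin_ext f v = (\<Sum>k\<in>Poly_Mapping.keys v. scale (Poly_Mapping.lookup v k) (f k))"

text \<open>In a word the leftmost letter acts first.\<close>

definition free_act ::
    "(gen \<Rightarrow> nat \<Rightarrow> (nat \<Rightarrow>\<^sub>0 'k)) \<Rightarrow> (nat \<Rightarrow>\<^sub>0 'k) \<Rightarrow> 'k::field free_alg \<Rightarrow> (nat \<Rightarrow>\<^sub>0 'k)" where
  "free_act f v p =
     (\<Sum>w\<in>Poly_Mapping.keys p.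
        scale (Poly_Mapping.lookup p w) (fold (\<lambda>g. lin_ext (f g)) (letters w) v))"

text \<open>
  The module with basis $m_0, \ldots, m_{n-1}$ on which the generator \<open>g\<close> sends $m_k$ to \<open>f g k\<close>.
  An element of \<open>A_alg\<close>, which is a class of elements of the free algebra, acts by the common value of
  the actions of its representatives; there is one if the operators satisfy the relations.
\<close>

definition based_module ::
    "nat \<Rightarrow> (gen \<Rightarrow> nat \<Rightarrow> (nat \<Rightarrow>\<^sub>0 'k)) \<Rightarrow> ('k::field free_alg set, nat \<Rightarrow>\<^sub>0 'k) right_module"
  where
  "based_module n f =
     \<lparr>carrier = {v. Poly_Mapping.keys v \<subseteq> {..<n}}, monoid.mult = undefined, one = undefined,
      ring.zero = 0, add = (+),
      ract = (\<lambda>v a. the_elem (free_act f v ` a))\<rparr>"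


section \<open>The modules $M_1$, $M_2$ and $M_3$\<close>

fun M1_gen :: "'k::field \<Rightarrow> nat \<Rightarrow> 'k \<Rightarrow> 'k \<Rightarrow> 'k \<Rightarrow> 'k \<Rightarrow> 'k \<Rightarrow> 'k \<Rightarrow> gen \<Rightarrow> nat \<Rightarrow> (nat \<Rightarrow>\<^sub>0 'k)"
  where
  "M1_gen q l \<alpha> \<beta> \<gamma> \<mu>1 \<mu>2 \<mu>3 Gx k =
     Poly_Mapping.single ((k + l - 1) mod l)
       (inverse \<mu>1 * inverse \<mu>2 * q powi (-2 * (int k - 1)) *
         (q powi (2 * int k) * \<mu>3 -
           (q powi (2 * int k) - 1) / (q powi 2 - 1) *
             (q powi (2 * int k - 2) * \<alpha> * \<mu>2 ^ 2 - \<beta> * \<gamma> * q powi 2 / (q powi 2 - 1)))) +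
     Poly_Mapping.single k
       (inverse \<mu>2 * \<beta> * q powi 2 / (q powi 2 - 1) * q powi (-2 * int k))"
| "M1_gen q l \<alpha> \<beta> \<gamma> \<mu>1 \<mu>2 \<mu>3 Gy k =
     Poly_Mapping.single ((k + 1) mod l) (\<mu>1 * inverse \<mu>2 * q powi (-2 * (int k + 1))) -
     Poly_Mapping.single k (inverse \<mu>2 * \<gamma> / (q powi 2 - 1) * q powi (-2 * int k))"
| "M1_gen q l \<alpha> \<beta> \<gamma> \<mu>1 \<mu>2 \<mu>3 Gz k = Poly_Mapping.single k (q powi (2 * int k) * \<mu>2)"

definition M1 ::
    "'k::field \<Rightarrow> nat \<Rightarrow> 'k \<Rightarrow> 'k \<Rightarrow> 'k \<Rightarrow> 'k \<Rightarrow> 'k \<Rightarrow> 'k \<Rightarrow> ('k free_alg set, nat \<Rightarrow>\<^sub>0 'k) right_module"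
  where
  "M1 q l \<alpha> \<beta> \<gamma> \<mu>1 \<mu>2 \<mu>3 = based_module l (M1_gen q l \<alpha> \<beta> \<gamma> \<mu>1 \<mu>2 \<mu>3)"

fun M2_gen :: "'k::field \<Rightarrow> nat \<Rightarrow> 'k \<Rightarrow> 'k \<Rightarrow> 'k \<Rightarrow> 'k \<Rightarrow> 'k \<Rightarrow> gen \<Rightarrow> nat \<Rightarrow> (nat \<Rightarrow>\<^sub>0 'k)" where
  "M2_gen q l \<alpha> \<beta> \<gamma> \<mu>1 \<mu>2 Gx k =
     Poly_Mapping.single ((k + 1) mod l) (\<mu>1 * inverse \<mu>2 * q powi (2 * (int k + 1))) +
     Poly_Mapping.single k (\<beta> * inverse \<mu>2 * q powi 2 / (q powi 2 - 1) * q powi (2 * int k))"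
| "M2_gen q l \<alpha> \<beta> \<gamma> \<mu>1 \<mu>2 Gy k =
     (if k = 0 then - Poly_Mapping.single 0 (\<gamma> * inverse \<mu>2 / (q powi 2 - 1))
      else
        Poly_Mapping.single (k - 1)
          (inverse \<mu>1 * inverse \<mu>2 * q powi (2 * (int k - 1)) *
            ((1 - q powi (-2 * int k)) / (1 - q powi (-2))) *
            (\<alpha> * \<mu>2 ^ 2 * q powi (-2 * int k) - \<beta> * \<gamma> / (q powi 2 - 1))) -
        Poly_Mapping.single k (\<gamma> * inverse \<mu>2 / (q powi 2 - 1) * q powi (2 * int k)))"
| "M2_gen q l \<alpha> \<beta> \<gamma> \<mu>1 \<mu>2 Gz k = Poly_Mapping.single k (q powi (-2 * int k) * \<mu>2)"

definition M2 ::
    "'k::field \<Rightarrow> nat \<Rightarrow> 'k \<Rightarrow> 'k \<Rightarrow> 'k \<Rightarrow> 'k \<Rightarrow> 'k \<Rightarrow> ('k free_alg set, nat \<Rightarrow>\<^sub>0 'k) right_module"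
  where
  "M2 q l \<alpha> \<beta> \<gamma> \<mu>1 \<mu>2 = based_module l (M2_gen q l \<alpha> \<beta> \<gamma> \<mu>1 \<mu>2)"

definition F_coeff :: "'k::field \<Rightarrow> 'k \<Rightarrow> 'k \<Rightarrow> 'k \<Rightarrow> nat \<Rightarrow> 'k \<Rightarrow> 'k" where
  "F_coeff q \<alpha> \<beta> \<gamma> k \<mu> = \<alpha> * q powi (-2 * int k) * \<mu> ^ 2 - \<beta> * \<gamma> / (q powi 2 - 1)"

definition M3_dim :: "'k::field \<Rightarrow> nat \<Rightarrow> 'k \<Rightarrow> 'k \<Rightarrow> 'k \<Rightarrow> 'k \<Rightarrow> nat" where
  "M3_dim q l \<alpha> \<beta> \<gamma> \<mu> =
     (if \<alpha> = 0 \<and> \<beta> * \<gamma> = 0 then 1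
      else if \<alpha> \<noteq> 0 \<and> \<beta> \<noteq> 0 \<and> \<gamma> \<noteq> 0 \<and> (\<exists>k\<in>{1..l}. F_coeff q \<alpha> \<beta> \<gamma> k \<mu> = 0)
      then (THE k. k \<in> {1..l} \<and> F_coeff q \<alpha> \<beta> \<gamma> k \<mu> = 0)
      else l)"

fun M3_gen :: "'k::field \<Rightarrow> 'k \<Rightarrow> 'k \<Rightarrow> 'k \<Rightarrow> 'k \<Rightarrow> nat \<Rightarrow> gen \<Rightarrow> nat \<Rightarrow> (nat \<Rightarrow>\<^sub>0 'k)" where
  "M3_gen q \<alpha> \<beta> \<gamma> \<mu> s Gx k =
     (if k = s - 1
      then Poly_Mapping.single (s - 1) (\<beta> * inverse \<mu> / (q powi 2 - 1) * q powi (2 * int s))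
      else
        Poly_Mapping.single (k + 1) (inverse \<mu> * q powi (2 * (int k + 1))) +
        Poly_Mapping.single k (\<beta> * inverse \<mu> / (q powi 2 - 1) * q powi (2 * int k + 2)))"
| "M3_gen q \<alpha> \<beta> \<gamma> \<mu> s Gy k =
     (if k = 0 then - Poly_Mapping.single 0 (\<gamma> * inverse \<mu> / (q powi 2 - 1))
      else
        Poly_Mapping.single (k - 1)
          (inverse \<mu> * q powi (2 * (int k - 1)) *
            ((1 - q powi (-2 * int k)) / (1 - q powi (-2))) *
            (\<alpha> * \<mu> ^ 2 * q powi (-2 * int k) - \<beta> * \<gamma> / (q powi 2 - 1))) -
        Poly_Mapping.single k (\<gamma> * inverse \<mu> / (q powi 2 - 1) * q powi (2 * int k)))"
| "M3_gen q \<alpha> \<beta> \<gamma> \<mu> s Gz k = Poly_Mapping.single k (q powi (-2 * int k) * \<mu>)"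

definition M3 ::
    "'k::field \<Rightarrow> 'k \<Rightarrow> 'k \<Rightarrow> 'k \<Rightarrow> 'k \<Rightarrow> nat \<Rightarrow> ('k free_alg set, nat \<Rightarrow>\<^sub>0 'k) right_module"
  where
  "M3 q \<alpha> \<beta> \<gamma> \<mu> s = based_module s (M3_gen q \<alpha> \<beta> \<gamma> \<mu> s)"

end

(*
  A simple module is F / I for a maximal right ideal I of the free algebra F, and everything is
  computed with congruences modulo I and modulo the annihilator N of F / I.  Since x^l, y^l, z^l are
  central and the algebra is finite over the subalgebra they generate, a Nullstellensatz argument
  shows that every central element acts on a simple module as a scalar.

  Completing x and y by multiples of z^-1 gives elements that shift the eigenvalues of z by t^-1 and
  t, where t = q^2.  Their l-th powers and a Casimir element are central, hence scalars, so the
  vectors obtained from a z-eigenvector by repeated shifting form a chain on which the algebra acts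
  by explicit formulas.  The chain is cyclic under y (M1), cyclic under x (M2), or killed by both
  (M3).  The explicit module maps to F / I along the chain, and both modules are simple.
*)

theory Submission
  imports Defs
begin

section \<open>Homomorphisms modulo an ideal\<close>

text \<open>Nothing says that a simple module is finite-dimensional, and the field may be countable,
  so Schur's lemma alone gives no scalars; finite generation over a polynomial ring in central
  elements takes the place of dimension.

  The ideal \<open>I\<close> is the annihilator of a nonzero vector m, so an element p of the free
  algebra stands for the vector m p. Congruence modulo \<open>I\<close> survives multiplication on
  the right only; an identity between operators is inserted behind a vector by way of
  \<open>N\<close>.

  The algebra provides no inverse of z. The completed generators are therefore taken multiplied by
  z, and z is cancelled by its injectivity on the module; no localization is formed.

  The scalars by which the l-th powers of the two completed generators act decide the family: that
  of y nonzero gives M1, that of y zero and that of x nonzero gives M2, both zero gives M3. In the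
  last case the length of the chain is the first positive zero of an explicit sequence, the origin
  of the cases in the definition of s.

  Because both modules are simple, one inclusion between annihilators of two vectors already yields
  an isomorphism.\<close>

definition two_sided_ideal :: "'a::ring_1 set \<Rightarrow> bool" where
  "two_sided_ideal N \<longleftrightarrow> 0 \<in> N \<and> (\<forall>a\<in>N. \<forall>b\<in>N. a - b \<in> N) \<and>
     (\<forall>a\<in>N. \<forall>p. a * p \<in> N \<and> p * a \<in> N)"

lemma two_sided_idealD:
  assumes "two_sided_ideal N"
  shows "0 \<in> N" and "a \<in> N \<Longrightarrow> b \<in> N \<Longrightarrow> a - b \<in> N" and "a \<in> N \<Longrightarrow> b \<in> N \<Longrightarrow> a + b \<in> N"
    and "a \<in> N \<Longrightarrow> a * p \<in> N" and "a \<in> N \<Longrightarrow> p * a \<in> N" and "a \<in> N \<Longrightarrow> - a \<in> N"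
proof -
  show "0 \<in> N" "a \<in> N \<Longrightarrow> b \<in> N \<Longrightarrow> a - b \<in> N" "a \<in> N \<Longrightarrow> a * p \<in> N" "a \<in> N \<Longrightarrow> p * a \<in> N"
    using assms by (auto simp: two_sided_ideal_def)
  have neg: "- c \<in> N" if "c \<in> N" for c
  proof -
    have "0 - c \<in> N" using assms that unfolding two_sided_ideal_def by blast
    then show ?thesis by simp
  qed
  then show "a \<in> N \<Longrightarrow> - a \<in> N" .
  assume "a \<in> N" "b \<in> N"
  then have "a - (- b) \<in> N" using neg assms unfolding two_sided_ideal_def by blast
  then show "a + b \<in> N" by simp
qed

definition eqmod :: "'a::ring_1 set \<Rightarrow> 'a \<Rightarrow> 'a \<Rightarrow> bool" where
  "eqmod N a b \<longleftrightarrow> a - b \<in> N"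

lemma eqmod_refl [simp]: "two_sided_ideal N \<Longrightarrow> eqmod N a a"
  by (simp add: eqmod_def two_sided_idealD)

lemma eqmod_sym: "two_sided_ideal N \<Longrightarrow> eqmod N a b \<Longrightarrow> eqmod N b a"
  unfolding eqmod_def using two_sided_idealD(6)[of N "a - b"] by simp

lemma eqmod_trans: "two_sided_ideal N \<Longrightarrow> eqmod N a b \<Longrightarrow> eqmod N b c \<Longrightarrow> eqmod N a c"
  unfolding eqmod_def using two_sided_idealD(3)[of N "a - b" "b - c"] by simp

lemma eqmod_add: "two_sided_ideal N \<Longrightarrow> eqmod N a b \<Longrightarrow> eqmod N c d \<Longrightarrow> eqmod N (a + c) (b + d)"
  unfolding eqmod_def using two_sided_idealD(3)[of N "a - b" "c - d"] by (simp add: algebra_simps)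

lemma eqmod_diff: "two_sided_ideal N \<Longrightarrow> eqmod N a b \<Longrightarrow> eqmod N c d \<Longrightarrow> eqmod N (a - c) (b - d)"
  unfolding eqmod_def using two_sided_idealD(2)[of N "a - b" "c - d"] by (simp add: algebra_simps)

lemma eqmod_mult:
  assumes N: "two_sided_ideal N" and "eqmod N a b" "eqmod N c d"
  shows "eqmod N (a * c) (b * d)"
proof -
  have "(a - b) * c + b * (c - d) \<in> N"
    using assms unfolding eqmod_def
    by (intro two_sided_idealD(3)[OF N two_sided_idealD(4)[OF N] two_sided_idealD(5)[OF N]])
  then show ?thesis by (simp add: eqmod_def algebra_simps)
qed

text \<open>A homomorphism into the centre of the quotient by \<open>N\<close>, written with
  representatives so that the quotient ring is never formed. Addition and unit are exact, because
  Horner evaluation respects them exactly; products only have to agree modulo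
  \<open>N\<close>.\<close>

definition hom_mod :: "'a::ring_1 set \<Rightarrow> ('r::comm_ring_1 \<Rightarrow> 'a) \<Rightarrow> bool" where
  "hom_mod N \<rho> \<longleftrightarrow> (\<forall>a b. \<rho> (a + b) = \<rho> a + \<rho> b) \<and> \<rho> 1 = 1 \<and>
     (\<forall>a b. eqmod N (\<rho> (a * b)) (\<rho> a * \<rho> b)) \<and> (\<forall>a p. eqmod N (\<rho> a * p) (p * \<rho> a))"

lemma hom_modD:
  assumes "hom_mod N \<rho>"
  shows "\<rho> (a + b) = \<rho> a + \<rho> b" and "\<rho> 1 = 1" and "eqmod N (\<rho> (a * b)) (\<rho> a * \<rho> b)"
    and "eqmod N (\<rho> a * p) (p * \<rho> a)" and "\<rho> 0 = 0" and "\<rho> (a - b) = \<rho> a - \<rho> b"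
proof -
  show add: "\<rho> (a + b) = \<rho> a + \<rho> b" for a b using assms by (auto simp: hom_mod_def)
  show "\<rho> 1 = 1" "eqmod N (\<rho> (a * b)) (\<rho> a * \<rho> b)" "eqmod N (\<rho> a * p) (p * \<rho> a)"
    using assms by (auto simp: hom_mod_def)
  show "\<rho> 0 = 0" using add[of 0 0] by simp
  show "\<rho> (a - b) = \<rho> a - \<rho> b" using add[of "a - b" b] by simp
qed

text \<open>The coefficient map is arbitrary so that evaluations can be nested: the evaluation in
  the earlier variables serves as coefficient map for the next one.\<close>

definition peval :: "('r::comm_ring_1 \<Rightarrow> 'a::ring_1) \<Rightarrow> 'a \<Rightarrow> 'r poly \<Rightarrow> 'a" where
  "peval \<rho> a f = fold_coeffs (\<lambda>c s. \<rho> c + s * a) f 0"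

lemma peval_0 [simp]: "peval \<rho> a 0 = 0"
  by (simp add: peval_def)

lemma peval_pCons: "\<rho> 0 = 0 \<Longrightarrow> peval \<rho> a (pCons c f) = \<rho> c + peval \<rho> a f * a"
  by (cases "c = 0 \<and> f = 0") (auto simp: peval_def)

lemma peval_const: "\<rho> 0 = 0 \<Longrightarrow> peval \<rho> a [:c:] = \<rho> c"
  by (simp add: peval_pCons)

lemma peval_var: "\<rho> 0 = 0 \<Longrightarrow> \<rho> 1 = 1 \<Longrightarrow> peval \<rho> a [:0, 1:] = a"
  by (simp add: peval_pCons)

lemma hom_mod_peval:
  assumes N: "two_sided_ideal N" and \<rho>: "hom_mod N \<rho>" and a: "\<And>p. eqmod N (a * p) (p * a)"
  shows "hom_mod N (peval \<rho> a)"
proof -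
  note [simp] = hom_modD(5)[OF \<rho>] peval_pCons[of \<rho>]
  note T [trans] = eqmod_trans[OF N]
  note cong = eqmod_add[OF N] eqmod_mult[OF N] eqmod_refl[OF N]
  have add: "peval \<rho> a (f + g) = peval \<rho> a f + peval \<rho> a g" for f g
    by (induction f g rule: poly_induct2) (simp_all add: hom_modD(1)[OF \<rho>] algebra_simps)
  have cent: "eqmod N (peval \<rho> a f * p) (p * peval \<rho> a f)" for f p
  proof (induction f arbitrary: p)
    case (pCons c f)
    have "eqmod N (\<rho> c * p + peval \<rho> a f * (a * p)) (p * \<rho> c + peval \<rho> a f * (p * a))"
      by (rule eqmod_add[OF N hom_modD(4)[OF \<rho>] eqmod_mult[OF N eqmod_refl[OF N] a]])
    also have "eqmod N \<dots> (p * \<rho> c + p * peval \<rho> a f * a)"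
      using eqmod_mult[OF N pCons.IH[of p] eqmod_refl[OF N, of a]]
      by (intro cong(1)) (simp_all add: N mult.assoc)
    finally show ?case by (simp add: algebra_simps)
  qed (simp add: N)
  have smult: "eqmod N (peval \<rho> a (smult c f)) (\<rho> c * peval \<rho> a f)" for c f
  proof (induction f)
    case (pCons b f)
    have "eqmod N (\<rho> (c * b) + peval \<rho> a (smult c f) * a) (\<rho> c * \<rho> b + \<rho> c * peval \<rho> a f * a)"
      using hom_modD(3)[OF \<rho>] pCons.IH by (intro cong)
    then show ?case by (simp add: algebra_simps)
  qed (simp add: N)
  have mult: "eqmod N (peval \<rho> a (f * g)) (peval \<rho> a f * peval \<rho> a g)" for f g
  proof (induction f)
    case (pCons c f)
    have "eqmod N (peval \<rho> a (pCons c f * g)) (\<rho> c * peval \<rho> a g + peval \<rho> a f * peval \<rho> a g * a)"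
      using smult pCons.IH by (simp add: add) (intro cong)
    \<comment> \<open>Multiplicativity rests on this exchange of \<open>a\<close> with a value; it
      is where centrality of \<open>a\<close> enters.\<close>
    also have "eqmod N \<dots> (\<rho> c * peval \<rho> a g + peval \<rho> a f * (a * peval \<rho> a g))"
      unfolding mult.assoc
      by (rule eqmod_add[OF N eqmod_refl[OF N] eqmod_mult[OF N eqmod_refl[OF N] eqmod_sym[OF N a]]])
    finally show ?case by (simp add: algebra_simps)
  qed (simp add: N)
  show ?thesis
    unfolding hom_mod_def using add cent mult
    by (simp add: one_pCons hom_modD(2)[OF \<rho>])
qed


section \<open>A weak Nullstellensatz\<close>

definition prime_set :: "'r::comm_ring_1 set \<Rightarrow> bool" where
  "prime_set P \<longleftrightarrow> two_sided_ideal P \<and> (\<forall>f g. f * g \<in> P \<longrightarrow> f \<in> P \<or> g \<in> P)"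

lemma two_sided_ideal_zero: "two_sided_ideal {0}"
  by (simp add: two_sided_ideal_def)

lemma hom_mod_zero_iff:
  fixes \<phi> :: "'r::comm_ring_1 \<Rightarrow> 'k::comm_ring_1"
  shows "hom_mod {0} \<phi> \<longleftrightarrow> (\<forall>a b. \<phi> (a + b) = \<phi> a + \<phi> b) \<and> \<phi> 1 = 1 \<and> (\<forall>a b. \<phi> (a * b) = \<phi> a * \<phi> b)"
  by (auto simp: hom_mod_def eqmod_def mult.commute)

lemma peval_eq_poly:
  fixes \<phi> :: "'r::comm_ring_1 \<Rightarrow> 'k::comm_ring_1"
  assumes "\<phi> 0 = 0"
  shows "peval \<phi> \<xi> f = poly (map_poly \<phi> f) \<xi>"
  by (induction f) (simp_all add: assms peval_pCons map_poly_pCons mult.commute)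

text \<open>A root of p - 1 is a point where p has the value 1.\<close>

lemma alg_closed_nonroot:
  fixes p :: "'k::alg_closed_field poly"
  assumes "p \<noteq> 0"
  shows "\<exists>\<xi>. poly p \<xi> \<noteq> 0"
proof (cases "degree p > 0")
  case True
  then have "degree (p + (- 1)) > 0" by (subst degree_add_eq_left) simp_all
  then have "degree (p - 1) > 0" by simp
  then obtain \<xi> where "poly (p - 1) \<xi> = 0"
    using alg_closed_imp_poly_has_root by blast
  then show ?thesis by (intro exI[of _ \<xi>]) simp
next
  case False
  then obtain c where "p = [:c:]" by (meson degree_eq_zeroE neq0_conv)
  with assms show ?thesis by auto
qed

lemma coeffs_in_imp_mem:
  fixes P :: "'r::idom poly set"
  assumes P: "two_sided_ideal P" and "\<And>i. [:coeff f i:] \<in> P"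
  shows "f \<in> P"
  using assms(2)
proof (induction f)
  case (pCons c f)
  have "f \<in> P" using pCons.prems[of "Suc i" for i] by (intro pCons.IH) simp
  moreover have "[:c:] \<in> P" using pCons.prems[of 0] by simp
  moreover have "pCons c f = [:c:] + [:0, 1:] * f" by simp
  ultimately show ?case using two_sided_idealD[OF P] by metis
qed (use two_sided_idealD[OF P] in simp)

text \<open>Leading terms with coefficient in \<open>P\<close> are subtracted until the leading
  coefficient lies outside \<open>P\<close>; this must happen, since the i-th coefficient is never
  touched. It allows degrees to be minimized over polynomials that are nonzero modulo the constants
  in \<open>P\<close>. The larger ideal \<open>J\<close> serves the second minimization in
  \<open>prime_set_extension\<close>.\<close>

lemma ideal_lead_coeff_reduce:
  fixes P J :: "'r::idom poly set"
  assumes P: "two_sided_ideal P" and J: "two_sided_ideal J" and PJ: "P \<subseteq> J"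
    and "f \<in> J" "[:coeff f i:] \<notin> P"
  shows "\<exists>g\<in>J. degree g \<le> degree f \<and> [:lead_coeff g:] \<notin> P"
  using assms(4,5)
proof (induction "degree f" arbitrary: f i rule: less_induct)
  case (less f)
  show ?case
  proof (cases "[:lead_coeff f:] \<in> P")
    case True
    define h where "h = f - monom (lead_coeff f) (degree f)"
    have m: "monom (lead_coeff f) (degree f) \<in> P"
      using two_sided_idealD(4)[OF P True, of "monom 1 (degree f)"] by (simp add: smult_monom)
    then have hJ: "h \<in> J" unfolding h_def using less.prems two_sided_idealD(2)[OF J] PJ by blast
    have i: "i \<noteq> degree f" using True less.prems by auto
    then have hi: "[:coeff h i:] \<notin> P" using less.prems by (simp add: h_def)
    have ch: "coeff h j = 0" if "j \<ge> degree f" for j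
      using that by (cases "j = degree f") (auto simp: h_def coeff_eq_0)
    have "h \<noteq> 0" using hi two_sided_idealD(1)[OF P] by auto
    then have "degree h < degree f"
      using ch[of "degree h"] by (metis leading_coeff_0_iff not_le_imp_less)
    with less.hyps[OF _ hJ hi] show ?thesis by (meson less_imp_le order_trans)
  qed (use less in blast)
qed

text \<open>
  The extension step of Zariski's lemma: if \<open>P\<close> contains a polynomial \<open>p\<close> which is nonzero modulo
  \<open>P \<inter> R\<close>, take it of least degree; then \<open>\<xi>\<close> can be any root of the image of \<open>p\<close>.
\<close>

lemma prime_set_extension:
  fixes P :: "'r::idom poly set"
  assumes P: "prime_set P" and s: "s \<notin> P"
  shows "\<exists>r. [:r:] \<notin> P \<and>
    (\<forall>\<phi> :: 'r \<Rightarrow> 'k::alg_closed_field.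
      hom_mod {0} \<phi> \<and> (\<forall>c. [:c:] \<in> P \<longrightarrow> \<phi> c = 0) \<and> \<phi> r \<noteq> 0 \<longrightarrow>
      (\<exists>\<xi>. (\<forall>f\<in>P. peval \<phi> \<xi> f = 0) \<and> peval \<phi> \<xi> s \<noteq> 0))"
proof -
  have idl: "two_sided_ideal P" using P by (simp add: prime_set_def)
  have pr: "f \<in> P \<or> g \<in> P" if "f * g \<in> P" for f g using P that by (auto simp: prime_set_def)
  note I = two_sided_idealD[OF idl]
  \<comment> \<open>Pseudo-division multiplies by powers of leading coefficients; primality keeps
    these powers outside \<open>P\<close>.\<close>
  have pw: "[:d:] \<in> P" if "[:d ^ n:] \<in> P" for d n
    using that
  proof (induction n)
    case 0
    then have "1 * s \<in> P" by (intro I(4)) (simp add: one_pCons)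
    with s show ?case by simp
  next
    case (Suc n)
    have "[:d ^ Suc n:] = [:d:] * [:d ^ n:]" by simp
    then have "[:d:] * [:d ^ n:] \<in> P" using Suc.prems by metis
    with Suc.IH pr show ?case by blast
  qed
  show ?thesis
  proof (cases "\<forall>f\<in>P. \<forall>i. [:coeff f i:] \<in> P")
    \<comment> \<open>Every member of \<open>P\<close> has all its coefficients in \<open>P\<close>,
      hence vanishes under \<phi> at every point; \<xi> only has to avoid the roots of the image of
      \<open>s\<close>.\<close>
    case True
    obtain i where i: "[:coeff s i:] \<notin> P" using s coeffs_in_imp_mem[OF idl] by blast
    show ?thesis
    proof (intro exI[of _ "coeff s i"] conjI i allI impI, elim conjE)
      fix \<phi> :: "'r \<Rightarrow> 'k"
      assume \<phi>: "hom_mod {0} \<phi>" and v: "\<forall>c. [:c:] \<in> P \<longrightarrow> \<phi> c = 0" and nz: "\<phi> (coeff s i) \<noteq> 0"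
      have 0: "\<phi> 0 = 0" using hom_modD(5)[OF \<phi>] .
      have "coeff (map_poly \<phi> s) i \<noteq> 0" using nz 0 by (simp add: coeff_map_poly)
      then obtain \<xi> where "poly (map_poly \<phi> s) \<xi> \<noteq> 0"
        using alg_closed_nonroot[of "map_poly \<phi> s"] by (metis coeff_0)
      moreover have "map_poly \<phi> f = 0" if "f \<in> P" for f
        using True v that by (intro poly_eqI) (simp add: coeff_map_poly 0)
      ultimately show "\<exists>\<xi>. (\<forall>f\<in>P. peval \<phi> \<xi> f = 0) \<and> peval \<phi> \<xi> s \<noteq> 0"
        by (intro exI[of _ \<xi>]) (simp add: peval_eq_poly 0)
    qed
  next
    case False
    then have "\<exists>p. p \<in> P \<and> [:lead_coeff p:] \<notin> P"
      using ideal_lead_coeff_reduce[OF idl idl] by blast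
    then obtain p where pP: "p \<in> P" and pc: "[:lead_coeff p:] \<notin> P"
      and pmin: "\<And>f. f \<in> P \<Longrightarrow> [:lead_coeff f:] \<notin> P \<Longrightarrow> degree p \<le> degree f"
      using ex_has_least_nat[of "\<lambda>p. p \<in> P \<and> [:lead_coeff p:] \<notin> P" _ degree] by metis
    have small: "[:coeff f i:] \<in> P" if "f \<in> P" "f = 0 \<or> degree f < degree p" for f i
      using ideal_lead_coeff_reduce[OF idl idl subset_refl that(1), of i] pmin that(2) I(1)
      by (metis coeff_0 leD le_trans pCons_0_0)
    have degp: "degree p > 0"
    proof (rule ccontr)
      assume "\<not> degree p > 0"
      then obtain c where "p = [:c:]" by (meson degree_eq_zeroE neq0_conv)
      with pP pc show False by simp
    qed
    have p0: "p \<noteq> 0" using degp by auto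
    \<comment> \<open>\<open>J\<close> is generated by \<open>P\<close> and \<open>s\<close>. The
      element \<open>g\<close> chosen in it will turn out to be a constant \<open>r0\<close> outside
      \<open>P\<close>, so that \<open>s\<close> divides \<open>r0\<close> modulo \<open>P\<close>
      and cannot vanish where \<open>r0\<close> does not.\<close>
    define J where "J = {f + v * s | f v. f \<in> P}"
    have J: "two_sided_ideal J"
      unfolding two_sided_ideal_def
    proof (intro conjI ballI allI)
      show "0 \<in> J" unfolding J_def using I(1) by (intro CollectI exI[of _ 0] exI[of _ 0]) simp
      fix a assume "a \<in> J"
      then obtain f v where a: "a = f + v * s" "f \<in> P" by (auto simp: J_def)
      {
        fix b assume "b \<in> J"
        then obtain g w where b: "b = g + w * s" "g \<in> P" by (auto simp: J_def)
        show "a - b \<in> J"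
          unfolding J_def a b using I(2) a b
          by (intro CollectI exI[of _ "f - g"] exI[of _ "v - w"]) (simp add: algebra_simps)
      }
      show *: "a * h \<in> J" for h
        unfolding J_def a using I(4) a
        by (intro CollectI exI[of _ "f * h"] exI[of _ "v * h"]) (simp add: algebra_simps)
      show "h * a \<in> J" for h using *[of h] by (simp add: mult.commute)
    qed
    have PJ: "P \<subseteq> J"
    proof
      fix f assume "f \<in> P"
      then show "f \<in> J" unfolding J_def by (intro CollectI exI[of _ f] exI[of _ 0]) simp
    qed
    have sJ: "s \<in> J" unfolding J_def using I(1) by (intro CollectI exI[of _ 0] exI[of _ 1]) simp
    have "\<exists>g. g \<in> J \<and> [:lead_coeff g:] \<notin> P" using pP pc PJ by blast
    then obtain g where gJ: "g \<in> J" and gc: "[:lead_coeff g:] \<notin> P"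
      and gmin: "\<And>f. f \<in> J \<Longrightarrow> [:lead_coeff f:] \<notin> P \<Longrightarrow> degree g \<le> degree f"
      using ex_has_least_nat[of "\<lambda>p. p \<in> J \<and> [:lead_coeff p:] \<notin> P" _ degree] by metis
    have g0: "g \<noteq> 0" using gc I(1) by auto
    have smallJ: "[:coeff f i:] \<in> P" if "f \<in> J" "f = 0 \<or> degree f < degree g" for f i
      using ideal_lead_coeff_reduce[OF idl J PJ that(1), of i] gmin that(2) I(1)
      by (metis coeff_0 leD le_trans pCons_0_0)
    have div: "\<exists>e k r. smult (lead_coeff b ^ e) f = b * k + r \<and> (r = 0 \<or> degree r < degree b)"
      if "b \<noteq> 0" for b f :: "'r poly"
      using pseudo_divmod[OF that, of f] by (metis surj_pair)
    have remJ: "(\<forall>i. [:coeff r i:] \<in> P) \<and> r \<in> P"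
      if "smult c f = g * k + r" "f \<in> J" "r = 0 \<or> degree r < degree g" for f k r c
    proof -
      have "r = [:c:] * f - g * k" using that(1) by simp
      then have "r \<in> J" using that(2) gJ two_sided_idealD[OF J] by metis
      then have "\<forall>i. [:coeff r i:] \<in> P" using smallJ that(3) by blast
      then show ?thesis using coeffs_in_imp_mem[OF idl] by blast
    qed
    have gP: "g \<notin> P"
    proof
      assume "g \<in> P"
      obtain e k r where e: "smult (lead_coeff g ^ e) s = g * k + r" "r = 0 \<or> degree r < degree g"
        using div[OF g0] by blast
      have "r \<in> P" using remJ[OF e(1) sJ e(2)] by blast
      then have "[:lead_coeff g ^ e:] * s \<in> P" using e(1) \<open>g \<in> P\<close> I(3,4) by simp
      with pr pw s gc show False by blast
    qed
    obtain e k r where e: "smult (lead_coeff g ^ e) p = g * k + r" "r = 0 \<or> degree r < degree g"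
      using div[OF g0] by blast
    have rP: "r \<in> P" "\<And>i. [:coeff r i:] \<in> P" using remJ[OF e(1) _ e(2)] pP PJ by auto
    have "g * k = [:lead_coeff g ^ e:] * p - r" using e(1) by simp
    then have "g * k \<in> P" using pP rP I(2,5) by metis
    then have kP: "k \<in> P" using pr gP by blast
    have gp: "degree g \<le> degree p" using gmin pP pc PJ by blast
    \<comment> \<open>If \<open>g\<close> were not constant, the quotient \<open>k\<close> would
      have smaller degree than \<open>p\<close>, so minimality of \<open>p\<close> puts all
      coefficients of \<open>k\<close> into \<open>P\<close>; comparing coefficients at
      \<open>degree p\<close> then puts a product of leading coefficients into
      \<open>P\<close>.\<close>
    have "degree g = 0"
    proof (rule ccontr)
      assume "degree g \<noteq> 0"
      have "k = 0 \<or> degree k < degree p"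
      proof (cases "k = 0")
        case False
        have "degree (g * k) \<le> degree p"
          unfolding \<open>g * k = _\<close>
        proof (rule degree_diff_le)
          show "degree ([:lead_coeff g ^ e:] * p) \<le> degree p" using degree_smult_le by simp
          show "degree r \<le> degree p" using e(2) gp by auto
        qed
        then show ?thesis using False g0 \<open>degree g \<noteq> 0\<close> by (simp add: degree_mult_eq)
      qed simp
      then have kc: "[:coeff k i:] \<in> P" for i using small kP by blast
      have sumP: "[:\<Sum>i\<in>A. u i:] \<in> P" if "\<And>i. i \<in> A \<Longrightarrow> [:u i:] \<in> P" for A and u :: "nat \<Rightarrow> 'r"
        using that
      proof (induction A rule: infinite_finite_induct)
        case (insert x F)
        have "[:u x:] + [:sum u F:] \<in> P" using insert by (intro I(3)) auto
        then show ?case using insert by simp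
      qed (use I(1) in auto)
      have "[:coeff (g * k) (degree p):] \<in> P"
        unfolding coeff_mult
      proof (rule sumP)
        fix i
        have "[:coeff g i:] * [:coeff k (degree p - i):] \<in> P" by (intro I(5) kc)
        then show "[:coeff g i * coeff k (degree p - i):] \<in> P" by (simp add: mult.commute)
      qed
      then have "[:coeff (g * k) (degree p):] + [:coeff r (degree p):] \<in> P" using rP I(3) by blast
      moreover have "coeff (g * k) (degree p) + coeff r (degree p) = lead_coeff g ^ e * lead_coeff p"
        by (metis coeff_add coeff_smult e(1))
      ultimately have "[:lead_coeff g ^ e:] * [:lead_coeff p:] \<in> P" by (simp add: mult.commute)
      with pr pw gc pc show False by blast
    qed
    then obtain r0 where r0: "g = [:r0:]" by (meson degree_eq_zeroE)
    obtain f v where fv: "g = f + v * s" "f \<in> P" using gJ by (auto simp: J_def)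
    show ?thesis
    \<comment> \<open>The factor \<open>lead_coeff p\<close> keeps the image of \<open>p\<close>
      nonconstant, so that it has a root; the factor \<open>r0\<close> keeps \<open>s\<close>
      nonzero at that root.\<close>
    proof (intro exI[of _ "r0 * lead_coeff p"] conjI allI impI; (elim conjE)?)
      show "[:r0 * lead_coeff p:] \<notin> P"
      proof
        assume "[:r0 * lead_coeff p:] \<in> P"
        then have "[:r0:] * [:lead_coeff p:] \<in> P" by (simp add: mult.commute)
        with pr gc pc r0 show False by fastforce
      qed
    next
      fix \<phi> :: "'r \<Rightarrow> 'k"
      assume \<phi>: "hom_mod {0} \<phi>" and v: "\<forall>c. [:c:] \<in> P \<longrightarrow> \<phi> c = 0" and nz: "\<phi> (r0 * lead_coeff p) \<noteq> 0"
      have 0: "\<phi> 0 = 0" using hom_modD(5)[OF \<phi>] .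
      have \<phi>m: "\<phi> (a * b) = \<phi> a * \<phi> b" for a b using \<phi> by (simp add: hom_mod_zero_iff)
      have \<phi>nz: "\<phi> r0 \<noteq> 0" "\<phi> (lead_coeff p) \<noteq> 0" using nz \<phi>m by auto
      have \<phi>p: "\<phi> (a ^ n) = \<phi> a ^ n" for a n
        using hom_modD(2)[OF \<phi>] by (induction n) (simp_all add: \<phi>m)
      have "coeff (map_poly \<phi> p) (degree p) \<noteq> 0" using \<phi>nz 0 by (simp add: coeff_map_poly)
      then have "degree (map_poly \<phi> p) > 0" using degp le_degree by fastforce
      then obtain \<xi> where "poly (map_poly \<phi> p) \<xi> = 0" using alg_closed_imp_poly_has_root by blast
      then have \<xi>: "peval \<phi> \<xi> p = 0" by (simp add: peval_eq_poly 0)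
      have E: "hom_mod {0} (peval \<phi> \<xi>)"
        by (rule hom_mod_peval[OF two_sided_ideal_zero \<phi>]) (simp add: eqmod_def mult.commute)
      then have Em: "peval \<phi> \<xi> (a * b) = peval \<phi> \<xi> a * peval \<phi> \<xi> b"
        and Ea: "peval \<phi> \<xi> (a + b) = peval \<phi> \<xi> a + peval \<phi> \<xi> b" for a b
        by (auto simp: hom_mod_zero_iff)
      \<comment> \<open>The remainder on division by \<open>p\<close> lies in \<open>P\<close> and
        has smaller degree, so its coefficients lie in \<open>P\<close> and are killed by
        \<phi>.\<close>
      have van: "peval \<phi> \<xi> h = 0" if "h \<in> P" for h
      proof -
        obtain e k r where e: "smult (lead_coeff p ^ e) h = p * k + r" "r = 0 \<or> degree r < degree p"
          using div[OF p0] by blast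
        have r: "r = [:lead_coeff p ^ e:] * h - p * k" using e(1) by simp
        have "r \<in> P" unfolding r by (intro I(2) I(4)[OF pP] I(5)[OF that])
        then have "\<phi> (coeff r i) = 0" for i using small e(2) v by blast
        then have "map_poly \<phi> r = 0" by (intro poly_eqI) (simp add: coeff_map_poly 0)
        then have "peval \<phi> \<xi> r = 0" by (simp add: peval_eq_poly 0)
        then have "peval \<phi> \<xi> ([:lead_coeff p ^ e:] * h) = 0"
          using e(1) \<xi> by (simp add: Ea Em)
        then show ?thesis using \<phi>nz unfolding Em by (simp add: peval_const 0 \<phi>p)
      qed
      have "peval \<phi> \<xi> g = peval \<phi> \<xi> v * peval \<phi> \<xi> s" using fv van by (simp add: Ea Em)
      moreover have "peval \<phi> \<xi> g \<noteq> 0" using \<phi>nz r0 by (simp add: peval_const 0)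
      ultimately show "\<exists>\<xi>. (\<forall>f\<in>P. peval \<phi> \<xi> f = 0) \<and> peval \<phi> \<xi> s \<noteq> 0"
        using van by (intro exI[of _ \<xi>]) auto
    qed
  qed
qed

section \<open>Maximal right ideals\<close>

text \<open>Maximality is phrased as right invertibility modulo \<open>I\<close> of every element
  outside \<open>I\<close>, which says that every nonzero coset generates the quotient
  module.\<close>

locale maximal_right_ideal =
  fixes I :: "'a::ring_1 set" and \<kappa> :: "'k::alg_closed_field \<Rightarrow> 'a"
  assumes zero_mem: "0 \<in> I"
    and diff_mem: "a \<in> I \<Longrightarrow> b \<in> I \<Longrightarrow> a - b \<in> I"
    and mult_mem: "a \<in> I \<Longrightarrow> a * p \<in> I"
    and one_notin: "1 \<notin> I"
    and maximal: "a \<notin> I \<Longrightarrow> \<exists>g. 1 - a * g \<in> I"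
    and \<kappa>_add: "\<kappa> (c + d) = \<kappa> c + \<kappa> d"
    and \<kappa>_mult: "\<kappa> (c * d) = \<kappa> c * \<kappa> d"
    and \<kappa>_one: "\<kappa> 1 = 1"
    and \<kappa>_comm: "p * \<kappa> c = \<kappa> c * p"
begin

text \<open>
  \<open>N\<close> is the annihilator of the right module of cosets of \<open>I\<close>: congruence modulo \<open>I\<close> is equality of
  vectors, congruence modulo \<open>N\<close> equality of operators.
\<close>

definition N :: "'a set" where
  "N = {n. \<forall>p. p * n \<in> I}"

definition eqI :: "'a \<Rightarrow> 'a \<Rightarrow> bool" (infix "\<approx>" 50) where
  "a \<approx> b \<longleftrightarrow> a - b \<in> I"

abbreviation eqN :: "'a \<Rightarrow> 'a \<Rightarrow> bool" (infix "\<cong>\<^sub>N" 50) where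
  "a \<cong>\<^sub>N b \<equiv> eqmod N a b"

lemma neg_mem: "a \<in> I \<Longrightarrow> - a \<in> I"
  using diff_mem[OF zero_mem, of a] by simp

lemma add_mem: "a \<in> I \<Longrightarrow> b \<in> I \<Longrightarrow> a + b \<in> I"
  using diff_mem[of a "- b"] neg_mem by simp

lemma N_subset: "n \<in> N \<Longrightarrow> n \<in> I"
  unfolding N_def by (metis (no_types, lifting) mem_Collect_eq mult_1)

lemma N_ideal: "two_sided_ideal N"
  unfolding two_sided_ideal_def N_def
  by (auto simp: zero_mem right_diff_distrib diff_mem mult_mem mult.assoc[symmetric])

lemma eqI_refl [simp]: "a \<approx> a"
  by (simp add: eqI_def zero_mem)

lemma eqI_sym: "a \<approx> b \<Longrightarrow> b \<approx> a"
  unfolding eqI_def using neg_mem[of "a - b"] by simp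

lemma eqI_trans [trans]: "a \<approx> b \<Longrightarrow> b \<approx> c \<Longrightarrow> a \<approx> c"
  unfolding eqI_def using add_mem[of "a - b" "b - c"] by simp

lemma eqI_add: "a \<approx> b \<Longrightarrow> c \<approx> d \<Longrightarrow> a + c \<approx> b + d"
  unfolding eqI_def using add_mem[of "a - b" "c - d"] by (simp add: algebra_simps)

lemma eqI_diff: "a \<approx> b \<Longrightarrow> c \<approx> d \<Longrightarrow> a - c \<approx> b - d"
  unfolding eqI_def using diff_mem[of "a - b" "c - d"] by (simp add: algebra_simps)

lemma eqI_mult: "a \<approx> b \<Longrightarrow> a * p \<approx> b * p"
  unfolding eqI_def using mult_mem[of "a - b" p] by (simp add: algebra_simps)

lemma eqI_\<kappa>: "a \<approx> b \<Longrightarrow> \<kappa> c * a \<approx> \<kappa> c * b"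
  using eqI_mult[of a b "\<kappa> c"] by (simp add: \<kappa>_comm)

text \<open>How operator identities act on vectors: \<open>u\<close> and \<open>v\<close> may be
  exchanged behind any \<open>p\<close>. What follows a vector is handled by
  \<open>eqI_mult\<close>; apart from scalars, \<approx> admits no multiplication on the
  left.\<close>

lemma eqN_imp_eqI: "u \<cong>\<^sub>N v \<Longrightarrow> p * u \<approx> p * v"
  by (simp add: eqI_def eqmod_def N_def right_diff_distrib)

lemma eqI_sum: "(\<And>i. i \<in> A \<Longrightarrow> f i \<approx> g i) \<Longrightarrow> sum f A \<approx> sum g A"
  by (induction A rule: infinite_finite_induct) (simp_all add: eqI_add)

lemma eqI_0_iff: "a \<approx> 0 \<longleftrightarrow> a \<in> I"
  by (simp add: eqI_def)

lemma eqI_mem: "a \<approx> b \<Longrightarrow> a \<in> I \<longleftrightarrow> b \<in> I"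
  by (meson eqI_0_iff eqI_sym eqI_trans)

lemma \<kappa>_0 [simp]: "\<kappa> 0 = 0"
  using \<kappa>_add[of 0 0] by simp

lemma \<kappa>_diff: "\<kappa> (c - d) = \<kappa> c - \<kappa> d"
  using \<kappa>_add[of "c - d" d] by simp

lemma \<kappa>_uminus: "\<kappa> (- c) = - \<kappa> c"
  using \<kappa>_diff[of 0 c] by simp

lemma \<kappa>_mult_mem_iff: "c \<noteq> 0 \<Longrightarrow> \<kappa> c * a \<in> I \<longleftrightarrow> a \<in> I"
proof
  assume "c \<noteq> 0" "\<kappa> c * a \<in> I"
  then have "\<kappa> c * a * \<kappa> (inverse c) \<in> I" using mult_mem by blast
  moreover have "\<kappa> c * a * \<kappa> (inverse c) = \<kappa> (inverse c * c) * a"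
    using \<kappa>_comm[of "\<kappa> c * a" "inverse c"] by (simp add: \<kappa>_mult mult.assoc)
  ultimately show "a \<in> I" using \<open>c \<noteq> 0\<close> by (simp add: \<kappa>_one)
next
  assume "a \<in> I"
  then show "\<kappa> c * a \<in> I" using mult_mem[of a "\<kappa> c"] by (simp add: \<kappa>_comm)
qed

lemma \<kappa>_mem_iff: "\<kappa> c \<in> I \<longleftrightarrow> c = 0"
  using \<kappa>_mult_mem_iff[of c 1] one_notin by (cases "c = 0") (simp_all add: zero_mem)

lemma hom_mod_\<kappa>: "hom_mod N \<kappa>"
  unfolding hom_mod_def \<kappa>_add \<kappa>_one \<kappa>_mult
  using \<kappa>_comm eqmod_refl[OF N_ideal] by metis

definition central :: "'a \<Rightarrow> bool" where
  "central c \<longleftrightarrow> (\<forall>p. c * p \<cong>\<^sub>N p * c)"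

text \<open>The surjective half of Schur's lemma. A central \<open>c\<close> in \<open>I\<close>
  would kill every coset, so \<open>c\<close> outside \<open>N\<close> is outside \<open>I\<close>
  and has a right inverse modulo \<open>I\<close>; centrality moves \<open>c\<close> to the other
  end.\<close>

lemma central_surj:
  assumes c: "central c" and "c \<notin> N"
  shows "\<exists>p'. p \<approx> p' * c"
proof -
  have eq: "c * p \<approx> p * c" for p
    using c eqN_imp_eqI[of "c * p" "p * c" 1] by (simp add: central_def)
  have "c \<notin> I"
  proof
    assume "c \<in> I"
    then have "p * c \<in> I" for p using eqI_mem[OF eq] mult_mem by blast
    with assms(2) show False by (simp add: N_def)
  qed
  then obtain g where "1 - c * g \<in> I" using maximal by blast
  then have "(1 - c * g) * p \<in> I" by (rule mult_mem)
  then have "p \<approx> c * (g * p)" by (simp add: eqI_def algebra_simps)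
  also have "\<dots> \<approx> (g * p) * c" by (rule eq)
  finally show ?thesis by blast
qed

text \<open>Nonzero central operators are surjective by \<open>central_surj\<close>, so a product of
  two of them is surjective and cannot be zero.\<close>

lemma hom_mod_kernel_prime:
  assumes \<rho>: "hom_mod N \<rho>"
  shows "prime_set {f. \<rho> f \<in> N}"
  unfolding prime_set_def
proof (intro conjI allI impI)
  note NI = two_sided_idealD[OF N_ideal]
  have mem: "u \<in> N \<longleftrightarrow> v \<in> N" if "u \<cong>\<^sub>N v" for u v
    using that NI(3)[of "u - v" v] NI(2)[of u "u - v"] by (auto simp: eqmod_def)
  have m: "\<rho> (f * g) \<in> N \<longleftrightarrow> \<rho> f * \<rho> g \<in> N" for f g
    by (rule mem[OF hom_modD(3)[OF \<rho>]])
  have m': "\<rho> (f * g) \<in> N \<longleftrightarrow> \<rho> g * \<rho> f \<in> N" for f g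
    using m[of g f] by (simp add: mult.commute)
  show "two_sided_ideal {f. \<rho> f \<in> N}"
    unfolding two_sided_ideal_def by (auto simp: hom_modD[OF \<rho>] m NI)
  fix f g assume "f * g \<in> {f. \<rho> f \<in> N}"
  then have fg: "\<rho> g * \<rho> f \<in> N" using m' by simp
  show "f \<in> {f. \<rho> f \<in> N} \<or> g \<in> {f. \<rho> f \<in> N}"
  proof (rule ccontr)
    assume "\<not> ?thesis"
    then have "\<rho> f \<notin> N" "\<rho> g \<notin> N" by auto
    moreover have "central (\<rho> h)" for h by (simp add: central_def hom_modD(4)[OF \<rho>])
    ultimately obtain p p' where p: "1 \<approx> p * \<rho> f" "p \<approx> p' * \<rho> g" using central_surj by meson
    have "1 \<approx> p' * \<rho> g * \<rho> f" using p(1) eqI_mult[OF p(2)] eqI_trans by blast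
    moreover have "p' * (\<rho> g * \<rho> f) \<in> I" using fg by (simp add: N_def)
    ultimately show False using eqI_mem one_notin by (simp add: mult.assoc)
  qed
qed

definition generates :: "('r \<Rightarrow> 'a) \<Rightarrow> 'a set \<Rightarrow> bool" where
  "generates \<rho> E \<longleftrightarrow> finite E \<and> (\<forall>p. \<exists>f. p \<approx> (\<Sum>e\<in>E. e * \<rho> (f e)))"

text \<open>
  Nakayama's lemma without determinants: a nonzero central element acts bijectively, which allows the
  generators to be removed one after another.
\<close>

lemma nakayama:
  fixes \<phi> :: "'r::comm_ring_1 \<Rightarrow> 'k"
  assumes \<rho>: "hom_mod N \<rho>" and \<phi>: "hom_mod {0} \<phi>" and van: "\<And>f. \<rho> f \<in> N \<Longrightarrow> \<phi> f = 0"
    and d: "\<phi> d = 0" "\<rho> d \<notin> N" and gen: "generates \<rho> E"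
  shows False
proof -
  have cen: "central (\<rho> h)" for h by (simp add: central_def hom_modD(4)[OF \<rho>])
  have mul: "e * \<rho> f * \<rho> g \<approx> e * \<rho> (f * g)" for e f g
    using eqN_imp_eqI[OF hom_modD(3)[OF \<rho>], of e f g] by (simp add: mult.assoc eqI_sym)
  have \<phi>m: "\<phi> (a * b) = \<phi> a * \<phi> b" for a b using \<phi> by (simp add: hom_mod_zero_iff)
  have "finite E" using gen by (simp add: generates_def)
  then have "\<not> (\<forall>p. \<exists>f. p \<approx> (\<Sum>e\<in>E. e * \<rho> (f e)))"
  proof (induction E)
    case empty
    then show ?case using one_notin by (auto simp: eqI_0_iff)
  next
    case (insert e E)
    show ?case
    proof
      assume g: "\<forall>p. \<exists>f. p \<approx> (\<Sum>e\<in>insert e E. e * \<rho> (f e))"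
      have g': "\<exists>f. p \<approx> e * \<rho> (f e) + (\<Sum>e\<in>E. e * \<rho> (f e))" for p
        using g insert.hyps by simp
      obtain p f where p: "e \<approx> p * \<rho> d" and f: "p \<approx> e * \<rho> (f e) + (\<Sum>e\<in>E. e * \<rho> (f e))"
        using central_surj[OF cen d(2)] g' by meson
      \<comment> \<open>\<open>h\<close> comes from collecting the terms in \<open>e\<close>. As
        \<open>\<phi> d = 0\<close>, it satisfies \<open>\<phi> h = 1\<close>, so
        \<open>\<rho> h\<close> is again surjective, while \<open>e * \<rho> h\<close> is a
        combination of the remaining generators.\<close>
      define h where "h = 1 - f e * d"
      have "e \<approx> (e * \<rho> (f e) + (\<Sum>e\<in>E. e * \<rho> (f e))) * \<rho> d"
        using p eqI_mult[OF f] eqI_trans by blast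
      also have "\<dots> = e * \<rho> (f e) * \<rho> d + (\<Sum>e\<in>E. e * \<rho> (f e) * \<rho> d)"
        by (simp add: distrib_right sum_distrib_right)
      also have "\<dots> \<approx> e * \<rho> (f e * d) + (\<Sum>e\<in>E. e * \<rho> (f e * d))"
        by (intro eqI_add eqI_sum mul)
      finally have "e - e * \<rho> (f e * d) \<approx> (\<Sum>e\<in>E. e * \<rho> (f e * d))"
        by (simp add: eqI_def algebra_simps)
      then have eh: "e * \<rho> h \<approx> (\<Sum>e\<in>E. e * \<rho> (f e * d))"
        by (simp add: h_def hom_modD[OF \<rho>] algebra_simps)
      have "\<phi> h = 1" using d(1) by (simp add: h_def hom_modD[OF \<phi>] \<phi>m)
      then have h: "\<rho> h \<notin> N" using van by fastforce
      have "\<exists>f. p \<approx> (\<Sum>e\<in>E. e * \<rho> (f e))" for p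
      proof -
        obtain p' f' where p': "p \<approx> p' * \<rho> h" and f': "p' \<approx> e * \<rho> (f' e) + (\<Sum>e\<in>E. e * \<rho> (f' e))"
          using central_surj[OF cen h] g' by meson
        have "p \<approx> (e * \<rho> (f' e) + (\<Sum>e\<in>E. e * \<rho> (f' e))) * \<rho> h"
          using p' eqI_mult[OF f'] eqI_trans by blast
        also have "\<dots> = e * (\<rho> (f' e) * \<rho> h) + (\<Sum>e\<in>E. e * \<rho> (f' e) * \<rho> h)"
          by (simp add: distrib_right sum_distrib_right mult.assoc)
        also have "\<dots> \<approx> e * \<rho> h * \<rho> (f' e) + (\<Sum>e\<in>E. e * \<rho> (f' e * h))"
          using eqN_imp_eqI[OF hom_modD(4)[OF \<rho>]] by (intro eqI_add eqI_sum mul) (simp add: mult.assoc)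
        also have "\<dots> \<approx> (\<Sum>e\<in>E. e * \<rho> (f e * d)) * \<rho> (f' e) + (\<Sum>e\<in>E. e * \<rho> (f' e * h))"
          by (intro eqI_add eqI_mult eh eqI_refl)
        also have "\<dots> = (\<Sum>a\<in>E. a * \<rho> (f a * d) * \<rho> (f' e)) + (\<Sum>e\<in>E. e * \<rho> (f' e * h))"
          by (simp add: sum_distrib_right)
        also have "\<dots> \<approx> (\<Sum>a\<in>E. a * \<rho> (f a * d * f' e)) + (\<Sum>e\<in>E. e * \<rho> (f' e * h))"
          by (intro eqI_add eqI_sum mul eqI_refl)
        also have "\<dots> = (\<Sum>a\<in>E. a * \<rho> (f a * d * f' e + f' a * h))"
          by (simp add: sum.distrib hom_modD(1)[OF \<rho>] distrib_left)
        finally show ?thesis by (intro exI[of _ "\<lambda>a. f a * d * f' e + f' a * h"])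
      qed
      with insert.IH show False by blast
    qed
  qed
  with gen show False by (simp add: generates_def)
qed

abbreviation peval3 :: "'a \<Rightarrow> 'a \<Rightarrow> 'a \<Rightarrow> 'k poly poly poly \<Rightarrow> 'a" where
  "peval3 a b c \<equiv> peval (peval (peval \<kappa> a) b) c"

text \<open>The kernel of the evaluation has a common zero: three uses of
  \<open>prime_set_extension\<close> strip off the variables, each passing on a nonvanishing
  condition, and the coordinates are then picked in the opposite order. By \<open>nakayama\<close>,
  a polynomial vanishing at that point acts as zero; this is applied to each variable minus its
  coordinate.\<close>

lemma central_scalars:
  assumes a: "central a1" "central a2" "central a3" and gen: "generates (peval3 a1 a2 a3) E"
  shows "\<exists>c1 c2 c3. a1 \<cong>\<^sub>N \<kappa> c1 \<and> a2 \<cong>\<^sub>N \<kappa> c2 \<and> a3 \<cong>\<^sub>N \<kappa> c3"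
proof -
  let ?\<rho>1 = "peval \<kappa> a1" and ?\<rho>2 = "peval (peval \<kappa> a1) a2" and ?\<rho>3 = "peval3 a1 a2 a3"
  have a': "eqmod N (a1 * p) (p * a1)" "eqmod N (a2 * p) (p * a2)" "eqmod N (a3 * p) (p * a3)" for p
    using a by (auto simp: central_def)
  have \<rho>1: "hom_mod N ?\<rho>1" by (rule hom_mod_peval[OF N_ideal hom_mod_\<kappa> a'(1)])
  have \<rho>2: "hom_mod N ?\<rho>2" by (rule hom_mod_peval[OF N_ideal \<rho>1 a'(2)])
  have \<rho>3: "hom_mod N ?\<rho>3" by (rule hom_mod_peval[OF N_ideal \<rho>2 a'(3)])
  have 1: "1 \<notin> N" using N_subset one_notin by blast
  have c3: "?\<rho>3 [:h:] = ?\<rho>2 h" for h by (rule peval_const[where \<rho> = ?\<rho>2, OF hom_modD(5)[OF \<rho>2]])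
  have c2: "?\<rho>2 [:h:] = ?\<rho>1 h" for h by (rule peval_const[where \<rho> = ?\<rho>1, OF hom_modD(5)[OF \<rho>1]])
  have c1: "?\<rho>1 [:h:] = \<kappa> h" for h by (simp add: peval_const)
  have s3: "1 \<notin> {f. ?\<rho>3 f \<in> N}" using 1 hom_modD(2)[OF \<rho>3] by simp
  obtain r3 where r3: "[:r3:] \<notin> {f. ?\<rho>3 f \<in> N}"
    and e3: "\<And>\<phi> :: _ \<Rightarrow> 'k. hom_mod {0} \<phi> \<and> (\<forall>c. [:c:] \<in> {f. ?\<rho>3 f \<in> N} \<longrightarrow> \<phi> c = 0) \<and> \<phi> r3 \<noteq> 0 \<Longrightarrow>
          \<exists>\<xi>. (\<forall>f\<in>{f. ?\<rho>3 f \<in> N}. peval \<phi> \<xi> f = 0) \<and> peval \<phi> \<xi> 1 \<noteq> 0"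
    using prime_set_extension[where 'k = 'k, OF hom_mod_kernel_prime[OF \<rho>3] s3] by blast
  have s2: "r3 \<notin> {f. ?\<rho>2 f \<in> N}" using r3 c3 by simp
  obtain r2 where r2: "[:r2:] \<notin> {f. ?\<rho>2 f \<in> N}"
    and e2: "\<And>\<phi> :: _ \<Rightarrow> 'k. hom_mod {0} \<phi> \<and> (\<forall>c. [:c:] \<in> {f. ?\<rho>2 f \<in> N} \<longrightarrow> \<phi> c = 0) \<and> \<phi> r2 \<noteq> 0 \<Longrightarrow>
          \<exists>\<xi>. (\<forall>f\<in>{f. ?\<rho>2 f \<in> N}. peval \<phi> \<xi> f = 0) \<and> peval \<phi> \<xi> r3 \<noteq> 0"
    using prime_set_extension[where 'k = 'k, OF hom_mod_kernel_prime[OF \<rho>2] s2] by blast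
  have s1: "r2 \<notin> {f. ?\<rho>1 f \<in> N}" using r2 c2 by simp
  obtain r1 where r1: "[:r1:] \<notin> {f. ?\<rho>1 f \<in> N}"
    and e1: "\<And>\<phi> :: _ \<Rightarrow> 'k. hom_mod {0} \<phi> \<and> (\<forall>c. [:c:] \<in> {f. ?\<rho>1 f \<in> N} \<longrightarrow> \<phi> c = 0) \<and> \<phi> r1 \<noteq> 0 \<Longrightarrow>
          \<exists>\<xi>. (\<forall>f\<in>{f. ?\<rho>1 f \<in> N}. peval \<phi> \<xi> f = 0) \<and> peval \<phi> \<xi> r2 \<noteq> 0"
    using prime_set_extension[where 'k = 'k, OF hom_mod_kernel_prime[OF \<rho>1] s1] by blast
  have comm: "eqmod {0} (\<xi> * p) (p * \<xi>)" for \<xi> p :: 'k by (simp add: eqmod_def)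
  let ?\<phi>0 = "\<lambda>c::'k. c"
  have \<phi>0: "hom_mod {0} ?\<phi>0" by (simp add: hom_mod_zero_iff)
  have "r1 \<noteq> 0" using r1 two_sided_idealD(1)[OF N_ideal] by auto
  then obtain \<xi>1 where \<xi>1: "\<And>f. ?\<rho>1 f \<in> N \<Longrightarrow> peval ?\<phi>0 \<xi>1 f = 0" "peval ?\<phi>0 \<xi>1 r2 \<noteq> 0"
    using e1[of ?\<phi>0] \<phi>0 c1 N_subset \<kappa>_mem_iff by auto
  let ?\<phi>1 = "peval ?\<phi>0 \<xi>1"
  have \<phi>1: "hom_mod {0} ?\<phi>1" by (rule hom_mod_peval[OF two_sided_ideal_zero \<phi>0 comm])
  obtain \<xi>2 where \<xi>2: "\<And>f. ?\<rho>2 f \<in> N \<Longrightarrow> peval ?\<phi>1 \<xi>2 f = 0" "peval ?\<phi>1 \<xi>2 r3 \<noteq> 0"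
    using e2[of ?\<phi>1] \<phi>1 c2 \<xi>1 by auto
  let ?\<phi>2 = "peval ?\<phi>1 \<xi>2"
  have \<phi>2: "hom_mod {0} ?\<phi>2" by (rule hom_mod_peval[OF two_sided_ideal_zero \<phi>1 comm])
  obtain \<xi>3 where \<xi>3: "\<And>f. ?\<rho>3 f \<in> N \<Longrightarrow> peval ?\<phi>2 \<xi>3 f = 0"
    using e3[of ?\<phi>2] \<phi>2 c3 \<xi>2 by auto
  let ?\<phi>3 = "peval ?\<phi>2 \<xi>3"
  have \<phi>3: "hom_mod {0} ?\<phi>3" by (rule hom_mod_peval[OF two_sided_ideal_zero \<phi>2 comm])
  have key: "?\<rho>3 d \<in> N" if "?\<phi>3 d = 0" for d
    using nakayama[OF \<rho>3 \<phi>3 \<xi>3 that _ gen] by blast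
  have d3: "?\<phi>3 [:h:] = ?\<phi>2 h" for h by (rule peval_const[where \<rho> = ?\<phi>2, OF hom_modD(5)[OF \<phi>2]])
  have d2: "?\<phi>2 [:h:] = ?\<phi>1 h" for h by (rule peval_const[where \<rho> = ?\<phi>1, OF hom_modD(5)[OF \<phi>1]])
  have d1: "?\<phi>1 [:h:] = h" for h by (simp add: peval_const)
  have v3: "?\<phi>3 [:0, 1:] = \<xi>3" "?\<rho>3 [:0, 1:] = a3"
    by (simp_all add: peval_var[where \<rho> = ?\<phi>2, OF hom_modD(5,2)[OF \<phi>2]] peval_var[where \<rho> = ?\<rho>2, OF hom_modD(5,2)[OF \<rho>2]])
  have v2: "?\<phi>2 [:0, 1:] = \<xi>2" "?\<rho>2 [:0, 1:] = a2"
    by (simp_all add: peval_var[where \<rho> = ?\<phi>1, OF hom_modD(5,2)[OF \<phi>1]] peval_var[where \<rho> = ?\<rho>1, OF hom_modD(5,2)[OF \<rho>1]])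
  have v1: "?\<phi>1 [:0, 1:] = \<xi>1" "?\<rho>1 [:0, 1:] = a1"
    by (simp_all add: peval_var \<kappa>_one)
  have "?\<phi>3 ([:0, 1:] - [:[:[:\<xi>3:]:]:]) = 0"
    unfolding hom_modD(6)[OF \<phi>3] d3 d2 d1 v3 by simp
  from key[OF this] have "a3 - \<kappa> \<xi>3 \<in> N"
    unfolding hom_modD(6)[OF \<rho>3] c3 c2 c1 v3 .
  moreover have "?\<phi>3 ([:[:0, 1:]:] - [:[:[:\<xi>2:]:]:]) = 0"
    unfolding hom_modD(6)[OF \<phi>3] d3 d2 d1 v2 by simp
  from key[OF this] have "a2 - \<kappa> \<xi>2 \<in> N"
    unfolding hom_modD(6)[OF \<rho>3] c3 c2 c1 v2 .
  moreover have "?\<phi>3 ([:[:[:0, 1:]:]:] - [:[:[:\<xi>1:]:]:]) = 0"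
    unfolding hom_modD(6)[OF \<phi>3] d3 d2 d1 v1 by simp
  from key[OF this] have "a1 - \<kappa> \<xi>1 \<in> N"
    unfolding hom_modD(6)[OF \<rho>3] c3 c2 c1 v1 .
  ultimately show ?thesis unfolding eqmod_def by blast
qed

end

section \<open>The algebra acting on a quotient by a maximal right ideal\<close>

text \<open>The sum of all \<open>u ^ i * w ^ j\<close> with i + j = n, that is (u^(n+1) - w^(n+1))
  / (u - w) if u and w differ. For distinct l-th roots of unity it vanishes at n = l - 1.\<close>

fun gsum :: "'k::field \<Rightarrow> 'k \<Rightarrow> nat \<Rightarrow> 'k" where
  "gsum u w 0 = 1"
| "gsum u w (Suc n) = w * gsum u w n + u ^ Suc n"

lemma gsum_eq: "(u - w) * gsum u w n = u ^ Suc n - w ^ Suc n"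
proof (induction n)
  case (Suc n)
  have "(u - w) * gsum u w (Suc n) = w * ((u - w) * gsum u w n) + (u - w) * u ^ Suc n"
    by (simp add: algebra_simps)
  then show ?case unfolding Suc.IH by (simp add: algebra_simps)
qed simp

context maximal_right_ideal
begin

definition smul :: "'k \<Rightarrow> 'a \<Rightarrow> 'a" (infixr "*\<^sub>K" 75) where
  "c *\<^sub>K p = \<kappa> c * p"

lemma smul_simps [simp]:
  "(c *\<^sub>K p) * r = c *\<^sub>K (p * r)" "p * (c *\<^sub>K r) = c *\<^sub>K (p * r)"
  "c *\<^sub>K d *\<^sub>K p = (c * d) *\<^sub>K p" "0 *\<^sub>K p = 0" "1 *\<^sub>K p = p" "c *\<^sub>K 0 = 0"
  unfolding smul_def using \<kappa>_comm[of p c] by (simp_all add: \<kappa>_mult \<kappa>_one mult.assoc[symmetric])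

lemma smul_distrib:
  "c *\<^sub>K (p + r) = c *\<^sub>K p + c *\<^sub>K r" "c *\<^sub>K (p - r) = c *\<^sub>K p - c *\<^sub>K r"
  "(c + d) *\<^sub>K p = c *\<^sub>K p + d *\<^sub>K p" "(c - d) *\<^sub>K p = c *\<^sub>K p - d *\<^sub>K p"
  "(- c) *\<^sub>K p = - (c *\<^sub>K p)" "c *\<^sub>K (- p) = - (c *\<^sub>K p)"
  by (simp_all add: smul_def algebra_simps \<kappa>_add \<kappa>_diff \<kappa>_uminus)

lemma \<kappa>_eq_smul: "\<kappa> c = c *\<^sub>K 1"
  by (simp add: smul_def)

lemma eqI_smul: "a \<approx> b \<Longrightarrow> c *\<^sub>K a \<approx> c *\<^sub>K b"
  unfolding smul_def by (rule eqI_\<kappa>)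

lemmas eqN_refl [simp] = eqmod_refl[OF N_ideal]
lemmas eqN_sym = eqmod_sym[OF N_ideal]
lemmas eqN_trans [trans] = eqmod_trans[OF N_ideal]
lemmas eqN_add = eqmod_add[OF N_ideal]
lemmas eqN_diff = eqmod_diff[OF N_ideal]
lemmas eqN_mult = eqmod_mult[OF N_ideal]

lemma eq_eqN_trans [trans]: "a = b \<Longrightarrow> b \<cong>\<^sub>N c \<Longrightarrow> a \<cong>\<^sub>N c"
  and eqN_eq_trans [trans]: "a \<cong>\<^sub>N b \<Longrightarrow> b = c \<Longrightarrow> a \<cong>\<^sub>N c"
  and eq_eqI_trans [trans]: "a = b \<Longrightarrow> b \<approx> c \<Longrightarrow> a \<approx> c"
  and eqI_eq_trans [trans]: "a \<approx> b \<Longrightarrow> b = c \<Longrightarrow> a \<approx> c"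
  by simp_all

lemma eqN_multL: "a \<cong>\<^sub>N b \<Longrightarrow> p * a \<cong>\<^sub>N p * b"
  by (rule eqN_mult) simp_all

lemma eqN_multR: "a \<cong>\<^sub>N b \<Longrightarrow> a * p \<cong>\<^sub>N b * p"
  by (rule eqN_mult) simp_all

lemma eqN_smul: "a \<cong>\<^sub>N b \<Longrightarrow> c *\<^sub>K a \<cong>\<^sub>N c *\<^sub>K b"
  unfolding smul_def by (rule eqN_multL)

lemma eqN_eqI: "u \<cong>\<^sub>N v \<Longrightarrow> u \<approx> v"
  using eqN_imp_eqI[of u v 1] by simp

text \<open>Each passage of \<open>b\<close> through one more \<open>a\<close> leaves error terms
  behind. Two of them are carried because the relation between \<open>xh\<close> and
  \<open>yh\<close> has an error in z^2 and a constant one, each passed with its own scalar.\<close>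

lemma q_power_commute:
  assumes ab: "a * b \<cong>\<^sub>N u *\<^sub>K (b * a) + e + e'"
    and e: "a * e \<cong>\<^sub>N w *\<^sub>K (e * a)" and e': "a * e' \<cong>\<^sub>N w' *\<^sub>K (e' * a)"
  shows "a ^ Suc n * b \<cong>\<^sub>N u ^ Suc n *\<^sub>K (b * a ^ Suc n) + gsum u w n *\<^sub>K (e * a ^ n) + gsum u w' n *\<^sub>K (e' * a ^ n)"
proof (induction n)
  case 0
  show ?case using ab by simp
next
  case (Suc n)
  let ?A = "a ^ Suc n"
  have "a ^ Suc (Suc n) * b \<cong>\<^sub>N
      a * (u ^ Suc n *\<^sub>K (b * ?A) + gsum u w n *\<^sub>K (e * a ^ n) + gsum u w' n *\<^sub>K (e' * a ^ n))"
    using eqN_multL[OF Suc.IH, of a] by (simp add: mult.assoc)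
  also have "\<dots> = u ^ Suc n *\<^sub>K ((a * b) * ?A) + gsum u w n *\<^sub>K ((a * e) * a ^ n) + gsum u w' n *\<^sub>K ((a * e') * a ^ n)"
    by (simp add: distrib_left mult.assoc)
  also have "\<dots> \<cong>\<^sub>N u ^ Suc n *\<^sub>K ((u *\<^sub>K (b * a) + e + e') * ?A) + gsum u w n *\<^sub>K ((w *\<^sub>K (e * a)) * a ^ n)
      + gsum u w' n *\<^sub>K ((w' *\<^sub>K (e' * a)) * a ^ n)"
    by (rule eqN_add[OF eqN_add[OF eqN_smul[OF eqN_multR[OF ab]] eqN_smul[OF eqN_multR[OF e]]]
          eqN_smul[OF eqN_multR[OF e']]])
  also have "\<dots> = u ^ Suc (Suc n) *\<^sub>K (b * a ^ Suc (Suc n)) + gsum u w (Suc n) *\<^sub>K (e * ?A) + gsum u w' (Suc n) *\<^sub>K (e' * ?A)"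
    by (simp add: distrib_right smul_distrib mult.assoc) (simp add: algebra_simps smul_distrib)
  finally show ?case .
qed

text \<open>At n = l - 1 both error coefficients are \<open>gsum\<close> of distinct l-th roots of
  unity, hence zero.\<close>

lemma q_root_power_commute:
  assumes ab: "a * b \<cong>\<^sub>N u *\<^sub>K (b * a) + e + e'"
    and e: "a * e \<cong>\<^sub>N w *\<^sub>K (e * a)" and e': "a * e' \<cong>\<^sub>N w' *\<^sub>K (e' * a)"
    and l: "l > 0" "u ^ l = 1" "w ^ l = 1" "w' ^ l = 1" "u \<noteq> w" "u \<noteq> w'"
  shows "a ^ l * b \<cong>\<^sub>N b * a ^ l"
proof -
  obtain n where n: "l = Suc n" using l(1) by (cases l) auto
  have "gsum u w n = 0" "gsum u w' n = 0"
    using gsum_eq[of u w n] gsum_eq[of u w' n] l n by auto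
  with q_power_commute[OF ab e e', of n] l n show ?thesis by simp
qed

lemma q_commute_inverse:
  assumes ab: "a * b \<cong>\<^sub>N u *\<^sub>K (b * a) + e" and u: "u \<noteq> 0"
  shows "b * a \<cong>\<^sub>N inverse u *\<^sub>K (a * b) + (- inverse u) *\<^sub>K e"
proof -
  have "inverse u *\<^sub>K (a * b) - inverse u *\<^sub>K e \<cong>\<^sub>N inverse u *\<^sub>K (u *\<^sub>K (b * a) + e) - inverse u *\<^sub>K e"
    by (rule eqN_diff[OF eqN_smul[OF ab] eqN_refl])
  also have "\<dots> = b * a" using u by (simp add: smul_distrib)
  finally show ?thesis by (simp add: smul_distrib eqN_sym)
qed

section \<open>Central operators and spans modulo the right ideal\<close>

lemma central_mult: "central c \<Longrightarrow> central d \<Longrightarrow> central (c * d)"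
  unfolding central_def
proof
  fix p assume c: "\<forall>p. c * p \<cong>\<^sub>N p * c" and d: "\<forall>p. d * p \<cong>\<^sub>N p * d"
  have "c * (d * p) \<cong>\<^sub>N c * (p * d)" by (rule eqN_multL) (use d in blast)
  also have "c * (p * d) = c * p * d" by (simp add: mult.assoc)
  also have "\<dots> \<cong>\<^sub>N p * c * d" by (rule eqN_multR) (use c in blast)
  finally show "c * d * p \<cong>\<^sub>N p * (c * d)" by (simp add: mult.assoc)
qed

lemma central_power: "central c \<Longrightarrow> central (c ^ n)"
  by (induction n) (simp_all add: central_mult, simp add: central_def)

text \<open>The rule \<open>kspan_cong\<close> makes this the preimage of a span in the quotient by
  \<open>I\<close>. The inductive form lets stability under right multiplication be checked on
  \<open>B\<close> alone.\<close>

inductive_set kspan :: "'a set \<Rightarrow> 'a set" for B :: "'a set" where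
  kspan_zero: "0 \<in> kspan B"
| kspan_base: "b \<in> B \<Longrightarrow> b \<in> kspan B"
| kspan_add: "u \<in> kspan B \<Longrightarrow> v \<in> kspan B \<Longrightarrow> u + v \<in> kspan B"
| kspan_smul: "u \<in> kspan B \<Longrightarrow> c *\<^sub>K u \<in> kspan B"
| kspan_cong: "u \<in> kspan B \<Longrightarrow> u \<approx> v \<Longrightarrow> v \<in> kspan B"

lemma kspan_mult:
  assumes "u \<in> kspan B" and "\<And>b. b \<in> B \<Longrightarrow> b * g \<in> kspan B"
  shows "u * g \<in> kspan B"
  using assms(1)
proof induction
  case (kspan_cong u v)
  then show ?case using eqI_mult by (blast intro: kspan.kspan_cong)
qed (auto simp: distrib_right assms(2) intro: kspan.intros)

definition gspan :: "('r \<Rightarrow> 'a) \<Rightarrow> 'a set \<Rightarrow> 'a set" where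
  "gspan \<rho> E = {p. \<exists>f. p \<approx> (\<Sum>e\<in>E. e * \<rho> (f e))}"

lemma gspan_cong:
  assumes "u \<in> gspan \<rho> E" and "u \<approx> v"
  shows "v \<in> gspan \<rho> E"
proof -
  obtain f where "u \<approx> (\<Sum>e\<in>E. e * \<rho> (f e))" using assms(1) by (auto simp: gspan_def)
  with eqI_sym[OF assms(2)] have "v \<approx> (\<Sum>e\<in>E. e * \<rho> (f e))" by (rule eqI_trans)
  then show ?thesis by (auto simp: gspan_def)
qed

lemma gspan_mult:
  assumes \<rho>: "hom_mod N \<rho>" and u: "u \<in> gspan \<rho> E"
  shows "u * \<rho> r \<in> gspan \<rho> E"
proof -
  obtain f where f: "u \<approx> (\<Sum>e\<in>E. e * \<rho> (f e))" using u by (auto simp: gspan_def)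
  have "u * \<rho> r \<approx> (\<Sum>e\<in>E. e * \<rho> (f e)) * \<rho> r" by (rule eqI_mult[OF f])
  also have "\<dots> = (\<Sum>e\<in>E. e * (\<rho> (f e) * \<rho> r))" by (simp add: sum_distrib_right mult.assoc)
  also have "\<dots> \<approx> (\<Sum>e\<in>E. e * \<rho> (f e * r))"
    by (intro eqI_sum eqN_imp_eqI eqN_sym[OF hom_modD(3)[OF \<rho>]])
  finally show ?thesis unfolding gspan_def by (intro CollectI exI[of _ "\<lambda>e. f e * r"])
qed

lemma gspan_power:
  assumes \<rho>: "hom_mod N \<rho>" and u: "u \<in> gspan \<rho> E"
  shows "u * \<rho> r ^ n \<in> gspan \<rho> E"
proof (induction n)
  case (Suc n)
  have "u * \<rho> r ^ Suc n = u * \<rho> r ^ n * \<rho> r"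
    by (simp only: power_Suc2 mult.assoc)
  then show ?case using gspan_mult[OF \<rho> Suc.IH] by simp
qed (simp add: u)

lemma gspan_add:
  assumes \<rho>: "hom_mod N \<rho>" and "u \<in> gspan \<rho> E" "v \<in> gspan \<rho> E"
  shows "u + v \<in> gspan \<rho> E"
proof -
  obtain f g where "u \<approx> (\<Sum>e\<in>E. e * \<rho> (f e))" "v \<approx> (\<Sum>e\<in>E. e * \<rho> (g e))"
    using assms by (auto simp: gspan_def)
  then have "u + v \<approx> (\<Sum>e\<in>E. e * \<rho> (f e)) + (\<Sum>e\<in>E. e * \<rho> (g e))" by (rule eqI_add)
  also have "\<dots> = (\<Sum>e\<in>E. e * \<rho> (f e + g e))"
    by (simp add: sum.distrib hom_modD(1)[OF \<rho>] distrib_left)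
  finally show ?thesis unfolding gspan_def by (intro CollectI exI[of _ "\<lambda>e. f e + g e"])
qed

lemma gspan_base:
  assumes \<rho>: "hom_mod N \<rho>" and "e \<in> E" "finite E"
  shows "e \<in> gspan \<rho> E"
proof -
  have "(\<Sum>e'\<in>E. e' * \<rho> (if e' = e then 1 else 0)) = (\<Sum>e'\<in>E. if e' = e then e' else 0)"
    by (intro sum.cong) (auto simp: hom_modD[OF \<rho>])
  also have "\<dots> = e" using assms by simp
  finally have "e \<approx> (\<Sum>e'\<in>E. e' * \<rho> (if e' = e then 1 else 0))" by simp
  then show ?thesis unfolding gspan_def by (intro CollectI exI[of _ "\<lambda>e'. if e' = e then 1 else 0"])
qed

lemma kspan_subset_gspan:
  assumes \<rho>: "hom_mod N \<rho>" and k: "\<And>c. \<rho> (k c) = \<kappa> c" and B: "B \<subseteq> gspan \<rho> E"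
    and u: "u \<in> kspan B"
  shows "u \<in> gspan \<rho> E"
  using u
proof induction
  case kspan_zero
  show ?case unfolding gspan_def by (intro CollectI exI[of _ "\<lambda>_. 0"]) (simp add: hom_modD[OF \<rho>])
next
  case (kspan_smul u c)
  have "u * \<rho> (k c) \<in> gspan \<rho> E" by (rule gspan_mult[OF \<rho> kspan_smul.IH])
  then show ?case by (simp add: k smul_def \<kappa>_comm)
next
  case (kspan_cong u v)
  then show ?case using gspan_cong by blast
qed (use B gspan_add[OF \<rho>] in auto)

lemma peval_scalar:
  assumes \<rho>: "\<rho> 0 = 0" "\<phi> 0 = 0" "\<And>c. \<rho> c \<cong>\<^sub>N \<kappa> (\<phi> c)" and a: "a \<cong>\<^sub>N \<kappa> \<xi>"
  shows "peval \<rho> a f \<cong>\<^sub>N \<kappa> (peval \<phi> \<xi> f)"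
proof (induction f)
  case (pCons c f)
  show ?case
    unfolding peval_pCons[of \<rho>, OF \<rho>(1)] peval_pCons[of \<phi>, OF \<rho>(2)] \<kappa>_add \<kappa>_mult
    by (intro eqN_add eqN_mult \<rho> a pCons.IH)
qed simp

lemma hom_mod_peval3:
  assumes "central a1" "central a2" "central a3"
  shows "hom_mod N (peval3 a1 a2 a3)"
  using assms unfolding central_def
  by (intro hom_mod_peval[OF N_ideal] hom_mod_\<kappa>) auto

lemma peval3_const: "peval3 a1 a2 a3 [:[:[:c:]:]:] = \<kappa> c"
  by (simp add: peval_const)

text \<open>After \<open>central_scalars\<close> has turned \<open>a1\<close>, \<open>a2\<close>,
  \<open>a3\<close> into scalars, \<open>E\<close> spans the quotient over the field alone. Constant
  polynomials then suffice as coefficients, so \<open>central_scalars\<close> applies again with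
  \<open>c\<close> in all three places.\<close>

lemma central_scalar_if_generates:
  assumes a: "central a1" "central a2" "central a3" and gen: "generates (peval3 a1 a2 a3) E"
    and c: "central c"
  shows "\<exists>s. c \<cong>\<^sub>N \<kappa> s"
proof -
  obtain c1 c2 c3 where ci: "a1 \<cong>\<^sub>N \<kappa> c1" "a2 \<cong>\<^sub>N \<kappa> c2" "a3 \<cong>\<^sub>N \<kappa> c3"
    using central_scalars[OF a gen] by blast
  let ?\<phi> = "peval (peval (peval (\<lambda>c. c) c1) c2) c3"
  have \<phi>: "peval3 a1 a2 a3 f \<cong>\<^sub>N \<kappa> (?\<phi> f)" for f
    by (intro peval_scalar ci) simp_all
  have "generates (peval3 c c c) E"
    unfolding generates_def
  proof (intro conjI allI)
    show "finite E" using gen by (simp add: generates_def)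
    fix p
    obtain f where "p \<approx> (\<Sum>e\<in>E. e * peval3 a1 a2 a3 (f e))" using gen by (auto simp: generates_def)
    also have "\<dots> \<approx> (\<Sum>e\<in>E. e * \<kappa> (?\<phi> (f e)))" by (intro eqI_sum eqN_imp_eqI \<phi>)
    also have "\<dots> = (\<Sum>e\<in>E. e * peval3 c c c [:[:[:?\<phi> (f e):]:]:])" by (simp only: peval3_const)
    finally show "\<exists>f. p \<approx> (\<Sum>e\<in>E. e * peval3 c c c (f e))"
      by (intro exI[of _ "\<lambda>e. [:[:[:?\<phi> (f e):]:]:]"])
  qed
  from central_scalars[OF c c c this] show ?thesis by blast
qed

end


text \<open>Here \<open>t\<close> stands for q^2. The relations are imposed on operators, modulo
  \<open>N\<close>, so that the ring can be the free algebra. \<open>generation\<close> is the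
  induction principle for statements about all elements; it builds words by appending generators, in
  keeping with right modules.\<close>

locale weyl_quotient = maximal_right_ideal I \<kappa>
  for I :: "'a::ring_1 set" and \<kappa> :: "'k::alg_closed_field \<Rightarrow> 'a" +
  fixes x y z :: 'a and t \<alpha> \<beta> \<gamma> :: 'k and l :: nat
  assumes xy: "x * y \<cong>\<^sub>N t *\<^sub>K (y * x) + \<alpha> *\<^sub>K 1"
    and xz: "x * z \<cong>\<^sub>N inverse t *\<^sub>K (z * x) + \<beta> *\<^sub>K 1"
    and yz: "y * z \<cong>\<^sub>N t *\<^sub>K (z * y) + \<gamma> *\<^sub>K 1"
    and l: "l > 1" and root: "primitive_root_of_unity l t"
    and z_inj: "p * z \<in> I \<Longrightarrow> p \<in> I"
    and generation: "(\<And>c. \<kappa> c \<in> S) \<Longrightarrow> (\<And>u v. u \<in> S \<Longrightarrow> v \<in> S \<Longrightarrow> u + v \<in> S) \<Longrightarrow>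
      (\<And>u. u \<in> S \<Longrightarrow> u * x \<in> S) \<Longrightarrow> (\<And>u. u \<in> S \<Longrightarrow> u * y \<in> S) \<Longrightarrow> (\<And>u. u \<in> S \<Longrightarrow> u * z \<in> S) \<Longrightarrow>
      p \<in> S"
begin

section \<open>Central powers of the generators\<close>

lemma t_root: "t ^ l = 1" "0 < j \<Longrightarrow> j < l \<Longrightarrow> t ^ j \<noteq> 1"
  using root by (auto simp: primitive_root_of_unity_def)

lemma t_neq: "t \<noteq> 0" "t \<noteq> 1"
  using t_root(1) t_root(2)[of 1] l by (auto simp: power_0_left)

lemma centralI:
  assumes "c * x \<cong>\<^sub>N x * c" "c * y \<cong>\<^sub>N y * c" "c * z \<cong>\<^sub>N z * c"
  shows "central c"
proof -
  have mult: "c * (u * g) \<cong>\<^sub>N u * g * c" if u: "c * u \<cong>\<^sub>N u * c" and g: "c * g \<cong>\<^sub>N g * c" for u g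
  proof -
    have "c * u * g \<cong>\<^sub>N u * c * g" by (rule eqN_multR[OF u])
    also have "\<dots> = u * (c * g)" by (simp add: mult.assoc)
    also have "\<dots> \<cong>\<^sub>N u * (g * c)" by (rule eqN_multL[OF g])
    finally show ?thesis by (simp add: mult.assoc)
  qed
  have "p \<in> {u. c * u \<cong>\<^sub>N u * c}" for p
  proof (rule generation)
    fix d show "\<kappa> d \<in> {u. c * u \<cong>\<^sub>N u * c}" using \<kappa>_comm[of c d] by simp
  next
    fix u v assume "u \<in> {u. c * u \<cong>\<^sub>N u * c}" "v \<in> {u. c * u \<cong>\<^sub>N u * c}"
    then show "u + v \<in> {u. c * u \<cong>\<^sub>N u * c}" using eqN_add by (simp add: distrib_left distrib_right)
  qed (use assms mult in auto)
  then show ?thesis by (simp add: central_def)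
qed

lemma weyl_power_commute:
  assumes ab: "a * b \<cong>\<^sub>N u *\<^sub>K (b * a) + \<delta> *\<^sub>K 1"
  shows "a ^ Suc n * b \<cong>\<^sub>N u ^ Suc n *\<^sub>K (b * a ^ Suc n) + (gsum u 1 n * \<delta>) *\<^sub>K a ^ n"
  using q_power_commute[of a b u "\<delta> *\<^sub>K 1" 0 1 1 n] ab by simp

text \<open>A constant error term is passed with scalar 1, and both \<open>t\<close> and its inverse
  are l-th roots of unity different from 1. The second part is the first one for the relation solved
  for \<open>b * a\<close>.\<close>

lemma weyl_root_power_commute:
  assumes ab: "a * b \<cong>\<^sub>N u *\<^sub>K (b * a) + \<delta> *\<^sub>K 1" and u: "u = t \<or> u = inverse t"
  shows "a ^ l * b \<cong>\<^sub>N b * a ^ l" and "b ^ l * a \<cong>\<^sub>N a * b ^ l"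
proof -
  have u': "u \<noteq> 0" "u \<noteq> 1" "u ^ l = 1" using u t_neq t_root by (auto simp: power_inverse)
  show "a ^ l * b \<cong>\<^sub>N b * a ^ l"
    using q_root_power_commute[of a b u "\<delta> *\<^sub>K 1" 0 1 1 l] ab u' l by simp
  show "b ^ l * a \<cong>\<^sub>N a * b ^ l"
    using q_root_power_commute[of b a "inverse u" "(- inverse u * \<delta>) *\<^sub>K 1" 0 1 1 l]
      q_commute_inverse[OF ab u'(1)] u' l by (simp add: power_inverse)
qed

lemma central_powers: "central (x ^ l)" "central (y ^ l)" "central (z ^ l)"
  by (intro centralI weyl_root_power_commute(1)[OF xy] weyl_root_power_commute(1)[OF xz]
      weyl_root_power_commute(1)[OF yz] weyl_root_power_commute(2)[OF xy]
      weyl_root_power_commute(2)[OF xz] weyl_root_power_commute(2)[OF yz];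
      simp add: power_commutes)+

section \<open>Ordered monomials span, and central elements are scalars\<close>

definition monomials :: "'a set" where
  "monomials = {z ^ i * y ^ j * x ^ k | i j k. True}"

lemma monomials_mult_x: "b \<in> monomials \<Longrightarrow> b * x \<in> monomials"
proof -
  assume "b \<in> monomials"
  then obtain i j k where b: "b = z ^ i * y ^ j * x ^ k" by (auto simp: monomials_def)
  have "b * x = z ^ i * y ^ j * x ^ Suc k" unfolding b by (simp add: mult.assoc power_commutes)
  then show ?thesis unfolding monomials_def by blast
qed

lemma kspan_monomials_x: "u \<in> kspan monomials \<Longrightarrow> u * x ^ n \<in> kspan monomials"
proof (induction n)
  case (Suc n)
  have "u * x ^ n * x \<in> kspan monomials"
    by (rule kspan_mult[OF Suc.IH[OF Suc.prems]]) (rule kspan_base[OF monomials_mult_x])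
  then show ?case by (simp only: power_Suc2 mult.assoc)
qed simp

lemma monomial_in_kspan: "z ^ i * y ^ j * x ^ k \<in> kspan monomials"
proof (rule kspan_base)
  show "z ^ i * y ^ j * x ^ k \<in> monomials" unfolding monomials_def by blast
qed

lemma monomials_mult_y: "z ^ i * y ^ j * x ^ k * y \<in> kspan monomials"
proof (cases k)
  case 0
  then have "z ^ i * y ^ j * x ^ k * y = z ^ i * y ^ Suc j * x ^ 0"
    by (simp add: mult.assoc power_commutes)
  then show ?thesis using monomial_in_kspan by metis
next
  case (Suc n)
  let ?c = "gsum t 1 n * \<alpha>"
  have "t ^ Suc n *\<^sub>K (z ^ i * y ^ Suc j * x ^ Suc n) + ?c *\<^sub>K (z ^ i * y ^ j * x ^ n) \<in> kspan monomials"
    by (intro kspan_add kspan_smul monomial_in_kspan)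
  also have "t ^ Suc n *\<^sub>K (z ^ i * y ^ Suc j * x ^ Suc n) + ?c *\<^sub>K (z ^ i * y ^ j * x ^ n) =
      z ^ i * y ^ j * (t ^ Suc n *\<^sub>K (y * x ^ Suc n) + ?c *\<^sub>K x ^ n)"
    unfolding distrib_left smul_simps(2) power_Suc2[of y j] mult.assoc ..
  finally have "z ^ i * y ^ j * (x ^ Suc n * y) \<in> kspan monomials"
    by (rule kspan_cong) (rule eqN_imp_eqI[OF eqN_sym[OF weyl_power_commute[OF xy]]])
  then show ?thesis by (simp only: Suc mult.assoc)
qed

lemma monomials_mult_yz: "z ^ i * y ^ j * z \<in> kspan monomials"
proof (cases j)
  case 0
  then have "z ^ i * y ^ j * z = z ^ Suc i * y ^ 0 * x ^ 0"
    by (simp add: power_commutes)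
  then show ?thesis using monomial_in_kspan by metis
next
  case (Suc n)
  let ?c = "gsum t 1 n * \<gamma>"
  have "t ^ Suc n *\<^sub>K (z ^ Suc i * y ^ Suc n * x ^ 0) + ?c *\<^sub>K (z ^ i * y ^ n * x ^ 0) \<in> kspan monomials"
    by (intro kspan_add kspan_smul monomial_in_kspan)
  also have "t ^ Suc n *\<^sub>K (z ^ Suc i * y ^ Suc n * x ^ 0) + ?c *\<^sub>K (z ^ i * y ^ n * x ^ 0) =
      z ^ i * (t ^ Suc n *\<^sub>K (z * y ^ Suc n) + ?c *\<^sub>K y ^ n)"
    unfolding distrib_left smul_simps(2) power_Suc2[of z i] mult.assoc power_0 mult_1_right ..
  finally have "z ^ i * (y ^ Suc n * z) \<in> kspan monomials"
    by (rule kspan_cong) (rule eqN_imp_eqI[OF eqN_sym[OF weyl_power_commute[OF yz]]])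
  then show ?thesis by (simp only: Suc mult.assoc)
qed

text \<open>Pulling z through the power of x leaves it behind the power of y, where
  \<open>monomials_mult_yz\<close> applies; appending powers of x afterwards stays in the span, x
  being the last letter.\<close>

lemma monomials_mult_z: "z ^ i * y ^ j * x ^ k * z \<in> kspan monomials"
proof (cases k)
  case 0
  then show ?thesis using monomials_mult_yz by simp
next
  case (Suc n)
  let ?t = "inverse t" and ?c = "gsum (inverse t) 1 n * \<beta>"
  have "?t ^ Suc n *\<^sub>K (z ^ i * y ^ j * z * x ^ Suc n) + ?c *\<^sub>K (z ^ i * y ^ j * x ^ n) \<in> kspan monomials"
    by (intro kspan_add kspan_smul monomial_in_kspan kspan_monomials_x monomials_mult_yz)
  also have "?t ^ Suc n *\<^sub>K (z ^ i * y ^ j * z * x ^ Suc n) + ?c *\<^sub>K (z ^ i * y ^ j * x ^ n) =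
      z ^ i * y ^ j * (?t ^ Suc n *\<^sub>K (z * x ^ Suc n) + ?c *\<^sub>K x ^ n)"
    unfolding distrib_left smul_simps(2) mult.assoc ..
  finally have "z ^ i * y ^ j * (x ^ Suc n * z) \<in> kspan monomials"
    by (rule kspan_cong) (rule eqN_imp_eqI[OF eqN_sym[OF weyl_power_commute[OF xz]]])
  then show ?thesis by (simp only: Suc mult.assoc)
qed

lemma kspan_monomials: "p \<in> kspan monomials"
proof (rule generation)
  fix c show "\<kappa> c \<in> kspan monomials"
    using kspan_smul[OF monomial_in_kspan[of 0 0 0], of c] by (simp add: \<kappa>_eq_smul)
next
  fix u v assume "u \<in> kspan monomials" "v \<in> kspan monomials"
  then show "u + v \<in> kspan monomials" by (rule kspan_add)
next
  fix u assume u: "u \<in> kspan monomials"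
  show "u * x \<in> kspan monomials" using kspan_monomials_x[OF u, of 1] by simp
  have m: "\<exists>i j k. b = z ^ i * y ^ j * x ^ k" if "b \<in> monomials" for b
    using that by (simp add: monomials_def)
  show "u * y \<in> kspan monomials"
    by (rule kspan_mult[OF u]) (use m monomials_mult_y in blast)
  show "u * z \<in> kspan monomials"
    by (rule kspan_mult[OF u]) (use m monomials_mult_z in blast)
qed

text \<open>Reducing exponents modulo l leaves at most l^3 monomials; the surplus l-th powers are
  central and can be collected at the right end, where they act as polynomial coefficients. So these
  monomials generate the quotient over the polynomials in x^l, y^l, z^l.\<close>

lemma central_scalar:
  assumes "central c"
  shows "\<exists>s. c \<cong>\<^sub>N \<kappa> s"
proof (rule central_scalar_if_generates[OF central_powers _ assms])
  let ?\<rho> = "peval3 (x ^ l) (y ^ l) (z ^ l)"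
  define E where "E = (\<lambda>(i, j, k). z ^ i * y ^ j * x ^ k) ` ({..<l} \<times> {..<l} \<times> {..<l})"
  have fin: "finite E" by (simp add: E_def)
  have \<rho>: "hom_mod N ?\<rho>" by (intro hom_mod_peval3 central_powers)
  have X: "?\<rho> [:[:[:0, 1:]:]:] = x ^ l" "?\<rho> [:[:0, 1:]:] = y ^ l" "?\<rho> [:0, 1:] = z ^ l"
    by (simp_all add: peval_pCons \<kappa>_one one_pCons)
  have "z ^ a * y ^ b * x ^ c \<in> gspan ?\<rho> E" for a b c
  proof -
    let ?e = "z ^ (a mod l) * y ^ (b mod l) * x ^ (c mod l)"
    have dm: "g ^ n = g ^ (n mod l) * (g ^ l) ^ (n div l)" for g :: 'a and n
      by (simp add: power_mult[symmetric] power_add[symmetric])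
    have "(a mod l, b mod l, c mod l) \<in> {..<l} \<times> {..<l} \<times> {..<l}" using l by auto
    then have "(\<lambda>(i, j, k). z ^ i * y ^ j * x ^ k) (a mod l, b mod l, c mod l) \<in> E"
      unfolding E_def by (rule imageI)
    then have "?e \<in> E" by simp
    then have "?e \<in> gspan ?\<rho> E" by (intro gspan_base \<rho> fin)
    then have "?e * (x ^ l) ^ (c div l) * (y ^ l) ^ (b div l) * (z ^ l) ^ (a div l) \<in> gspan ?\<rho> E"
      using gspan_power[OF \<rho>] X by metis
    moreover have "?e * (x ^ l) ^ (c div l) * (y ^ l) ^ (b div l) * (z ^ l) ^ (a div l) \<approx> z ^ a * y ^ b * x ^ c"
    proof -
      let ?X = "(x ^ l) ^ (c div l)" and ?Y = "(y ^ l) ^ (b div l)" and ?Z = "(z ^ l) ^ (a div l)"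
      let ?x = "x ^ (c mod l)" and ?y = "y ^ (b mod l)" and ?z = "z ^ (a mod l)"
      have cY: "p * ?Y \<cong>\<^sub>N ?Y * p" and cZ: "p * ?Z \<cong>\<^sub>N ?Z * p" for p
        using central_power[OF central_powers(2)] central_power[OF central_powers(3)] eqN_sym
        by (auto simp: central_def)
      have "?e * ?X * ?Y * ?Z = ?z * (?y * ((?x * ?X) * ?Y) * ?Z)" by (simp add: mult.assoc)
      also have "\<dots> \<cong>\<^sub>N ?z * (?y * (?Y * (?x * ?X)) * ?Z)"
        by (intro eqN_multL eqN_multR cY)
      also have "\<dots> \<cong>\<^sub>N ?z * (?Z * (?y * (?Y * (?x * ?X))))"
        by (intro eqN_multL cZ)
      also have "\<dots> = (?z * ?Z) * (?y * ?Y) * (?x * ?X)" by (simp add: mult.assoc)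
      also have "\<dots> = z ^ a * y ^ b * x ^ c" by (simp only: dm[symmetric])
      finally show ?thesis by (rule eqN_eqI)
    qed
    ultimately show ?thesis by (rule gspan_cong)
  qed
  then have "monomials \<subseteq> gspan ?\<rho> E" by (auto simp: monomials_def)
  then have "p \<in> gspan ?\<rho> E" for p
    by (rule kspan_subset_gspan[where k = "\<lambda>c. [:[:[:c:]:]:]", OF \<rho> peval3_const _ kspan_monomials])
  then show "generates ?\<rho> E" using fin by (auto simp: generates_def gspan_def)
qed

end

section \<open>Chains of eigenvectors\<close>

context maximal_right_ideal
begin

definition qcomm :: "'k \<Rightarrow> 'a \<Rightarrow> 'a \<Rightarrow> bool" where
  "qcomm u a b \<longleftrightarrow> a * b \<cong>\<^sub>N u *\<^sub>K (b * a)"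

lemma qcomm_mult:
  assumes "qcomm u a b" "qcomm v a c"
  shows "qcomm (u * v) a (b * c)"
proof -
  have "a * b * c \<cong>\<^sub>N (u *\<^sub>K (b * a)) * c"
    using assms(1) by (intro eqN_multR) (simp add: qcomm_def)
  also have "\<dots> = u *\<^sub>K (b * (a * c))" by (simp add: mult.assoc)
  also have "\<dots> \<cong>\<^sub>N u *\<^sub>K (b * (v *\<^sub>K (c * a)))"
    using assms(2) by (intro eqN_smul eqN_multL) (simp add: qcomm_def)
  finally show ?thesis by (simp add: qcomm_def mult.assoc)
qed

lemma qcomm_power: "qcomm u a b \<Longrightarrow> qcomm (u ^ n) a (b ^ n)"
proof (induction n)
  case 0
  show ?case by (simp add: qcomm_def)
next
  case (Suc n)
  then show ?case using qcomm_mult[of u a b "u ^ n" "b ^ n"] by simp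
qed

lemma qcomm_sym:
  assumes "qcomm u a b" "u \<noteq> 0"
  shows "qcomm (inverse u) b a"
proof -
  have "inverse u *\<^sub>K (a * b) \<cong>\<^sub>N inverse u *\<^sub>K u *\<^sub>K (b * a)"
    using assms(1) unfolding qcomm_def by (rule eqN_smul)
  then show ?thesis using assms(2) by (simp add: qcomm_def eqN_sym)
qed

lemma qcomm_1_iff: "qcomm 1 a b \<longleftrightarrow> a * b \<cong>\<^sub>N b * a"
  by (simp add: qcomm_def)

lemma peval_smult: "peval \<kappa> a (smult c f) = c *\<^sub>K peval \<kappa> a f"
  by (induction f) (simp_all add: peval_pCons \<kappa>_mult smul_def distrib_left mult.assoc)

lemma peval_add: "peval \<kappa> a (f + g) = peval \<kappa> a f + peval \<kappa> a g"
  by (induction f g rule: poly_induct2) (simp_all add: peval_pCons \<kappa>_add algebra_simps)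

lemma peval_monom: "peval \<kappa> a (monom 1 n) = a ^ n"
  by (induction n) (simp_all add: monom_Suc peval_pCons one_pCons \<kappa>_one monom_0 power_commutes)

text \<open>The coset of 1 is killed by f(a). Linear factors are split off until the cofactor
  evaluated at \<open>a\<close> no longer lies in \<open>I\<close>; the coset of that value is an
  eigenvector.\<close>

lemma eigenvector_if_annihilated:
  assumes "f \<noteq> 0" "peval \<kappa> a f \<in> I"
  shows "\<exists>v \<theta>. v \<notin> I \<and> v * a \<approx> \<theta> *\<^sub>K v"
  using assms
proof (induction "degree f" arbitrary: f rule: less_induct)
  case (less f)
  show ?case
  proof (cases "degree f = 0")
    case True
    then obtain c where "f = [:c:]" by (meson degree_eq_zeroE)
    then show ?thesis using less.prems \<kappa>_mem_iff by (simp add: peval_const)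
  next
    case False
    then obtain \<xi> where "poly f \<xi> = 0" using alg_closed_imp_poly_has_root by blast
    then obtain g where g: "f = [:- \<xi>, 1:] * g" using poly_eq_0_iff_dvd by (auto simp: dvd_def)
    then have g0: "g \<noteq> 0" using less.prems by auto
    have "degree f = Suc (degree g)" unfolding g using g0 by (subst degree_mult_eq) auto
    show ?thesis
    proof (cases "peval \<kappa> a g \<in> I")
      case True
      then show ?thesis using less.hyps[OF _ g0] \<open>degree f = _\<close> by simp
    next
      case False
      have "peval \<kappa> a f = peval \<kappa> a g * a - \<xi> *\<^sub>K peval \<kappa> a g"
      proof -
        have "f = pCons 0 g + smult (- \<xi>) g" unfolding g by simp
        then show ?thesis by (simp only: peval_add peval_smult) (simp add: peval_pCons smul_distrib)
      qed
      then have "peval \<kappa> a g * a \<approx> \<xi> *\<^sub>K peval \<kappa> a g" using less.prems by (simp add: eqI_def)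
      with False show ?thesis by blast
    qed
  qed
qed

end


text \<open>These solve \<open>\<beta> = b - inverse t * b\<close> and
  \<open>\<gamma> = d - t * d\<close>, the conditions for x - b z^-1 and y - d z^-1 to commute with
  z up to a scalar. Divided by the eigenvalue of z they are the diagonal coefficients of x and y in
  all three families; \<open>comm_const\<close> is the constant left over when the two corrected
  elements are exchanged.\<close>

definition x_shift :: "'k::field \<Rightarrow> 'k \<Rightarrow> 'k" where "x_shift t \<beta> = \<beta> * t / (t - 1)"
definition y_shift :: "'k::field \<Rightarrow> 'k \<Rightarrow> 'k" where "y_shift t \<gamma> = - (\<gamma> / (t - 1))"
definition comm_const :: "'k::field \<Rightarrow> 'k \<Rightarrow> 'k \<Rightarrow> 'k" where
  "comm_const t \<beta> \<gamma> = \<beta> * \<gamma> * t / (t - 1)"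

lemma shift_eqs:
  fixes t :: "'k::field"
  assumes t: "t \<noteq> 0" "t \<noteq> 1"
  shows "\<beta> = x_shift t \<beta> - inverse t * x_shift t \<beta>" "\<gamma> = y_shift t \<gamma> - t * y_shift t \<gamma>"
    "comm_const t \<beta> \<gamma> = y_shift t \<gamma> * x_shift t \<beta> - t * (y_shift t \<gamma> * x_shift t \<beta>)"
    "t * \<beta> = t * x_shift t \<beta> - x_shift t \<beta>"
proof -
  define r where "r = inverse (t - 1)"
  define s where "s = inverse t"
  have "r * (t - 1) = 1" using t by (simp add: r_def)
  then have r: "r * t - r = 1" by (simp only: right_diff_distrib mult_1_right)
  have s: "s * t = 1" using t by (simp add: s_def)
  have [simp]: "x_shift t \<beta> = \<beta> * t * r" "y_shift t \<gamma> = - (\<gamma> * r)" "comm_const t \<beta> \<gamma> = \<beta> * \<gamma> * t * r"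
    by (simp_all add: x_shift_def y_shift_def comm_const_def r_def divide_inverse)
  have "\<beta> * t * r - s * (\<beta> * t * r) = \<beta> * (r * t - r * (s * t))" by (simp add: algebra_simps)
  also have "\<dots> = \<beta>" unfolding s mult_1_right r ..
  finally show "\<beta> = x_shift t \<beta> - inverse t * x_shift t \<beta>" unfolding s_def by simp
  have "y_shift t \<gamma> - t * y_shift t \<gamma> = \<gamma> * (r * t - r)" by (simp add: algebra_simps)
  then show "\<gamma> = y_shift t \<gamma> - t * y_shift t \<gamma>" by (simp add: r)
  have "y_shift t \<gamma> * x_shift t \<beta> - t * (y_shift t \<gamma> * x_shift t \<beta>) = \<beta> * \<gamma> * t * r * (r * t - r)" by (simp add: algebra_simps)
  then show "comm_const t \<beta> \<gamma> = y_shift t \<gamma> * x_shift t \<beta> - t * (y_shift t \<gamma> * x_shift t \<beta>)" by (simp add: r)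
  have "t * x_shift t \<beta> - x_shift t \<beta> = t * \<beta> * (r * t - r)" by (simp add: algebra_simps)
  then show "t * \<beta> = t * x_shift t \<beta> - x_shift t \<beta>" by (simp add: r)
qed


context weyl_quotient
begin

section \<open>The corrected generators and the Casimir element\<close>

abbreviation "bx \<equiv> x_shift t \<beta>"
abbreviation "dy \<equiv> y_shift t \<gamma>"
abbreviation "c0 \<equiv> comm_const t \<beta> \<gamma>"

text \<open>
  In the localization at \<open>z\<close>, these are \<open>(x - bx z\<^sup>-\<^sup>1) z\<close> and \<open>(y - dy z\<^sup>-\<^sup>1) z\<close>; the corrections of \<open>x\<close> and \<open>y\<close>
  are chosen so that both commute with \<open>z\<close> up to a scalar.
\<close>

definition xh :: 'a where "xh = x * z - bx *\<^sub>K 1"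
definition yh :: 'a where "yh = y * z - dy *\<^sub>K 1"

lemmas coeff_eqs = shift_eqs[OF t_neq]

text \<open>Working with any \<open>b\<close> that solves the equation keeps the division in
  \<open>x_shift\<close> out of the computation.\<close>

lemma shift_x_z:
  assumes b: "\<beta> = b - inverse t * b"
  shows "qcomm (inverse t) (x * z - b *\<^sub>K 1) z"
proof -
  have "x * z * z \<cong>\<^sub>N (inverse t *\<^sub>K (z * x) + \<beta> *\<^sub>K 1) * z" by (rule eqN_multR[OF xz])
  then have "x * z * z - b *\<^sub>K z \<cong>\<^sub>N (inverse t *\<^sub>K (z * x) + \<beta> *\<^sub>K 1) * z - b *\<^sub>K z"
    by (rule eqN_diff) simp
  also have "\<dots> = inverse t *\<^sub>K (z * (x * z - b *\<^sub>K 1))"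
    unfolding b by (simp add: algebra_simps smul_distrib)
  finally show ?thesis by (simp add: qcomm_def left_diff_distrib)
qed

lemma shift_y_z:
  assumes d: "\<gamma> = d - t * d"
  shows "qcomm t (y * z - d *\<^sub>K 1) z"
proof -
  have "y * z * z \<cong>\<^sub>N (t *\<^sub>K (z * y) + \<gamma> *\<^sub>K 1) * z" by (rule eqN_multR[OF yz])
  then have "y * z * z - d *\<^sub>K z \<cong>\<^sub>N (t *\<^sub>K (z * y) + \<gamma> *\<^sub>K 1) * z - d *\<^sub>K z"
    by (rule eqN_diff) simp
  also have "\<dots> = t *\<^sub>K (z * (y * z - d *\<^sub>K 1))"
    unfolding d by (simp add: algebra_simps smul_distrib)
  finally show ?thesis by (simp add: qcomm_def left_diff_distrib)
qed

text \<open>The equations for \<open>b\<close> and \<open>d\<close> are exactly those that cancel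
  the terms in \<open>y * z\<close> and \<open>x * z\<close>; what survives is the multiple of z^2
  and the constant \<open>c\<close>.\<close>

lemma shift_x_y:
  fixes b d :: 'k
  defines "u \<equiv> x * z - b *\<^sub>K 1" and "v \<equiv> y * z - d *\<^sub>K 1"
  assumes d: "\<gamma> = d - t * d" and b: "t * \<beta> = t * b - b" and c: "c = d * b - t * (d * b)"
  shows "t *\<^sub>K (u * v) \<cong>\<^sub>N v * u + \<alpha> *\<^sub>K (z * z) - c *\<^sub>K 1"
proof -
  have zy: "t *\<^sub>K (z * y) \<cong>\<^sub>N y * z - \<gamma> *\<^sub>K 1"
    using eqN_diff[OF eqN_sym[OF yz] eqN_refl, of "\<gamma> *\<^sub>K 1"] by simp
  have zx: "z * x \<cong>\<^sub>N t *\<^sub>K (x * z) - (t * \<beta>) *\<^sub>K 1"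
    using q_commute_inverse[OF xz] t_neq by (simp add: smul_distrib)
  have "t *\<^sub>K (x * z * y * z) = x * (t *\<^sub>K (z * y)) * z" by (simp add: mult.assoc)
  also have "\<dots> \<cong>\<^sub>N x * (y * z - \<gamma> *\<^sub>K 1) * z" by (intro eqN_multL eqN_multR zy)
  also have "\<dots> = (x * y) * (z * z) - \<gamma> *\<^sub>K (x * z)" by (simp add: algebra_simps)
  also have "\<dots> \<cong>\<^sub>N (t *\<^sub>K (y * x) + \<alpha> *\<^sub>K 1) * (z * z) - \<gamma> *\<^sub>K (x * z)"
    by (intro eqN_diff eqN_multR xy eqN_refl)
  also have "\<dots> = t *\<^sub>K (y * x * z * z) + \<alpha> *\<^sub>K (z * z) - \<gamma> *\<^sub>K (x * z)"
    by (simp add: algebra_simps)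
  finally have 1: "t *\<^sub>K (x * z * y * z) \<cong>\<^sub>N t *\<^sub>K (y * x * z * z) + \<alpha> *\<^sub>K (z * z) - \<gamma> *\<^sub>K (x * z)" .
  have "y * z * x * z = y * (z * x) * z" by (simp add: mult.assoc)
  also have "\<dots> \<cong>\<^sub>N y * (t *\<^sub>K (x * z) - (t * \<beta>) *\<^sub>K 1) * z" by (intro eqN_multL eqN_multR zx)
  also have "\<dots> = t *\<^sub>K (y * x * z * z) - (t * \<beta>) *\<^sub>K (y * z)" by (simp add: algebra_simps)
  finally have 2: "y * z * x * z \<cong>\<^sub>N t *\<^sub>K (y * x * z * z) - (t * \<beta>) *\<^sub>K (y * z)" .
  have "t *\<^sub>K (u * v) - (v * u + \<alpha> *\<^sub>K (z * z) - c *\<^sub>K 1) =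
      t *\<^sub>K (x * z * y * z) - y * z * x * z
      + ((b - t * b) *\<^sub>K (y * z) + (d - t * d) *\<^sub>K (x * z) - \<alpha> *\<^sub>K (z * z))"
    unfolding c by (simp add: u_def v_def algebra_simps smul_distrib)
  also have "\<dots> \<cong>\<^sub>N (t *\<^sub>K (y * x * z * z) + \<alpha> *\<^sub>K (z * z) - \<gamma> *\<^sub>K (x * z))
      - (t *\<^sub>K (y * x * z * z) - (t * \<beta>) *\<^sub>K (y * z))
      + ((b - t * b) *\<^sub>K (y * z) + (d - t * d) *\<^sub>K (x * z) - \<alpha> *\<^sub>K (z * z))"
    by (intro eqN_add eqN_diff 1 2 eqN_refl)
  also have "\<dots> = 0"
    unfolding d b by (simp add: algebra_simps smul_distrib)
  finally show ?thesis by (simp add: eqmod_def)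
qed

lemma X_z: "qcomm (inverse t) xh z"
  unfolding xh_def by (rule shift_x_z[OF coeff_eqs(1)])

lemma Y_z: "qcomm t yh z"
  unfolding yh_def by (rule shift_y_z[OF coeff_eqs(2)])

lemma X_Y: "t *\<^sub>K (xh * yh) \<cong>\<^sub>N yh * xh + \<alpha> *\<^sub>K (z * z) - c0 *\<^sub>K 1"
  unfolding xh_def yh_def by (rule shift_x_y[OF coeff_eqs(2,4,3)])

text \<open>If \<open>c\<close> commutes with z and with g z - d, then (c g - g c) z lies in
  \<open>N\<close>, and \<open>z_inj\<close> cancels z. This stands in for a computation in the
  localization at z.\<close>

lemma centralI':
  assumes xh: "c * xh \<cong>\<^sub>N xh * c" and yh: "c * yh \<cong>\<^sub>N yh * c" and z: "c * z \<cong>\<^sub>N z * c"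
  shows "central c"
proof -
  have *: "c * g \<cong>\<^sub>N g * c" if "c * (g * z - d *\<^sub>K 1) \<cong>\<^sub>N (g * z - d *\<^sub>K 1) * c" for g d
  proof -
    have "c * g * z - g * z * c \<in> N"
      using that by (simp add: eqmod_def algebra_simps)
    moreover have "g * (c * z) - g * (z * c) \<in> N"
      using eqN_multL[OF z, of g] by (simp add: eqmod_def)
    ultimately have "(c * g * z - g * z * c) - (g * (c * z) - g * (z * c)) \<in> N"
      using two_sided_idealD(2)[OF N_ideal] by blast
    then have "(c * g - g * c) * z \<in> N" by (simp add: algebra_simps)
    then have "c * g - g * c \<in> N" using z_inj by (auto simp: N_def mult.assoc[symmetric])
    then show ?thesis by (simp add: eqmod_def)
  qed
  show ?thesis
    using *[of x bx] *[of y dy] xh yh z by (intro centralI) (simp_all add: xh_def yh_def)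
qed

lemma inverse_t_power: "inverse t ^ l = 1"
  using t_root by (simp add: power_inverse)

lemma z_qcomm: "qcomm t z xh" "qcomm (inverse t) z yh"
  using qcomm_sym[OF X_z] qcomm_sym[OF Y_z] t_neq by simp_all

lemma X_Y': "xh * yh \<cong>\<^sub>N inverse t *\<^sub>K (yh * xh) + (inverse t * \<alpha>) *\<^sub>K (z * z) + (- (inverse t * c0)) *\<^sub>K 1"
  using eqN_smul[OF X_Y, of "inverse t"] t_neq by (simp add: smul_distrib)

lemma Y_X: "yh * xh \<cong>\<^sub>N t *\<^sub>K (xh * yh) + (- \<alpha>) *\<^sub>K (z * z) + c0 *\<^sub>K 1"
  using eqN_add[OF eqN_sym[OF X_Y] eqN_refl, of "c0 *\<^sub>K 1 - \<alpha> *\<^sub>K (z * z)"] by (simp add: smul_distrib algebra_simps)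

text \<open>The error terms in z^2 and 1 are passed by \<open>xh\<close> with scalars t^-2 and 1,
  both different from the leading scalar t^-1. For \<open>yh\<close> in the next lemma the scalars
  are t^2, 1 and t.\<close>

lemma central_X_power: "central (xh ^ l)"
proof (rule centralI')
  show "xh ^ l * xh \<cong>\<^sub>N xh * xh ^ l" by (simp add: power_commutes)
  show "xh ^ l * z \<cong>\<^sub>N z * xh ^ l"
    using qcomm_power[OF z_qcomm(1), of l] t_root by (simp add: qcomm_1_iff eqN_sym)
  have "xh * (z * z) \<cong>\<^sub>N (inverse t * inverse t) *\<^sub>K (z * z * xh)"
    using qcomm_mult[OF X_z X_z] by (simp add: qcomm_def)
  from eqN_smul[OF this, of "inverse t * \<alpha>"]
  have zz: "xh * ((inverse t * \<alpha>) *\<^sub>K (z * z)) \<cong>\<^sub>N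
      (inverse t * inverse t) *\<^sub>K (((inverse t * \<alpha>) *\<^sub>K (z * z)) * xh)"
    by (simp add: mult.commute mult.left_commute)
  have one: "xh * ((- (inverse t * c0)) *\<^sub>K 1) \<cong>\<^sub>N 1 *\<^sub>K (((- (inverse t * c0)) *\<^sub>K 1) * xh)" by simp
  show "xh ^ l * yh \<cong>\<^sub>N yh * xh ^ l"
    by (rule q_root_power_commute[OF X_Y' zz one])
      (use l t_neq inverse_t_power in \<open>simp_all add: power_mult_distrib\<close>)
qed

lemma central_Y_power: "central (yh ^ l)"
proof (rule centralI')
  show "yh ^ l * yh \<cong>\<^sub>N yh * yh ^ l" by (simp add: power_commutes)
  show "yh ^ l * z \<cong>\<^sub>N z * yh ^ l"
    using qcomm_power[OF z_qcomm(2), of l] inverse_t_power by (simp add: qcomm_1_iff eqN_sym)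
  have "yh * (z * z) \<cong>\<^sub>N (t * t) *\<^sub>K (z * z * yh)"
    using qcomm_mult[OF Y_z Y_z] by (simp add: qcomm_def)
  from eqN_smul[OF this, of "- \<alpha>"]
  have zz: "yh * ((- \<alpha>) *\<^sub>K (z * z)) \<cong>\<^sub>N (t * t) *\<^sub>K (((- \<alpha>) *\<^sub>K (z * z)) * yh)"
    by (simp add: mult.commute)
  have one: "yh * (c0 *\<^sub>K 1) \<cong>\<^sub>N 1 *\<^sub>K ((c0 *\<^sub>K 1) * yh)" by simp
  show "yh ^ l * xh \<cong>\<^sub>N xh * yh ^ l"
    by (rule q_root_power_commute[OF Y_X zz one])
      (use l t_neq t_root(1) in \<open>simp_all add: power_mult_distrib\<close>)
qed

text \<open>\<open>Om z\<^sup>-\<^sup>1\<close> is the Casimir element; it is multiplied by the central \<open>z ^ l\<close> to clear the denominator.\<close>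

definition Om :: 'a where
  "Om = yh * xh + (\<alpha> * t / (t - 1)) *\<^sub>K (z * z) + (c0 / (t - 1)) *\<^sub>K 1"

text \<open>\<open>Om\<close> is passed by \<open>xh\<close>, \<open>yh\<close> and z with the same
  scalars as z itself, so for \<open>Om * z ^ (l - 1)\<close> the scalars are l-th powers of roots
  of unity.\<close>

lemma Om_qcomm: "qcomm (inverse t) xh Om" "qcomm t yh Om" "qcomm 1 z Om"
proof -
  let ?a = "\<alpha> * t / (t - 1)" and ?b = "c0 / (t - 1)" and ?s = "inverse t"
  have s: "?s * t = 1" "t * ?s = 1" using t_neq by auto
  have Xzz: "xh * (z * z) \<cong>\<^sub>N (?s * ?s) *\<^sub>K (z * z * xh)"
    using qcomm_mult[OF X_z X_z] by (simp add: qcomm_def)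
  have zzY: "z * z * yh \<cong>\<^sub>N (?s * ?s) *\<^sub>K (yh * (z * z))"
    using qcomm_sym[OF qcomm_mult[OF Y_z Y_z]] t_neq by (simp add: qcomm_def)
  let ?M = "?s *\<^sub>K (yh * xh) + (?s * \<alpha>) *\<^sub>K (z * z) + (- (?s * c0)) *\<^sub>K 1"
  \<comment> \<open>These two equations determine the coefficients of z^2 and 1 in
    \<open>Om\<close>.\<close>
  have coef: "?s * \<alpha> + ?a * (?s * ?s) = ?s * ?a" "?b - ?s * c0 = ?s * ?b"
    using t_neq by (simp_all add: field_simps)
  have "xh * Om = xh * yh * xh + ?a *\<^sub>K (xh * (z * z)) + ?b *\<^sub>K xh"
    by (simp add: Om_def distrib_left mult.assoc)
  also have "\<dots> \<cong>\<^sub>N ?M * xh + ?a *\<^sub>K (?s * ?s) *\<^sub>K (z * z * xh) + ?b *\<^sub>K xh"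
    by (intro eqN_add eqN_multR X_Y' eqN_smul Xzz eqN_refl)
  also have "\<dots> = ?s *\<^sub>K (yh * xh * xh) + (?s * \<alpha> + ?a * (?s * ?s)) *\<^sub>K (z * z * xh) + (?b - ?s * c0) *\<^sub>K xh"
    by (simp add: distrib_right left_diff_distrib smul_distrib)
  also have "\<dots> = ?s *\<^sub>K (Om * xh)"
    unfolding coef by (simp add: Om_def distrib_right smul_distrib)
  finally show "qcomm ?s xh Om" by (simp add: qcomm_def)
  have "Om * yh = yh * (xh * yh) + ?a *\<^sub>K (z * z * yh) + ?b *\<^sub>K yh"
    by (simp add: Om_def distrib_right mult.assoc)
  also have "\<dots> \<cong>\<^sub>N yh * ?M + ?a *\<^sub>K (?s * ?s) *\<^sub>K (yh * (z * z)) + ?b *\<^sub>K yh"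
    by (intro eqN_add eqN_multL X_Y' eqN_smul zzY eqN_refl)
  also have "\<dots> = ?s *\<^sub>K (yh * (yh * xh)) + (?s * \<alpha> + ?a * (?s * ?s)) *\<^sub>K (yh * (z * z)) + (?b - ?s * c0) *\<^sub>K yh"
    by (simp add: distrib_left right_diff_distrib smul_distrib)
  also have "\<dots> = ?s *\<^sub>K (yh * Om)"
    unfolding coef by (simp add: Om_def distrib_left smul_distrib)
  finally have "qcomm ?s Om yh" by (simp add: qcomm_def)
  from qcomm_sym[OF this] t_neq show "qcomm t yh Om" by simp
  have "qcomm (?s * t) z (yh * xh)" by (rule qcomm_mult[OF z_qcomm(2,1)])
  then have "z * (yh * xh) \<cong>\<^sub>N yh * xh * z" using s by (simp add: qcomm_def)
  then have "z * (yh * xh) + (?a *\<^sub>K (z * z * z) + ?b *\<^sub>K z) \<cong>\<^sub>N yh * xh * z + (?a *\<^sub>K (z * z * z) + ?b *\<^sub>K z)"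
    by (intro eqN_add eqN_refl)
  then show "qcomm 1 z Om" by (simp add: qcomm_def Om_def distrib_left distrib_right mult.assoc add.assoc)
qed

lemma central_Om: "central (Om * z ^ (l - 1))"
proof (rule centralI')
  have l': "u * u ^ (l - 1) = u ^ l" for u :: 'k using l by (metis One_nat_def Suc_pred less_trans power_Suc zero_less_one)
  have "qcomm (inverse t * inverse t ^ (l - 1)) xh (Om * z ^ (l - 1))"
    by (intro qcomm_mult qcomm_power Om_qcomm X_z)
  then show "Om * z ^ (l - 1) * xh \<cong>\<^sub>N xh * (Om * z ^ (l - 1))"
    unfolding l' inverse_t_power by (simp add: qcomm_1_iff eqN_sym)
  have "qcomm (t * t ^ (l - 1)) yh (Om * z ^ (l - 1))"
    by (intro qcomm_mult qcomm_power Om_qcomm Y_z)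
  then show "Om * z ^ (l - 1) * yh \<cong>\<^sub>N yh * (Om * z ^ (l - 1))"
    unfolding l' t_root by (simp add: qcomm_1_iff eqN_sym)
  have "qcomm 1 z z" by (simp add: qcomm_1_iff)
  then have "qcomm (1 * 1 ^ (l - 1)) z (Om * z ^ (l - 1))"
    by (intro qcomm_mult qcomm_power Om_qcomm)
  then show "Om * z ^ (l - 1) * z \<cong>\<^sub>N z * (Om * z ^ (l - 1))"
    by (simp add: qcomm_1_iff eqN_sym)
qed

section \<open>Eigenvectors of z\<close>

definition zeig :: "'k \<Rightarrow> 'a \<Rightarrow> bool" where
  "zeig \<theta> v \<longleftrightarrow> v * z \<approx> \<theta> *\<^sub>K v"

lemma zeig_smul: "zeig \<theta> v \<Longrightarrow> zeig \<theta> (c *\<^sub>K v)"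
  unfolding zeig_def using eqI_smul[of "v * z" "\<theta> *\<^sub>K v" c] by (simp add: mult.commute)

lemma zeig_mult:
  assumes v: "zeig \<theta> v" and g: "qcomm u g z"
  shows "zeig (u * \<theta>) (v * g)"
proof -
  have "v * (g * z) \<approx> v * (u *\<^sub>K (z * g))" using g by (intro eqN_imp_eqI) (simp add: qcomm_def)
  also have "\<dots> = u *\<^sub>K (v * z * g)" by (simp add: mult.assoc)
  also have "\<dots> \<approx> u *\<^sub>K ((\<theta> *\<^sub>K v) * g)" using v by (intro eqI_smul eqI_mult) (simp add: zeig_def)
  finally show ?thesis by (simp add: zeig_def mult.assoc)
qed

lemma zeig_power_mult:
  assumes v: "zeig \<theta> v" and g: "qcomm u g z"
  shows "zeig (u ^ n * \<theta>) (v * g ^ n)"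
proof (induction n)
  case (Suc n)
  have "v * g ^ Suc n = v * g ^ n * g" by (simp only: power_Suc2 mult.assoc)
  moreover have "u ^ Suc n * \<theta> = u * (u ^ n * \<theta>)" by simp
  ultimately show ?case using zeig_mult[OF Suc.IH g] by (simp only:)
qed (simp add: v)

lemma zeig_z_power: "zeig \<theta> v \<Longrightarrow> v * z ^ n \<approx> \<theta> ^ n *\<^sub>K v"
proof (induction n)
  case (Suc n)
  have "v * z ^ n * z \<approx> \<theta> ^ n *\<^sub>K v * z" using Suc by (intro eqI_mult) simp
  also have "\<dots> \<approx> \<theta> ^ n *\<^sub>K (\<theta> *\<^sub>K v)"
    using eqI_smul[of "v * z" "\<theta> *\<^sub>K v" "\<theta> ^ n"] Suc.prems by (simp add: zeig_def)
  finally show ?case by (simp only: power_Suc2 mult.assoc smul_simps)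
qed simp

text \<open>The element z^l acts as a scalar \<zeta>, so X^l - \<zeta> annihilates z; a zero
  eigenvalue would contradict \<open>z_inj\<close>.\<close>

lemma zeig_exists: "\<exists>v \<theta>. v \<notin> I \<and> \<theta> \<noteq> 0 \<and> zeig \<theta> v"
proof -
  obtain \<zeta> where \<zeta>: "z ^ l \<cong>\<^sub>N \<kappa> \<zeta>" using central_scalar[OF central_powers(3)] by blast
  let ?f = "monom 1 l + smult (- 1) [:\<zeta>:]"
  have "coeff ?f l = 1" using l by (cases l) (auto simp: coeff_pCons)
  then have f0: "?f \<noteq> 0" by (metis coeff_0 zero_neq_one)
  have "peval \<kappa> z ?f = z ^ l - \<kappa> \<zeta>"
    unfolding peval_add peval_smult by (simp add: peval_monom peval_const smul_distrib)
  then have "peval \<kappa> z ?f \<in> I" using N_subset[of "z ^ l - \<kappa> \<zeta>"] \<zeta> by (simp add: eqmod_def)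
  then obtain v \<theta> where v: "v \<notin> I" "v * z \<approx> \<theta> *\<^sub>K v" using eigenvector_if_annihilated[OF f0] by blast
  then have "\<theta> \<noteq> 0" using z_inj by (auto simp: eqI_0_iff)
  with v show ?thesis by (auto simp: zeig_def)
qed

text \<open>The central element \<open>Om * z ^ (l - 1)\<close> acts as a scalar and z^(l-1) acts on
  \<open>v\<close> by a nonzero one, so \<open>Om\<close> scales \<open>v\<close>, and
  \<open>yh * xh\<close> differs from \<open>Om\<close> by terms in z^2 and 1. Hence a step along
  \<open>yh\<close> followed by one along \<open>xh\<close> returns to the line of
  \<open>v\<close>.\<close>

lemma zeig_YX_scalar:
  assumes v: "zeig \<theta> v" and \<theta>: "\<theta> \<noteq> 0"
  shows "\<exists>w. v * yh * xh \<approx> w *\<^sub>K v"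
proof -
  obtain h where h: "Om * z ^ (l - 1) \<cong>\<^sub>N \<kappa> h" using central_scalar[OF central_Om] by blast
  let ?a = "\<alpha> * t / (t - 1)" and ?b = "c0 / (t - 1)" and ?L = "\<theta> ^ (l - 1)"
  have L: "?L \<noteq> 0" using \<theta> by simp
  have "qcomm 1 Om z" using qcomm_sym[OF Om_qcomm(3)] by simp
  then have comm: "Om * z ^ (l - 1) \<cong>\<^sub>N z ^ (l - 1) * Om"
    using qcomm_power[of 1 Om z "l - 1"] by (simp add: qcomm_1_iff)
  have "?L *\<^sub>K v * Om \<approx> v * z ^ (l - 1) * Om" by (rule eqI_mult[OF eqI_sym[OF zeig_z_power[OF v]]])
  also have "\<dots> \<approx> v * (Om * z ^ (l - 1))"
    unfolding mult.assoc by (rule eqN_imp_eqI[OF eqN_sym[OF comm]])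
  also have "\<dots> \<approx> v * \<kappa> h" by (rule eqN_imp_eqI[OF h])
  finally have "inverse ?L *\<^sub>K (?L *\<^sub>K v * Om) \<approx> inverse ?L *\<^sub>K (h *\<^sub>K v)"
    by (intro eqI_smul) (simp add: smul_def \<kappa>_comm)
  then have Om: "v * Om \<approx> (inverse ?L * h) *\<^sub>K v" using L by simp
  have zz: "?a *\<^sub>K (v * (z * z)) \<approx> ?a *\<^sub>K (\<theta> ^ 2 *\<^sub>K v)"
    using zeig_z_power[OF v, of 2] by (intro eqI_smul) (simp add: power2_eq_square)
  have "v * yh * xh = v * Om - ?a *\<^sub>K (v * (z * z)) - ?b *\<^sub>K v"
    by (simp add: Om_def distrib_left mult.assoc)
  also have "\<dots> \<approx> (inverse ?L * h) *\<^sub>K v - ?a *\<^sub>K (\<theta> ^ 2 *\<^sub>K v) - ?b *\<^sub>K v"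
    by (intro eqI_diff Om zz eqI_refl)
  also have "\<dots> = (inverse ?L * h - ?a * \<theta> ^ 2 - ?b) *\<^sub>K v" by (simp add: smul_distrib)
  finally show ?thesis by blast
qed

lemma zeig_XY:
  assumes v: "zeig \<theta> v"
  shows "t *\<^sub>K (v * xh * yh) \<approx> v * yh * xh + (\<alpha> * \<theta> ^ 2 - c0) *\<^sub>K v"
proof -
  have "v * (t *\<^sub>K (xh * yh)) \<approx> v * (yh * xh + \<alpha> *\<^sub>K (z * z) - c0 *\<^sub>K 1)" by (rule eqN_imp_eqI[OF X_Y])
  also have "\<dots> = v * yh * xh + \<alpha> *\<^sub>K (v * z ^ 2) - c0 *\<^sub>K v" by (simp add: algebra_simps power2_eq_square)
  also have "\<dots> \<approx> v * yh * xh + \<alpha> *\<^sub>K (\<theta> ^ 2 *\<^sub>K v) - c0 *\<^sub>K v"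
    by (intro eqI_add eqI_diff eqI_smul zeig_z_power v eqI_refl)
  finally show ?thesis by (simp add: smul_distrib mult.assoc add_diff_eq)
qed

text \<open>The way back from \<open>xh\<close> and \<open>yh\<close> to x and y. The factor \<nu>
  undoes the multiplication by z: after multiplication by z both sides agree, and
  \<open>z_inj\<close> cancels it.\<close>

lemma act_from_shift:
  assumes v: "zeig \<theta> v" "\<theta> \<noteq> 0" and w: "zeig \<nu> w" "\<nu> \<noteq> 0" and g: "v * (g * z - d *\<^sub>K 1) \<approx> (a * \<nu>) *\<^sub>K w"
  shows "v * g \<approx> a *\<^sub>K w + (d / \<theta>) *\<^sub>K v"
proof -
  have 1: "v * g * z \<approx> (a * \<nu>) *\<^sub>K w + d *\<^sub>K v"
    using eqI_add[OF g eqI_refl, of "d *\<^sub>K v"] by (simp add: algebra_simps)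
  have 2: "(a *\<^sub>K w + (d / \<theta>) *\<^sub>K v) * z \<approx> a *\<^sub>K (\<nu> *\<^sub>K w) + (d / \<theta>) *\<^sub>K (\<theta> *\<^sub>K v)"
    using v w by (simp add: distrib_right zeig_def del: smul_simps(3)) (intro eqI_add eqI_smul)
  have "a *\<^sub>K (\<nu> *\<^sub>K w) + (d / \<theta>) *\<^sub>K (\<theta> *\<^sub>K v) = (a * \<nu>) *\<^sub>K w + d *\<^sub>K v" using v by simp
  with 1 2 have "v * g * z \<approx> (a *\<^sub>K w + (d / \<theta>) *\<^sub>K v) * z" using eqI_sym eqI_trans by metis
  then have "(v * g - (a *\<^sub>K w + (d / \<theta>) *\<^sub>K v)) * z \<in> I" by (simp add: eqI_def left_diff_distrib)
  then show ?thesis using z_inj by (simp add: eqI_def)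
qed

end

lemma inverse_conj: "\<mu> \<noteq> 0 \<Longrightarrow> inverse \<mu> * c * \<mu> = c" for \<mu> c :: "'k::field"
  by (simp add: field_simps)

text \<open>
  Closed forms, read off from the definitions of the modules, of the recursions that the relation
  between \<open>xh * yh\<close> and \<open>yh * xh\<close> imposes on the eigenvalues of these products along a chain.
\<close>

definition g_seq :: "'k::field \<Rightarrow> 'k \<Rightarrow> 'k \<Rightarrow> 'k \<Rightarrow> 'k \<Rightarrow> nat \<Rightarrow> 'k" where
  "g_seq t \<alpha> c \<theta> \<mu> k = t ^ k * \<mu> - (t ^ k - 1) / (t - 1) * (t ^ k / t * \<alpha> * \<theta> ^ 2 - c)"

lemma g_seq_simps:
  assumes t: "t \<noteq> 0" "t \<noteq> 1"
  shows "g_seq t \<alpha> c \<theta> \<mu> 0 = \<mu>"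
    and "g_seq t \<alpha> c \<theta> \<mu> (Suc k) = t * g_seq t \<alpha> c \<theta> \<mu> k - (\<alpha> * (t ^ k * \<theta>) ^ 2 - c)"
proof -
  have "t - 1 \<noteq> 0" using t by simp
  then show "g_seq t \<alpha> c \<theta> \<mu> (Suc k) = t * g_seq t \<alpha> c \<theta> \<mu> k - (\<alpha> * (t ^ k * \<theta>) ^ 2 - c)"
    unfolding g_seq_def using t(1)
    by (simp add: divide_simps) (simp add: algebra_simps power2_eq_square)
qed (simp add: g_seq_def)

definition f_seq :: "'k::field \<Rightarrow> 'k \<Rightarrow> 'k \<Rightarrow> 'k \<Rightarrow> nat \<Rightarrow> 'k" where
  "f_seq t \<alpha> c \<theta> k =
     (1 - inverse t ^ k) / (1 - inverse t) * (\<alpha> * \<theta> ^ 2 * inverse t ^ k - c / t)"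

lemma f_seq_simps:
  assumes t: "t \<noteq> 0" "t \<noteq> 1"
  shows "f_seq t \<alpha> c \<theta> 0 = 0"
    and "f_seq t \<alpha> c \<theta> (Suc k) = inverse t * (f_seq t \<alpha> c \<theta> k + (\<alpha> * (inverse t ^ k * \<theta>) ^ 2 - c))"
proof -
  have "1 - inverse t \<noteq> 0" using t by simp
  then show "f_seq t \<alpha> c \<theta> (Suc k) = inverse t * (f_seq t \<alpha> c \<theta> k + (\<alpha> * (inverse t ^ k * \<theta>) ^ 2 - c))"
    unfolding f_seq_def divide_inverse[of c]
    by (simp add: divide_simps del: power_inverse inverse_eq_divide)
       (simp add: algebra_simps power2_eq_square)
qed (simp add: f_seq_def)

context weyl_quotient
begin

section \<open>Existence of chains\<close>

lemma eqI_smul_cancel: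
  assumes "c *\<^sub>K a \<approx> b" "c \<noteq> 0"
  shows "a \<approx> inverse c *\<^sub>K b"
  using eqI_smul[OF assms(1), of "inverse c"] assms(2) by simp

abbreviation "g_coeff \<equiv> g_seq t \<alpha> c0"
abbreviation "f_coeff \<equiv> f_seq t \<alpha> c0"

lemmas g_coeff_simps = g_seq_simps[OF t_neq, of \<alpha> c0]
lemmas f_coeff_simps = f_seq_simps[OF t_neq, of \<alpha> c0]

text \<open>The triple \<mu>, \<theta>, \<open>\<mu>'\<close> will be the parameter triple of M1.
  Indices run over all natural numbers and only \<open>V l \<approx> V 0\<close> records the period;
  reduction modulo l happens when the chain is compared with the basis.\<close>

definition y_chain :: "'k \<Rightarrow> 'k \<Rightarrow> 'k \<Rightarrow> (nat \<Rightarrow> 'a) \<Rightarrow> bool" where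
  "y_chain \<mu> \<theta> \<mu>' V \<longleftrightarrow> \<mu> \<noteq> 0 \<and> \<theta> \<noteq> 0 \<and> V 0 \<notin> I \<and> (\<forall>k. zeig (t ^ k * \<theta>) (V k)) \<and>
     (\<forall>k. V k * yh \<approx> \<mu> *\<^sub>K V (Suc k)) \<and> V l \<approx> V 0 \<and>
     V 0 * xh \<approx> (inverse \<mu> * \<mu>') *\<^sub>K V (l - 1) \<and>
     (\<forall>k. V (Suc k) * xh \<approx> (inverse \<mu> * g_coeff \<theta> \<mu>' (Suc k)) *\<^sub>K V k)"

text \<open>With \<open>V l \<approx> V 0\<close> added, \<mu> and \<theta> are the parameters of
  M2; with \<mu> = 1 and a vector of the chain in \<open>I\<close>, the chain leads to M3.\<close>

definition x_chain :: "'k \<Rightarrow> 'k \<Rightarrow> (nat \<Rightarrow> 'a) \<Rightarrow> bool" where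
  "x_chain \<mu> \<theta> V \<longleftrightarrow> \<mu> \<noteq> 0 \<and> \<theta> \<noteq> 0 \<and> V 0 \<notin> I \<and> (\<forall>k. zeig (inverse t ^ k * \<theta>) (V k)) \<and>
     (\<forall>k. V k * xh \<approx> \<mu> *\<^sub>K V (Suc k)) \<and> V 0 * yh \<approx> 0 \<and>
     (\<forall>k. V (Suc k) * yh \<approx> (inverse \<mu> * f_coeff \<theta> (Suc k)) *\<^sub>K V k)"

lemma power_scaled_step: "(inverse \<mu>) ^ k *\<^sub>K (v * a ^ k) * a = \<mu> *\<^sub>K (inverse \<mu>) ^ Suc k *\<^sub>K (v * a ^ Suc k)"
  if "\<mu> \<noteq> 0" for \<mu> :: 'k and v a :: 'a
proof -
  have "\<mu> * inverse \<mu> ^ Suc k = inverse \<mu> ^ k" using that by simp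
  then show ?thesis by (simp only: smul_simps power_Suc2[of a] mult.assoc)
qed

lemma power_scaled_root:
  assumes "a ^ l \<cong>\<^sub>N \<kappa> (\<mu> ^ l)" "\<mu> \<noteq> 0"
  shows "(inverse \<mu>) ^ l *\<^sub>K (v * a ^ l) \<approx> v"
proof -
  have "(inverse \<mu>) ^ l *\<^sub>K (v * a ^ l) \<approx> (inverse \<mu>) ^ l *\<^sub>K (v * \<kappa> (\<mu> ^ l))"
    by (intro eqI_smul eqN_imp_eqI assms)
  also have "\<dots> = v" using assms(2) by (simp add: \<kappa>_eq_smul power_mult_distrib[symmetric])
  finally show ?thesis .
qed

text \<open>Rescaling by an l-th root of the scalar of \<open>yh ^ l\<close> closes the chain. By
  \<open>zeig_XY\<close> one eigenvalue of \<open>xh * yh\<close> determines the later ones; the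
  first, at \<open>V 0\<close>, is the eigenvalue \<open>w\<close> of \<open>yh * xh\<close> at
  \<open>V (l - 1)\<close>, carried over the closing point.\<close>

lemma y_chain_exists:
  assumes v: "v \<notin> I" "zeig \<theta> v" "\<theta> \<noteq> 0" and \<eta>: "yh ^ l \<cong>\<^sub>N \<kappa> \<eta>" "\<eta> \<noteq> 0"
  shows "\<exists>\<mu> \<mu>' V. y_chain \<mu> \<theta> \<mu>' V"
proof -
  obtain \<mu> where \<mu>: "\<mu> ^ l = \<eta>" using nth_root_exists[of l \<eta>] l by auto
  then have \<mu>0: "\<mu> \<noteq> 0" using \<eta>(2) l by (auto simp: power_0_left)
  define V where "V k = (inverse \<mu>) ^ k *\<^sub>K (v * yh ^ k)" for k
  have eig: "zeig (t ^ k * \<theta>) (V k)" for k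
    unfolding V_def by (intro zeig_smul zeig_power_mult v Y_z)
  have yV: "V k * yh = \<mu> *\<^sub>K V (Suc k)" for k
    unfolding V_def by (rule power_scaled_step[OF \<mu>0])
  have V0: "V 0 = v" by (simp add: V_def)
  have Vl: "V l \<approx> V 0"
    unfolding V0 unfolding V_def using \<eta>(1) \<mu> \<mu>0 by (intro power_scaled_root) auto
  have xV: "V (Suc k) * xh = inverse \<mu> *\<^sub>K (V k * yh * xh)" for k
    using \<mu>0 by (simp add: yV)
  have "t ^ (l - 1) * \<theta> \<noteq> 0" using t_neq v(3) by simp
  then obtain w where w: "V (l - 1) * yh * xh \<approx> w *\<^sub>K V (l - 1)" using zeig_YX_scalar[OF eig] by blast
  have l': "l = Suc (l - 1)" using l by simp
  have "V 0 * xh \<approx> V l * xh" by (rule eqI_mult[OF eqI_sym[OF Vl]])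
  also have "\<dots> = inverse \<mu> *\<^sub>K (V (l - 1) * yh * xh)" by (subst l') (rule xV)
  also have "\<dots> \<approx> inverse \<mu> *\<^sub>K (w *\<^sub>K V (l - 1))" by (rule eqI_smul[OF w])
  finally have x0: "V 0 * xh \<approx> (inverse \<mu> * w) *\<^sub>K V (l - 1)" by simp
  have step: "V (Suc k) * xh \<approx> (inverse \<mu> * g_coeff \<theta> w (Suc k)) *\<^sub>K V k"
    if "V k * xh * yh \<approx> g_coeff \<theta> w k *\<^sub>K V k" for k
  proof -
    let ?d = "\<alpha> * (t ^ k * \<theta>) ^ 2 - c0"
    have "V k * yh * xh = V k * yh * xh + ?d *\<^sub>K V k - ?d *\<^sub>K V k" by simp
    also have "\<dots> \<approx> t *\<^sub>K (V k * xh * yh) - ?d *\<^sub>K V k"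
      by (intro eqI_diff eqI_sym[OF zeig_XY[OF eig]] eqI_refl)
    also have "\<dots> \<approx> t *\<^sub>K (g_coeff \<theta> w k *\<^sub>K V k) - ?d *\<^sub>K V k"
      by (intro eqI_diff eqI_smul that eqI_refl)
    also have "\<dots> = g_coeff \<theta> w (Suc k) *\<^sub>K V k"
      unfolding g_coeff_simps(2) by (simp add: smul_distrib)
    finally have "inverse \<mu> *\<^sub>K (V k * yh * xh) \<approx> inverse \<mu> *\<^sub>K (g_coeff \<theta> w (Suc k) *\<^sub>K V k)"
      by (rule eqI_smul)
    then show ?thesis by (simp add: xV)
  qed
  have xy: "V k * xh * yh \<approx> g_coeff \<theta> w k *\<^sub>K V k" for k
  proof (induction k)
    case 0
    have "V 0 * xh * yh \<approx> (inverse \<mu> * w) *\<^sub>K V (l - 1) * yh" by (rule eqI_mult[OF x0])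
    also have "\<dots> = (inverse \<mu> * w * \<mu>) *\<^sub>K V l" using l' yV[of "l - 1"] by simp
    also have "\<dots> = w *\<^sub>K V l" by (simp only: inverse_conj[OF \<mu>0])
    also have "\<dots> \<approx> w *\<^sub>K V 0" by (rule eqI_smul[OF Vl])
    finally show ?case by (simp add: g_coeff_simps)
  next
    case (Suc k)
    have "V (Suc k) * xh * yh \<approx> (inverse \<mu> * g_coeff \<theta> w (Suc k)) *\<^sub>K V k * yh"
      by (rule eqI_mult[OF step[OF Suc.IH]])
    also have "\<dots> = (inverse \<mu> * g_coeff \<theta> w (Suc k) * \<mu>) *\<^sub>K V (Suc k)" by (simp add: yV)
    also have "\<dots> = g_coeff \<theta> w (Suc k) *\<^sub>K V (Suc k)" by (simp only: inverse_conj[OF \<mu>0])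
    finally show ?case .
  qed
  have "y_chain \<mu> \<theta> w V"
    unfolding y_chain_def using \<mu>0 v V0 eig yV Vl x0 step[OF xy] by simp
  then show ?thesis by blast
qed

text \<open>As \<open>yh\<close> kills the start, the eigenvalues of \<open>yh * xh\<close> begin
  with 0 and \<open>zeig_XY\<close> fixes all of them, so no third parameter appears.\<close>

lemma x_chain_power:
  assumes v: "v \<notin> I" "zeig \<theta> v" "\<theta> \<noteq> 0" "v * yh \<in> I" and \<mu>: "\<mu> \<noteq> 0"
  shows "x_chain \<mu> \<theta> (\<lambda>k. (inverse \<mu>) ^ k *\<^sub>K (v * xh ^ k))"
proof -
  define V where "V k = (inverse \<mu>) ^ k *\<^sub>K (v * xh ^ k)" for k
  have eig: "zeig (inverse t ^ k * \<theta>) (V k)" for k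
    unfolding V_def by (intro zeig_smul zeig_power_mult v X_z)
  have xV: "V k * xh = \<mu> *\<^sub>K V (Suc k)" for k
    unfolding V_def by (rule power_scaled_step[OF \<mu>])
  have V0: "V 0 = v" by (simp add: V_def)
  have yV: "V (Suc k) * yh = inverse \<mu> *\<^sub>K (V k * xh * yh)" for k
    using \<mu> by (simp add: xV)
  have step: "V (Suc k) * yh \<approx> (inverse \<mu> * f_coeff \<theta> (Suc k)) *\<^sub>K V k"
    if "V k * yh * xh \<approx> f_coeff \<theta> k *\<^sub>K V k" for k
  proof -
    let ?d = "\<alpha> * (inverse t ^ k * \<theta>) ^ 2 - c0"
    have "t *\<^sub>K (V k * xh * yh) \<approx> V k * yh * xh + ?d *\<^sub>K V k" by (rule zeig_XY[OF eig])
    also have "\<dots> \<approx> f_coeff \<theta> k *\<^sub>K V k + ?d *\<^sub>K V k"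
      by (intro eqI_add that eqI_refl)
    also have "\<dots> = (f_coeff \<theta> k + ?d) *\<^sub>K V k" by (simp add: smul_distrib)
    finally have "V k * xh * yh \<approx> inverse t *\<^sub>K ((f_coeff \<theta> k + ?d) *\<^sub>K V k)"
      by (rule eqI_smul_cancel) (rule t_neq)
    then have "V k * xh * yh \<approx> f_coeff \<theta> (Suc k) *\<^sub>K V k" unfolding f_coeff_simps(2) by simp
    then have "inverse \<mu> *\<^sub>K (V k * xh * yh) \<approx> inverse \<mu> *\<^sub>K (f_coeff \<theta> (Suc k) *\<^sub>K V k)" by (rule eqI_smul)
    then show ?thesis by (simp add: yV)
  qed
  have yx: "V k * yh * xh \<approx> f_coeff \<theta> k *\<^sub>K V k" for k
  proof (induction k)
    case 0
    then show ?case using v(4) mult_mem by (simp add: V0 f_coeff_simps eqI_0_iff)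
  next
    case (Suc k)
    have "V (Suc k) * yh * xh \<approx> (inverse \<mu> * f_coeff \<theta> (Suc k)) *\<^sub>K V k * xh"
      by (rule eqI_mult[OF step[OF Suc.IH]])
    also have "\<dots> = (inverse \<mu> * f_coeff \<theta> (Suc k) * \<mu>) *\<^sub>K V (Suc k)" by (simp add: xV)
    also have "\<dots> = f_coeff \<theta> (Suc k) *\<^sub>K V (Suc k)"
      by (simp only: inverse_conj[OF \<mu>])
    finally show ?case .
  qed
  show ?thesis
    unfolding V_def[symmetric] x_chain_def using \<mu> v V0 eig xV step[OF yx] by (simp add: eqI_0_iff)
qed

text \<open>The new vector is the power image \<open>v * yh ^ m\<close> just before the first one in
  \<open>I\<close>.\<close>

lemma x_chain_start_exists:
  assumes v: "v \<notin> I" "zeig \<theta> v" "\<theta> \<noteq> 0" and \<eta>: "yh ^ l \<in> N"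
  shows "\<exists>v \<theta>. v \<notin> I \<and> zeig \<theta> v \<and> \<theta> \<noteq> 0 \<and> v * yh \<in> I"
proof -
  define n where "n = (LEAST n. v * yh ^ n \<in> I)"
  have "v * yh ^ l \<in> I" using \<eta> by (simp add: N_def)
  then have n: "v * yh ^ n \<in> I" unfolding n_def by (rule LeastI)
  have "n \<noteq> 0" using n v(1) by (metis mult_1_right power_0)
  then obtain m where m: "n = Suc m" by (cases n) auto
  then have "v * yh ^ m \<notin> I" using not_less_Least[of m "\<lambda>n. v * yh ^ n \<in> I"] by (simp add: n_def)
  moreover have "zeig (t ^ m * \<theta>) (v * yh ^ m)" by (intro zeig_power_mult v Y_z)
  moreover have "v * yh ^ m * yh \<in> I" using n by (simp only: m power_Suc2 mult.assoc)
  moreover have "t ^ m * \<theta> \<noteq> 0" using t_neq v(3) by simp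
  ultimately show ?thesis by blast
qed

lemma kspan_right_ideal:
  assumes u: "u \<in> kspan B"
    and B: "\<And>b. b \<in> B \<Longrightarrow> b * x \<in> kspan B" "\<And>b. b \<in> B \<Longrightarrow> b * y \<in> kspan B" "\<And>b. b \<in> B \<Longrightarrow> b * z \<in> kspan B"
  shows "u * p \<in> kspan B"
proof -
  have "p \<in> {p. u * p \<in> kspan B}"
  proof (rule generation)
    fix c show "\<kappa> c \<in> {p. u * p \<in> kspan B}" using kspan_smul[OF u, of c] by (simp add: smul_def \<kappa>_comm)
  qed (use B kspan_mult kspan_add in \<open>auto simp: distrib_left mult.assoc[symmetric]\<close>)
  then show ?thesis by simp
qed

text \<open>
  By the condition on \<open>f_coeff\<close>, \<open>yh\<close> kills \<open>v * xh ^ s\<close>, so the vectors \<open>v * xh ^ k\<close> with \<open>k \<ge> s\<close> span a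
  submodule.  Were it nonzero, it would contain \<open>v\<close>, contradicting the nilpotency of \<open>xh\<close>.
\<close>

lemma x_chain_vanish:
  assumes v: "v \<notin> I" "zeig \<theta> v" "\<theta> \<noteq> 0" "v * yh \<in> I" and \<xi>: "xh ^ l \<in> N"
    and s: "0 < s" "f_coeff \<theta> s = 0"
  shows "v * xh ^ s \<in> I"
proof (rule ccontr)
  assume neg: "v * xh ^ s \<notin> I"
  have ch: "x_chain 1 \<theta> (\<lambda>k. 1 *\<^sub>K (v * xh ^ k))" using x_chain_power[OF v, of 1] by simp
  define V where "V k = v * xh ^ k" for k
  have V: "zeig (inverse t ^ k * \<theta>) (V k)" "V k * xh \<approx> 1 *\<^sub>K V (Suc k)"
    "V (Suc k) * yh \<approx> f_coeff \<theta> (Suc k) *\<^sub>K V k" for k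
    using ch by (simp_all add: x_chain_def V_def)
  have nz: "inverse t ^ k * \<theta> \<noteq> 0" for k using t_neq v(3) by simp
  define B where "B = V ` {s..}"
  have VB: "V k \<in> kspan B" if "k \<ge> s" for k using that by (auto simp: B_def intro: kspan_base)
  have xB: "V k * x \<in> kspan B" if "k \<ge> s" for k
  proof -
    let ?n = "inverse t ^ Suc k * \<theta>"
    have "V k * (x * z - bx *\<^sub>K 1) \<approx> (inverse ?n * ?n) *\<^sub>K V (Suc k)"
      unfolding left_inverse[OF nz] using V(2)[of k] unfolding xh_def .
    then have e: "V k * x \<approx> inverse ?n *\<^sub>K V (Suc k) + (bx / (inverse t ^ k * \<theta>)) *\<^sub>K V k"
      by (rule act_from_shift[OF V(1) nz V(1) nz])
    show ?thesis
      by (rule kspan_cong[OF _ eqI_sym[OF e]]) (use that in \<open>auto intro!: kspan_add kspan_smul VB\<close>)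
  qed
  have yB: "V k * y \<in> kspan B" if k: "k \<ge> s" for k
  proof -
    obtain j where j: "k = Suc j" using k s(1) by (cases k) auto
    let ?c = "f_coeff \<theta> (Suc j) / (inverse t ^ j * \<theta>)"
    have "?c * (inverse t ^ j * \<theta>) = f_coeff \<theta> (Suc j)"
      by (rule nonzero_eq_divide_eq[OF nz, THEN iffD1]) (rule refl)
    then have "V k * (y * z - dy *\<^sub>K 1) \<approx> (?c * (inverse t ^ j * \<theta>)) *\<^sub>K V j"
      using V(3)[of j] unfolding yh_def j by (simp only:)
    then have e: "V k * y \<approx> ?c *\<^sub>K V j + (dy / (inverse t ^ k * \<theta>)) *\<^sub>K V k"
      by (rule act_from_shift[OF V(1) nz V(1) nz])
    \<comment> \<open>At the bottom k = s the vector \<open>V j\<close> is not among the generators,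
      but its coefficient is zero by the condition on s.\<close>
    have "?c *\<^sub>K V j \<in> kspan B"
    proof (cases "k = s")
      case True
      then show ?thesis using s(2) j by (simp add: kspan_zero)
    next
      case False
      then show ?thesis using k j by (intro kspan_smul VB) auto
    qed
    then show ?thesis
      by (intro kspan_cong[OF kspan_add[OF _ kspan_smul[OF VB[OF k]]] eqI_sym[OF e]])
  qed
  have zB: "V k * z \<in> kspan B" if "k \<ge> s" for k
    using V(1)[of k] unfolding zeig_def by (intro kspan_cong[OF kspan_smul[OF VB[OF that]] eqI_sym])
  obtain g where "1 - V s * g \<in> I" using maximal neg by (auto simp: V_def)
  then have "(1 - V s * g) * v \<in> I" by (rule mult_mem)
  then have vs: "V s * (g * v) \<approx> v" using eqI_sym by (simp add: eqI_def left_diff_distrib mult.assoc)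
  have "V s * (g * v) \<in> kspan B"
    by (rule kspan_right_ideal) (use VB xB yB zB in \<open>auto simp: B_def\<close>)
  then have vB: "v \<in> kspan B" using vs by (rule kspan_cong)
  \<comment> \<open>Since s > 0, every generator has a factor \<open>xh\<close> right after
    \<open>v\<close>; the cofactor is kept commuting with \<open>xh\<close> so that the resulting
    congruence can be iterated.\<close>
  have "\<exists>f. u \<approx> v * xh * f \<and> f * xh = xh * f" if "u \<in> kspan B" for u
    using that
  proof induction
    case kspan_zero
    then show ?case by (intro exI[of _ 0]) simp
  next
    case (kspan_base b)
    then obtain k where "k \<ge> s" "b = v * xh ^ k" by (auto simp: B_def V_def)
    moreover then have "k = Suc (k - 1)" using s(1) by simp
    ultimately have "b = v * xh * xh ^ (k - 1)" by (metis mult.assoc power_Suc)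
    then show ?case by (intro exI[of _ "xh ^ (k - 1)"]) (simp add: power_commutes)
  next
    case (kspan_add u w)
    then obtain f f' where "u \<approx> v * xh * f" "f * xh = xh * f" "w \<approx> v * xh * f'" "f' * xh = xh * f'" by blast
    then show ?case
      by (intro exI[of _ "f + f'"]) (simp add: distrib_left distrib_right eqI_add)
  next
    case (kspan_smul u c)
    then obtain f where "u \<approx> v * xh * f" "f * xh = xh * f" by blast
    then show ?case
      by (intro exI[of _ "c *\<^sub>K f"]) (simp add: eqI_smul)
  next
    case (kspan_cong u w)
    then obtain f where f: "u \<approx> v * xh * f" "f * xh = xh * f" by blast
    have "w \<approx> v * xh * f" by (rule eqI_trans[OF eqI_sym[OF kspan_cong.hyps(2)] f(1)])
    with f(2) show ?case by blast
  qed
  from this[OF vB] obtain f where f: "v \<approx> v * xh * f" "f * xh = xh * f" by blast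
  have fp: "f * xh ^ n = xh ^ n * f" for n
    by (induction n) (simp_all add: mult.assoc[symmetric] f(2), simp add: mult.assoc)
  \<comment> \<open>Substituting \<open>v \<approx> v * xh * f\<close> into itself n times; at n = l
    the nilpotency of \<open>xh\<close> forces \<open>v\<close> into \<open>I\<close>.\<close>
  have "v \<approx> v * xh ^ n * f ^ n" for n
  proof (induction n)
    case (Suc n)
    have "v * (xh ^ n * f ^ n) \<approx> v * xh * f * (xh ^ n * f ^ n)" by (rule eqI_mult[OF f(1)])
    also have "\<dots> = v * xh * (f * xh ^ n) * f ^ n" by (simp only: mult.assoc)
    also have "\<dots> = v * xh ^ Suc n * f ^ Suc n" by (simp only: fp power_Suc mult.assoc)
    finally have "v * xh ^ n * f ^ n \<approx> v * xh ^ Suc n * f ^ Suc n" by (simp only: mult.assoc)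
    with Suc.IH show ?case by (rule eqI_trans)
  qed simp
  moreover have "v * xh ^ l \<in> I" using \<xi> by (simp add: N_def)
  then have "v * xh ^ l * f ^ l \<in> I" by (rule mult_mem)
  ultimately show False using v(1) eqI_mem by blast
qed

text \<open>The split is by the vanishing of the scalars of \<open>yh ^ l\<close> and
  \<open>xh ^ l\<close>. In the last case there is no period to close, so the scale is set to 1, and
  the chain is cut at every positive zero of \<open>f_coeff\<close>; which zero is the dimension is
  settled only with the explicit module.\<close>

lemma chains_exhaustive:
  "(\<exists>\<mu> \<theta> \<mu>' V. y_chain \<mu> \<theta> \<mu>' V) \<or> (\<exists>\<mu> \<theta> V. x_chain \<mu> \<theta> V \<and> V l \<approx> V 0) \<or>
   (\<exists>\<theta> V. x_chain 1 \<theta> V \<and> (\<forall>s. 0 < s \<and> f_coeff \<theta> s = 0 \<longrightarrow> V s \<in> I))"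
proof -
  obtain v \<theta> where v: "v \<notin> I" "zeig \<theta> v" "\<theta> \<noteq> 0" using zeig_exists by blast
  obtain \<eta> where \<eta>: "yh ^ l \<cong>\<^sub>N \<kappa> \<eta>" using central_scalar[OF central_Y_power] by blast
  obtain \<xi> where \<xi>: "xh ^ l \<cong>\<^sub>N \<kappa> \<xi>" using central_scalar[OF central_X_power] by blast
  show ?thesis
  proof (cases "\<eta> = 0")
    case False
    then show ?thesis using y_chain_exists[OF v \<eta>] by blast
  next
    case True
    then have "yh ^ l \<in> N" using \<eta> by (simp add: eqmod_def)
    then obtain v \<theta> where v: "v \<notin> I" "zeig \<theta> v" "\<theta> \<noteq> 0" "v * yh \<in> I"
      using x_chain_start_exists[OF v] by blast
    show ?thesis
    proof (cases "\<xi> = 0")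
      case True
      then have "xh ^ l \<in> N" using \<xi> by (simp add: eqmod_def)
      then have "\<forall>s. 0 < s \<and> f_coeff \<theta> s = 0 \<longrightarrow> v * xh ^ s \<in> I" using x_chain_vanish[OF v] by blast
      moreover have "x_chain 1 \<theta> (\<lambda>k. v * xh ^ k)" using x_chain_power[OF v, of 1] by simp
      ultimately show ?thesis by blast
    next
      case False
      obtain \<mu> where \<mu>: "\<mu> ^ l = \<xi>" using nth_root_exists[of l \<xi>] l by auto
      then have \<mu>0: "\<mu> \<noteq> 0" using False l by (auto simp: power_0_left)
      have "(inverse \<mu>) ^ l *\<^sub>K (v * xh ^ l) \<approx> v"
        using \<xi> \<mu> \<mu>0 by (intro power_scaled_root) auto
      then show ?thesis using x_chain_power[OF v \<mu>0] by fastforce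
    qed
  qed
qed

end

section \<open>The action of the free algebra\<close>

lemma lookup_scale [simp]: "Poly_Mapping.lookup (scale c v) k = c * Poly_Mapping.lookup v k"
  unfolding scale_def by (simp add: Poly_Mapping.map.rep_eq when_def)

lemma scale_simps [simp]:
  "scale c (u + v) = scale c u + scale c v" "scale c (scale d v) = scale (c * d) v"
  "scale 0 v = 0" "scale c 0 = 0" "scale 1 v = v"
  "scale c (Poly_Mapping.single k a) = Poly_Mapping.single k (c * a)"
  by (rule poly_mapping_eqI, simp add: lookup_add lookup_single when_def algebra_simps)+

lemma scale_add_left: "scale (c + d) v = scale c v + scale d v"
  by (rule poly_mapping_eqI) (simp add: lookup_add algebra_simps)

lemma keys_scale: "Poly_Mapping.keys (scale c v) \<subseteq> Poly_Mapping.keys v"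
  by (auto simp: in_keys_iff)

lemma poly_mapping_sum_singles:
  "(p :: 'a \<Rightarrow>\<^sub>0 'b::comm_monoid_add) = (\<Sum>k\<in>Poly_Mapping.keys p. Poly_Mapping.single k (Poly_Mapping.lookup p k))"
proof (rule poly_mapping_eqI)
  fix k
  have "(\<Sum>j\<in>Poly_Mapping.keys p. Poly_Mapping.lookup (Poly_Mapping.single j (Poly_Mapping.lookup p j)) k) =
    (\<Sum>j\<in>Poly_Mapping.keys p. if j = k then Poly_Mapping.lookup p j else 0)"
    by (intro sum.cong) (auto simp: lookup_single when_def)
  also have "\<dots> = Poly_Mapping.lookup p k" by (auto simp: in_keys_iff)
  finally show "Poly_Mapping.lookup p k =
    Poly_Mapping.lookup (\<Sum>k\<in>Poly_Mapping.keys p. Poly_Mapping.single k (Poly_Mapping.lookup p k)) k"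
    by (simp add: lookup_sum)
qed

lemma poly_mapping_add_induct [case_names single add]:
  assumes "\<And>k c. P (Poly_Mapping.single k c)" and "\<And>u v. P u \<Longrightarrow> P v \<Longrightarrow> P (u + v)"
  shows "P (p :: 'a \<Rightarrow>\<^sub>0 'b::comm_monoid_add)"
proof -
  have "P (\<Sum>k\<in>S. Poly_Mapping.single k (Poly_Mapping.lookup p k))" if "finite S" for S
    using that
  proof induction
    case empty
    show ?case using assms(1)[of undefined 0] by simp
  qed (use assms in auto)
  from this[of "Poly_Mapping.keys p"] show ?thesis
    using poly_mapping_sum_singles[of p] by simp
qed

lemma lincomb_superset:
  assumes "finite S" "Poly_Mapping.keys v \<subseteq> S" and "\<And>k. h k 0 = 0"
  shows "(\<Sum>k\<in>Poly_Mapping.keys v. h k (Poly_Mapping.lookup v k)) = (\<Sum>k\<in>S. h k (Poly_Mapping.lookup v k))"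
  using assms by (intro sum.mono_neutral_left) (auto simp: in_keys_iff)

lemma lincomb_add:
  assumes "\<And>k. h k 0 = 0" and "\<And>k a b. h k (a + b) = h k a + h k b"
  shows "(\<Sum>k\<in>Poly_Mapping.keys (u + v). h k (Poly_Mapping.lookup (u + v) k)) =
    (\<Sum>k\<in>Poly_Mapping.keys u. h k (Poly_Mapping.lookup u k)) + (\<Sum>k\<in>Poly_Mapping.keys v. h k (Poly_Mapping.lookup v k))"
proof -
  let ?S = "Poly_Mapping.keys u \<union> Poly_Mapping.keys v"
  have S: "(\<Sum>k\<in>Poly_Mapping.keys w. h k (Poly_Mapping.lookup w k)) = (\<Sum>k\<in>?S. h k (Poly_Mapping.lookup w k))"
    if "Poly_Mapping.keys w \<subseteq> ?S" for w
    by (rule lincomb_superset) (use that assms(1) in auto)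
  show ?thesis
    unfolding S[OF keys_add] S[OF Un_upper1] S[OF Un_upper2] by (simp add: lookup_add assms(2) sum.distrib)
qed

lemma lin_ext_add [simp]: "lin_ext f (u + v) = lin_ext f u + lin_ext f v"
  unfolding lin_ext_def by (rule lincomb_add) (simp_all add: scale_add_left)

lemma lin_ext_single [simp]: "lin_ext f (Poly_Mapping.single k c) = scale c (f k)"
  by (cases "c = 0") (simp_all add: lin_ext_def)

lemma lin_ext_scale [simp]: "lin_ext f (scale c v) = scale c (lin_ext f v)"
  by (induction v rule: poly_mapping_add_induct) simp_all

lemma keys_lin_ext:
  assumes "Poly_Mapping.keys v \<subseteq> B" "\<And>k. k \<in> B \<Longrightarrow> Poly_Mapping.keys (f k) \<subseteq> B"
  shows "Poly_Mapping.keys (lin_ext f v) \<subseteq> B"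
proof -
  have "Poly_Mapping.keys (lin_ext f v) \<subseteq> (\<Union>k\<in>Poly_Mapping.keys v. Poly_Mapping.keys (scale (Poly_Mapping.lookup v k) (f k)))"
    unfolding lin_ext_def by (rule keys_sum)
  also have "\<dots> \<subseteq> B" using assms keys_scale by fastforce
  finally show ?thesis .
qed

definition word_act :: "(gen \<Rightarrow> nat \<Rightarrow> (nat \<Rightarrow>\<^sub>0 'k)) \<Rightarrow> word \<Rightarrow> (nat \<Rightarrow>\<^sub>0 'k::field) \<Rightarrow> (nat \<Rightarrow>\<^sub>0 'k)" where
  "word_act f w v = fold (\<lambda>g. lin_ext (f g)) (letters w) v"

lemma word_act_linear [simp]:
  "word_act f w (u + v) = word_act f w u + word_act f w v"
  "word_act f w (scale c v) = scale c (word_act f w v)"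
proof -
  have "fold (\<lambda>g. lin_ext (f g)) ls (u + v) = fold (\<lambda>g. lin_ext (f g)) ls u + fold (\<lambda>g. lin_ext (f g)) ls v" for ls
    by (induction ls arbitrary: u v) simp_all
  then show "word_act f w (u + v) = word_act f w u + word_act f w v" by (simp add: word_act_def)
  have "fold (\<lambda>g. lin_ext (f g)) ls (scale c v) = scale c (fold (\<lambda>g. lin_ext (f g)) ls v)" for ls
    by (induction ls arbitrary: v) simp_all
  then show "word_act f w (scale c v) = scale c (word_act f w v)" by (simp add: word_act_def)
qed

lemma free_act_add_right [simp]: "free_act f v (p + r) = free_act f v p + free_act f v r"
  unfolding free_act_def by (rule lincomb_add) (simp_all add: scale_add_left)

lemma free_act_single [simp]: "free_act f v (Poly_Mapping.single w c) = scale c (word_act f w v)"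
  by (cases "c = 0") (simp_all add: free_act_def word_act_def)

lemma free_act_add_left [simp]: "free_act f (u + v) p = free_act f u p + free_act f v p"
  by (induction p rule: poly_mapping_add_induct) simp_all

lemma free_act_scale [simp]: "free_act f (scale c v) p = scale c (free_act f v p)"
  by (induction p rule: poly_mapping_add_induct) (simp_all add: mult.commute)

lemma free_act_0 [simp]: "free_act f 0 p = 0" "free_act f v 0 = 0"
  using free_act_scale[of f 0 0 p] by (simp_all add: free_act_def)

lemma free_act_diff_right: "free_act f v (p - r) = free_act f v p - free_act f v r"
  using free_act_add_right[of f v "p - r" r] by (simp del: free_act_add_right)

lemma free_act_mult: "free_act f v (p * r) = free_act f (free_act f v p) r"
proof (induction p arbitrary: v rule: poly_mapping_add_induct)
  case (single w c)
  show ?case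
  proof (induction r rule: poly_mapping_add_induct)
    case (single w' c')
    have "word_act f (w + w') v = word_act f w' (word_act f w v)"
      by (simp add: word_act_def plus_word_def)
    then show ?case by (simp add: mult_single mult.commute)
  qed (simp add: distrib_left)
qed (simp add: distrib_right)

lemma free_act_gen [simp]: "free_act f v (gen g) = lin_ext (f g) v"
  by (simp add: gen_def word_act_def)

lemma free_act_const [simp]: "free_act f v (const c) = scale c v"
  by (simp add: const_def word_act_def zero_word_def)

lemma free_act_one [simp]: "free_act f v 1 = v"
  using free_act_const[of f v 1] by (simp add: const_def)

text \<open>Words are built by appending letters, since the leftmost letter acts first; this is the
  shape of the assumption \<open>generation\<close>.\<close>

lemma free_alg_generation:
  assumes const: "\<And>c. const c \<in> S" and add: "\<And>u v. u \<in> S \<Longrightarrow> v \<in> S \<Longrightarrow> u + v \<in> S"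
    and gen: "\<And>u g. u \<in> S \<Longrightarrow> u * gen g \<in> S"
  shows "(p :: 'k::field free_alg) \<in> S"
proof (induction p rule: poly_mapping_add_induct)
  case (single w c)
  have "Poly_Mapping.single (Word ls) c \<in> S" for ls
  proof (induction ls rule: rev_induct)
    case Nil
    show ?case using const[of c] by (simp add: const_def zero_word_def)
  next
    case (snoc g ls)
    have "Poly_Mapping.single (Word (ls @ [g])) c = Poly_Mapping.single (Word ls) c * gen g"
      by (simp add: gen_def mult_single plus_word_def)
    then show ?case using gen[OF snoc] by simp
  qed
  from this[of "letters w"] show ?case by simp
qed (rule add)

lemma const_hom:
  "const (c + d) = const c + const d" "const (c * d) = const c * const d" "const 1 = 1"
  "p * const c = const c * p"
proof -
  show "const (c + d) = const c + const d" "const (c * d) = const c * const d" "const 1 = 1"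
    by (simp_all add: const_def single_add mult_single)
  show "p * const c = const c * p"
    by (induction p rule: poly_mapping_add_induct)
      (simp_all add: const_def mult_single distrib_left distrib_right mult.commute)
qed


section \<open>Modules over the algebra\<close>

abbreviation free_ring :: "'k::field free_alg ring" where
  "free_ring \<equiv> ring_of_type_algebra"

lemma free_ring_simps:
  "carrier free_ring = UNIV" "p \<otimes>\<^bsub>free_ring\<^esub> r = p * r" "p \<oplus>\<^bsub>free_ring\<^esub> r = p + r"
  "\<one>\<^bsub>free_ring\<^esub> = 1" "\<zero>\<^bsub>free_ring\<^esub> = 0"
  by (simp_all add: ring_of_type_algebra_def)

lemma free_ring: "ring free_ring"
proof -
  have "\<exists>y. x + y = 0" for x :: "'a free_alg" by (rule exI[of _ "- x"]) simp
  then show ?thesis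
    unfolding ring_of_type_algebra_def
    by unfold_locales (auto simp: algebra_simps Units_def)
qed

lemma relation_ideal_ideal: "ideal (relation_ideal q \<alpha> \<beta> \<gamma>) free_ring"
  unfolding relation_ideal_def by (rule ring.genideal_ideal[OF free_ring]) (simp add: free_ring_simps)

text \<open>Connects the predicate \<open>two_sided_ideal\<close> on the type with the ideals of
  \<open>free_ring\<close>. It is how relators that act as zero make the whole relation ideal act as
  zero.\<close>

lemma relation_ideal_minimal:
  assumes N: "two_sided_ideal N" and "relators q \<alpha> \<beta> \<gamma> \<subseteq> N"
  shows "relation_ideal q \<alpha> \<beta> \<gamma> \<subseteq> N"
  unfolding relation_ideal_def
proof (rule ring.genideal_minimal[OF free_ring _ assms(2)])
  interpret ring "free_ring :: 'a free_alg ring" by (rule free_ring)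
  have inv: "inv\<^bsub>add_monoid (free_ring :: 'a free_alg ring)\<^esub> p = - p" for p
    using minus_equality[of "- p" p] by (simp add: free_ring_simps a_inv_def)
  have "subgroup N (add_monoid free_ring)"
  proof (rule subgroup.intro)
    show "inv\<^bsub>add_monoid free_ring\<^esub> p \<in> N" if "p \<in> N" for p
      unfolding inv using two_sided_idealD(6)[OF N that] .
  qed (auto simp: free_ring_simps two_sided_idealD[OF N])
  then show "ideal N free_ring"
    by (rule idealI[OF free_ring]) (auto simp: free_ring_simps two_sided_idealD[OF N])
qed

lemma A_class_eq: "A_class q \<alpha> \<beta> \<gamma> p = (\<lambda>h. h + p) ` relation_ideal q \<alpha> \<beta> \<gamma>"
  by (auto simp: A_class_def a_r_coset_def' free_ring_simps)

lemma A_class_hom: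
  "A_class q \<alpha> \<beta> \<gamma> p \<otimes>\<^bsub>A_alg q \<alpha> \<beta> \<gamma>\<^esub> A_class q \<alpha> \<beta> \<gamma> r = A_class q \<alpha> \<beta> \<gamma> (p * r)"
  "A_class q \<alpha> \<beta> \<gamma> p \<oplus>\<^bsub>A_alg q \<alpha> \<beta> \<gamma>\<^esub> A_class q \<alpha> \<beta> \<gamma> r = A_class q \<alpha> \<beta> \<gamma> (p + r)"
  "\<one>\<^bsub>A_alg q \<alpha> \<beta> \<gamma>\<^esub> = A_class q \<alpha> \<beta> \<gamma> 1"
  "carrier (A_alg q \<alpha> \<beta> \<gamma>) = range (A_class q \<alpha> \<beta> \<gamma>)"
proof -
  interpret ideal "relation_ideal q \<alpha> \<beta> \<gamma>" free_ring by (rule relation_ideal_ideal)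
  show "A_class q \<alpha> \<beta> \<gamma> p \<otimes>\<^bsub>A_alg q \<alpha> \<beta> \<gamma>\<^esub> A_class q \<alpha> \<beta> \<gamma> r = A_class q \<alpha> \<beta> \<gamma> (p * r)"
    using rcoset_mult_add[of p r] by (simp add: A_alg_def A_class_def FactRing_def free_ring_simps)
  show "A_class q \<alpha> \<beta> \<gamma> p \<oplus>\<^bsub>A_alg q \<alpha> \<beta> \<gamma>\<^esub> A_class q \<alpha> \<beta> \<gamma> r = A_class q \<alpha> \<beta> \<gamma> (p + r)"
    using a_rcos_sum[of p r] by (simp add: A_alg_def A_class_def FactRing_def free_ring_simps)
  show "\<one>\<^bsub>A_alg q \<alpha> \<beta> \<gamma>\<^esub> = A_class q \<alpha> \<beta> \<gamma> 1"
    by (simp add: A_alg_def A_class_def FactRing_def free_ring_simps)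
  show "carrier (A_alg q \<alpha> \<beta> \<gamma>) = range (A_class q \<alpha> \<beta> \<gamma>)"
    by (auto simp: A_alg_def A_class_def FactRing_def A_RCOSETS_def' free_ring_simps)
qed

lemma ring_A_alg: "ring (A_alg q \<alpha> \<beta> \<gamma>)"
  unfolding A_alg_def by (rule ideal.quotient_is_ring[OF relation_ideal_ideal])

lemma A_class_relator:
  assumes "r \<in> relators q \<alpha> \<beta> \<gamma>"
  shows "A_class q \<alpha> \<beta> \<gamma> r = A_class q \<alpha> \<beta> \<gamma> 0"
proof -
  interpret ideal "relation_ideal q \<alpha> \<beta> \<gamma>" free_ring by (rule relation_ideal_ideal)
  have "r \<in> relation_ideal q \<alpha> \<beta> \<gamma>"
    unfolding relation_ideal_def using assms ring.genideal_self[OF free_ring, of "relators q \<alpha> \<beta> \<gamma>"]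
    by (auto simp: free_ring_simps)
  then have "relation_ideal q \<alpha> \<beta> \<gamma> +>\<^bsub>free_ring\<^esub> r = relation_ideal q \<alpha> \<beta> \<gamma>"
    by (rule ring.a_rcos_zero[OF free_ring relation_ideal_ideal])
  moreover have "relation_ideal q \<alpha> \<beta> \<gamma> +>\<^bsub>free_ring\<^esub> 0 = relation_ideal q \<alpha> \<beta> \<gamma>"
    using ring.a_rcos_zero[OF free_ring relation_ideal_ideal
        additive_subgroup.zero_closed[OF ideal.axioms(1)[OF relation_ideal_ideal]]]
    by (simp add: free_ring_simps)
  ultimately show ?thesis by (simp add: A_class_def)
qed

locale A_module = right_module "A_alg q \<alpha> \<beta> \<gamma>" M
  for q \<alpha> \<beta> \<gamma> :: "'k::field" and M :: "('k free_alg set, 'm) right_module"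
begin

text \<open>The module pulled back to the free algebra, where computations use elements of a type in
  place of cosets.\<close>

definition act :: "'m \<Rightarrow> 'k free_alg \<Rightarrow> 'm" where
  "act m p = m \<triangleleft>\<^bsub>M\<^esub> A_class q \<alpha> \<beta> \<gamma> p"

lemma A_class_carrier: "A_class q \<alpha> \<beta> \<gamma> p \<in> carrier (A_alg q \<alpha> \<beta> \<gamma>)"
  by (simp add: A_class_hom)

lemma act_closed: "m \<in> carrier M \<Longrightarrow> act m p \<in> carrier M"
  unfolding act_def by (rule ract_closed[OF _ A_class_carrier])

lemma act_add_right: "m \<in> carrier M \<Longrightarrow> act m (p + r) = act m p \<oplus>\<^bsub>M\<^esub> act m r"
  unfolding act_def A_class_hom(2)[symmetric] by (rule ract_add_right[OF _ A_class_carrier A_class_carrier])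

lemma act_add_left: "m \<in> carrier M \<Longrightarrow> n \<in> carrier M \<Longrightarrow> act (m \<oplus>\<^bsub>M\<^esub> n) p = act m p \<oplus>\<^bsub>M\<^esub> act n p"
  unfolding act_def by (rule ract_add_left[OF _ _ A_class_carrier])

lemma act_mult: "m \<in> carrier M \<Longrightarrow> act m (p * r) = act (act m p) r"
  unfolding act_def A_class_hom(1)[symmetric] by (rule ract_mult[OF _ A_class_carrier A_class_carrier])

lemma act_one: "m \<in> carrier M \<Longrightarrow> act m 1 = m"
  unfolding act_def A_class_hom(3)[symmetric] by (rule ract_one)

lemma act_0_right: "m \<in> carrier M \<Longrightarrow> act m 0 = \<zero>\<^bsub>M\<^esub>"
  using act_add_right[of m 0 0] M.add.r_cancel_one'[of "act m 0" "act m 0"] act_closed[of m 0] by simp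

lemma act_0_left: "act \<zero>\<^bsub>M\<^esub> p = \<zero>\<^bsub>M\<^esub>"
  using act_add_left[OF M.zero_closed M.zero_closed, of p]
    M.add.r_cancel_one'[of "act \<zero>\<^bsub>M\<^esub> p" "act \<zero>\<^bsub>M\<^esub> p"] act_closed[OF M.zero_closed, of p] by simp

lemma act_uminus: "m \<in> carrier M \<Longrightarrow> act m (- p) = \<ominus>\<^bsub>M\<^esub> act m p"
  using act_add_right[of m "- p" p] act_0_right[of m] act_closed
  by (intro M.minus_equality[symmetric]) simp_all

lemma act_diff: "m \<in> carrier M \<Longrightarrow> act m (p - r) = act m p \<ominus>\<^bsub>M\<^esub> act m r"
  using act_add_right[of m p "- r"] by (simp add: act_uminus M.minus_eq)

lemma act_diff_eq_0_iff:
  assumes m: "m \<in> carrier M"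
  shows "act m (p - r) = \<zero>\<^bsub>M\<^esub> \<longleftrightarrow> act m p = act m r"
proof
  assume "act m (p - r) = \<zero>\<^bsub>M\<^esub>"
  then show "act m p = act m r"
    using act_add_right[OF m, of "p - r" r] act_closed[OF m] by simp
next
  assume "act m p = act m r"
  then show "act m (p - r) = \<zero>\<^bsub>M\<^esub>"
    using act_diff[OF m] act_closed[OF m] by (simp add: M.minus_eq M.r_neg)
qed

lemma act_relator:
  assumes "m \<in> carrier M" "r \<in> relators q \<alpha> \<beta> \<gamma>"
  shows "act m r = \<zero>\<^bsub>M\<^esub>"
proof -
  have "act m r = act m 0" by (simp only: act_def A_class_relator[OF assms(2)])
  then show ?thesis by (simp only: act_0_right[OF assms(1)])
qed

lemma cyclic_submodule:
  assumes m: "m \<in> carrier M"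
  shows "right_submodule (range (act m)) (A_alg q \<alpha> \<beta> \<gamma>) M"
  unfolding right_submodule_def
proof (intro conjI ballI)
  show "additive_subgroup (range (act m)) M"
  proof (intro additive_subgroup.intro M.add.subgroupI)
    show "range (act m) \<subseteq> carrier M" using act_closed[OF m] by auto
    show "\<ominus>\<^bsub>M\<^esub> a \<in> range (act m)" if "a \<in> range (act m)" for a
      using that act_uminus[OF m] by (auto simp: image_iff intro: sym)
    show "a \<oplus>\<^bsub>M\<^esub> b \<in> range (act m)" if "a \<in> range (act m)" "b \<in> range (act m)" for a b
      using that act_add_right[OF m] by (auto simp: image_iff intro: sym)
  qed simp
  fix n a assume "n \<in> range (act m)" "a \<in> carrier (A_alg q \<alpha> \<beta> \<gamma>)"
  then obtain p r where pr: "n = act m p" "a = A_class q \<alpha> \<beta> \<gamma> r" by (auto simp: A_class_hom)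
  have "n \<triangleleft>\<^bsub>M\<^esub> a = act m (p * r)" using act_mult[OF m, of p r] by (simp add: pr act_def)
  then show "n \<triangleleft>\<^bsub>M\<^esub> a \<in> range (act m)" by simp
qed

lemma simple_act_surj:
  assumes S: "simple_right_module (A_alg q \<alpha> \<beta> \<gamma>) M"
    and m: "m \<in> carrier M" "m \<noteq> \<zero>\<^bsub>M\<^esub>" and n: "n \<in> carrier M"
  shows "\<exists>p. n = act m p"
proof -
  have "range (act m) = {\<zero>\<^bsub>M\<^esub>} \<or> range (act m) = carrier M"
    using S cyclic_submodule[OF m(1)] by (simp add: simple_right_module_def)
  moreover have "m \<in> range (act m)" using act_one[OF m(1)] by (metis rangeI)
  ultimately show ?thesis using m n by (auto simp: image_iff)
qed

end

section \<open>Isomorphisms and quotients from annihilators of vectors\<close>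

lemma A_moduleI:
  fixes M :: "('k::field free_alg set, 'm) right_module"
  shows "simple_right_module (A_alg q \<alpha> \<beta> \<gamma>) M \<Longrightarrow> A_module q \<alpha> \<beta> \<gamma> M"
  by (simp add: A_module_def simple_right_module_def)

text \<open>Annihilators of nonzero vectors of a simple module are maximal right ideals, so the
  assumed inclusion is an equality (\<open>ann2\<close> is the other half), and sending m p to b p
  is a well-defined bijection.\<close>

lemma simple_modules_isomorphic:
  fixes M :: "('k::field free_alg set, 'm) right_module" and B :: "('k free_alg set, 'n) right_module"
  assumes SM: "simple_right_module (A_alg q \<alpha> \<beta> \<gamma>) M" and SB: "simple_right_module (A_alg q \<alpha> \<beta> \<gamma>) B"
    and m: "m \<in> carrier M" "m \<noteq> \<zero>\<^bsub>M\<^esub>" and b: "b \<in> carrier B"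
    and ann: "\<And>p. b \<triangleleft>\<^bsub>B\<^esub> A_class q \<alpha> \<beta> \<gamma> p = \<zero>\<^bsub>B\<^esub> \<Longrightarrow> m \<triangleleft>\<^bsub>M\<^esub> A_class q \<alpha> \<beta> \<gamma> p = \<zero>\<^bsub>M\<^esub>"
  shows "isomorphic_right_modules (A_alg q \<alpha> \<beta> \<gamma>) M B"
proof -
  interpret M: A_module q \<alpha> \<beta> \<gamma> M by (rule A_moduleI[OF SM])
  interpret B: A_module q \<alpha> \<beta> \<gamma> B by (rule A_moduleI[OF SB])
  have ann1: "M.act m p = \<zero>\<^bsub>M\<^esub>" if "B.act b p = \<zero>\<^bsub>B\<^esub>" for p
    using ann that by (simp add: M.act_def B.act_def)
  have b0: "b \<noteq> \<zero>\<^bsub>B\<^esub>"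
    using ann1[of 1] m B.act_0_left M.act_one by metis
  have ann2: "B.act b p = \<zero>\<^bsub>B\<^esub>" if p: "M.act m p = \<zero>\<^bsub>M\<^esub>" for p
  proof (rule ccontr)
    assume "B.act b p \<noteq> \<zero>\<^bsub>B\<^esub>"
    then obtain r where "b = B.act (B.act b p) r"
      using B.simple_act_surj[OF SB B.act_closed[OF b] _ b] by blast
    then have "B.act b 1 = B.act b (p * r)" using b by (simp add: B.act_one B.act_mult)
    then have "B.act b (1 - p * r) = \<zero>\<^bsub>B\<^esub>" using b by (simp add: B.act_diff_eq_0_iff)
    then have "M.act m 1 = M.act m (p * r)" using ann1 m by (simp add: M.act_diff_eq_0_iff[symmetric])
    then have "m = M.act (M.act m p) r" using m by (simp add: M.act_one M.act_mult)
    then show False using p m M.act_0_left by simp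
  qed
  have eq: "M.act m p = M.act m r \<longleftrightarrow> B.act b p = B.act b r" for p r
    using ann1[of "p - r"] ann2[of "p - r"] m b by (auto simp: M.act_diff_eq_0_iff B.act_diff_eq_0_iff)
  define h where "h u = B.act b (SOME p. u = M.act m p)" for u
  have h: "h (M.act m p) = B.act b p" for p
  proof -
    have "M.act m p = M.act m (SOME r. M.act m p = M.act m r)" by (rule someI[of _ p]) simp
    then show ?thesis unfolding h_def using eq by metis
  qed
  have Msurj: "\<exists>p. u = M.act m p" if "u \<in> carrier M" for u
    using M.simple_act_surj[OF SM m that] .
  have Bsurj: "\<exists>p. u = B.act b p" if "u \<in> carrier B" for u
    using B.simple_act_surj[OF SB b b0 that] .
  show ?thesis
    unfolding isomorphic_right_modules_def
  proof (intro exI[of _ h] conjI ballI)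
    show "bij_betw h (carrier M) (carrier B)"
    proof (rule bij_betwI')
      fix u v assume "u \<in> carrier M" "v \<in> carrier M"
      then obtain p r where "u = M.act m p" "v = M.act m r" using Msurj by metis
      then show "h u = h v \<longleftrightarrow> u = v" by (simp add: h eq)
    next
      fix u assume "u \<in> carrier M"
      then obtain p where "u = M.act m p" using Msurj by metis
      then show "h u \<in> carrier B" using B.act_closed[OF b] by (simp add: h)
    next
      fix w assume "w \<in> carrier B"
      then obtain p where "w = B.act b p" using Bsurj by metis
      then show "\<exists>u\<in>carrier M. w = h u" using M.act_closed[OF m(1)] h by metis
    qed
  next
    fix u v assume "u \<in> carrier M" "v \<in> carrier M"
    then obtain p r where pr: "u = M.act m p" "v = M.act m r" using Msurj by metis
    then have "u \<oplus>\<^bsub>M\<^esub> v = M.act m (p + r)" using m by (simp add: M.act_add_right)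
    then show "h (u \<oplus>\<^bsub>M\<^esub> v) = h u \<oplus>\<^bsub>B\<^esub> h v" using b by (simp add: h pr B.act_add_right)
  next
    fix u a assume "u \<in> carrier M" "a \<in> carrier (A_alg q \<alpha> \<beta> \<gamma>)"
    then obtain p r where pr: "u = M.act m p" "a = A_class q \<alpha> \<beta> \<gamma> r"
      using Msurj by (metis A_class_hom(4) imageE)
    have "u \<triangleleft>\<^bsub>M\<^esub> a = M.act m (p * r)" using m by (simp add: M.act_mult) (simp add: pr M.act_def)
    moreover have "h u \<triangleleft>\<^bsub>B\<^esub> a = B.act b (p * r)" using b by (simp add: B.act_mult pr h) (simp add: B.act_def)
    ultimately show "h (u \<triangleleft>\<^bsub>M\<^esub> a) = h u \<triangleleft>\<^bsub>B\<^esub> a" by (simp add: h)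
  qed
qed

text \<open>Maximality of the annihilator says that every nonzero vector of M generates M. A relator
  kills every vector and not only m, which puts it into \<open>N\<close>.\<close>

lemma weyl_quotient_of_module:
  fixes q \<alpha> \<beta> \<gamma> :: "'k::alg_closed_field" and M :: "('k free_alg set, 'm) right_module"
  assumes S: "simple_right_module (A_alg q \<alpha> \<beta> \<gamma>) M" and z: "acts_invertibly M (A_class q \<alpha> \<beta> \<gamma> (gen Gz))"
    and l: "l > 1" "primitive_root_of_unity l (q ^ 2)"
    and m: "m \<in> carrier M" "m \<noteq> \<zero>\<^bsub>M\<^esub>"
  shows "weyl_quotient {p. m \<triangleleft>\<^bsub>M\<^esub> A_class q \<alpha> \<beta> \<gamma> p = \<zero>\<^bsub>M\<^esub>} const (gen Gx) (gen Gy) (gen Gz) (q ^ 2) \<alpha> \<beta> \<gamma> l"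
proof -
  interpret M: A_module q \<alpha> \<beta> \<gamma> M by (rule A_moduleI[OF S])
  have I: "{p. m \<triangleleft>\<^bsub>M\<^esub> A_class q \<alpha> \<beta> \<gamma> p = \<zero>\<^bsub>M\<^esub>} = {p. M.act m p = \<zero>\<^bsub>M\<^esub>}" by (simp add: M.act_def)
  interpret maximal_right_ideal "{p. M.act m p = \<zero>\<^bsub>M\<^esub>}" const
  proof
    fix a p :: "'k free_alg" assume "a \<in> {p. M.act m p = \<zero>\<^bsub>M\<^esub>}"
    then show "a * p \<in> {p. M.act m p = \<zero>\<^bsub>M\<^esub>}" using m by (simp add: M.act_mult M.act_0_left)
  next
    fix a :: "'k free_alg" assume "a \<notin> {p. M.act m p = \<zero>\<^bsub>M\<^esub>}"
    then obtain g where "m = M.act (M.act m a) g"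
      using M.simple_act_surj[OF S M.act_closed[OF m(1)] _ m(1)] by blast
    then have "M.act m 1 = M.act m (a * g)" using m by (simp add: M.act_one M.act_mult)
    then show "\<exists>g. 1 - a * g \<in> {p. M.act m p = \<zero>\<^bsub>M\<^esub>}" using m by (auto simp: M.act_diff_eq_0_iff)
  next
    fix p :: "'k free_alg" and c show "p * const c = const c * p" by (rule const_hom)
  qed (use m in \<open>simp_all add: M.act_0_right M.act_diff M.act_one const_hom(1-3) M.minus_eq\<close>)
  have rel: "r \<in> N" if "r \<in> relators q \<alpha> \<beta> \<gamma>" for r
    using that m M.act_closed by (simp add: N_def M.act_mult M.act_relator)
  show ?thesis
    unfolding I
  proof
    have powi: "q powi 2 = q ^ 2" "q powi (-2) = inverse (q ^ 2)"
      by (simp_all add: power_int_def power_inverse)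
    show "eqmod N (gen Gx * gen Gy) (smul (q ^ 2) (gen Gy * gen Gx) + smul \<alpha> 1)"
      using rel[of "gen Gx * gen Gy - (const (q powi 2) * gen Gy * gen Gx + const \<alpha>)"]
      by (simp add: relators_def eqmod_def smul_def powi mult.assoc)
    show "eqmod N (gen Gx * gen Gz) (smul (inverse (q ^ 2)) (gen Gz * gen Gx) + smul \<beta> 1)"
      using rel[of "gen Gx * gen Gz - (const (q powi (-2)) * gen Gz * gen Gx + const \<beta>)"]
      by (simp only: relators_def eqmod_def smul_def powi mult.assoc mult_1_right) simp
    show "eqmod N (gen Gy * gen Gz) (smul (q ^ 2) (gen Gz * gen Gy) + smul \<gamma> 1)"
      using rel[of "gen Gy * gen Gz - (const (q powi 2) * gen Gz * gen Gy + const \<gamma>)"]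
      by (simp add: relators_def eqmod_def smul_def powi mult.assoc)
  next
    fix p :: "'k free_alg" assume "p * gen Gz \<in> {p. M.act m p = \<zero>\<^bsub>M\<^esub>}"
    then have "M.act (M.act m p) (gen Gz) = M.act \<zero>\<^bsub>M\<^esub> (gen Gz)" using m by (simp add: M.act_mult M.act_0_left)
    moreover have "inj_on (\<lambda>m. M.act m (gen Gz)) (carrier M)"
      using z by (simp add: acts_invertibly_def bij_betw_def M.act_def)
    ultimately have "M.act m p = \<zero>\<^bsub>M\<^esub>"
      using M.act_closed[OF m(1)] M.M.zero_closed by (simp add: inj_on_def)
    then show "p \<in> {p. M.act m p = \<zero>\<^bsub>M\<^esub>}" by simp
  next
    fix S :: "'k free_alg set" and p
    assume const: "\<And>c. const c \<in> S" and add: "\<And>u v. u \<in> S \<Longrightarrow> v \<in> S \<Longrightarrow> u + v \<in> S"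
      and g: "\<And>u. u \<in> S \<Longrightarrow> u * gen Gx \<in> S" "\<And>u. u \<in> S \<Longrightarrow> u * gen Gy \<in> S" "\<And>u. u \<in> S \<Longrightarrow> u * gen Gz \<in> S"
    have "u * gen a \<in> S" if "u \<in> S" for u a by (cases a) (use g[OF that] in simp_all)
    with const add show "p \<in> S" by (rule free_alg_generation)
  qed (use l in auto)
qed

text \<open>The generator maps are defined at all natural numbers, hence the restriction to k < n.
  Checking the relators on basis vectors is enough by linearity.\<close>

locale based_rep =
  fixes n :: nat and f :: "gen \<Rightarrow> nat \<Rightarrow> (nat \<Rightarrow>\<^sub>0 'k::field)" and q \<alpha> \<beta> \<gamma> :: 'k
  assumes closed: "k < n \<Longrightarrow> Poly_Mapping.keys (f g k) \<subseteq> {..<n}"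
    and relation: "k < n \<Longrightarrow> r \<in> relators q \<alpha> \<beta> \<gamma> \<Longrightarrow> free_act f (Poly_Mapping.single k 1) r = 0"
begin

abbreviation "V \<equiv> {v :: nat \<Rightarrow>\<^sub>0 'k. Poly_Mapping.keys v \<subseteq> {..<n}}"
abbreviation "B \<equiv> based_module n f"

lemma V_closed: "u \<in> V \<Longrightarrow> v \<in> V \<Longrightarrow> u + v \<in> V" "u \<in> V \<Longrightarrow> scale c u \<in> V" "u \<in> V \<Longrightarrow> - u \<in> V" "0 \<in> V"
  using keys_add[of u v] keys_scale[of c u] by auto

lemma free_act_closed:
  assumes v: "v \<in> V"
  shows "free_act f v p \<in> V"
proof -
  have "p \<in> {p. free_act f v p \<in> V}"
  proof (rule free_alg_generation)
    fix c show "const c \<in> {p. free_act f v p \<in> V}" using V_closed(2)[OF v] by simp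
  next
    fix p r assume "p \<in> {p. free_act f v p \<in> V}" "r \<in> {p. free_act f v p \<in> V}"
    then show "p + r \<in> {p. free_act f v p \<in> V}" using V_closed(1) by simp
  next
    fix p g assume "p \<in> {p. free_act f v p \<in> V}"
    then show "p * gen g \<in> {p. free_act f v p \<in> V}"
      using keys_lin_ext[of "free_act f v p" "{..<n}" "f g"] closed by (simp add: free_act_mult)
  qed
  then show ?thesis by simp
qed

lemma free_act_relator:
  assumes v: "v \<in> V" and r: "r \<in> relators q \<alpha> \<beta> \<gamma>"
  shows "free_act f v r = 0"
proof -
  have sum: "free_act f (\<Sum>k\<in>S. u k) r = (\<Sum>k\<in>S. free_act f (u k) r)" for S :: "nat set" and u
    by (induction S rule: infinite_finite_induct) simp_all
  have "v = (\<Sum>k\<in>Poly_Mapping.keys v. scale (Poly_Mapping.lookup v k) (Poly_Mapping.single k 1))"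
    using poly_mapping_sum_singles[of v] by simp
  then have "free_act f v r =
      free_act f (\<Sum>k\<in>Poly_Mapping.keys v. scale (Poly_Mapping.lookup v k) (Poly_Mapping.single k 1)) r"
    by (rule arg_cong[where f = "\<lambda>v. free_act f v r"])
  also have "\<dots> =
      (\<Sum>k\<in>Poly_Mapping.keys v. scale (Poly_Mapping.lookup v k) (free_act f (Poly_Mapping.single k 1) r))"
    by (simp only: sum free_act_scale)
  also have "\<dots> = 0" using v r by (intro sum.neutral) (auto simp: relation)
  finally show ?thesis .
qed

text \<open>The elements killing all of \<open>V\<close> form a two-sided ideal because
  \<open>V\<close> is stable; the annihilator of a single vector is in general only a right
  ideal.\<close>

lemma free_act_relation_ideal:
  assumes v: "v \<in> V" and r: "r \<in> relation_ideal q \<alpha> \<beta> \<gamma>"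
  shows "free_act f v r = 0"
proof -
  have "two_sided_ideal {r. \<forall>v\<in>V. free_act f v r = 0}"
    unfolding two_sided_ideal_def
  proof (intro conjI ballI allI CollectI)
    fix a p u assume "a \<in> {r. \<forall>v\<in>V. free_act f v r = 0}" and u: "u \<in> V"
    then have a: "free_act f v a = 0" if "v \<in> V" for v using that by blast
    show "free_act f u (a * p) = 0" "free_act f u (p * a) = 0"
      using a[OF u] a[OF free_act_closed[OF u]] by (simp_all add: free_act_mult)
  qed (auto simp: free_act_diff_right)
  then have "relation_ideal q \<alpha> \<beta> \<gamma> \<subseteq> {r. \<forall>v\<in>V. free_act f v r = 0}"
    by (rule relation_ideal_minimal) (use free_act_relator in blast)
  then show ?thesis using v r by blast
qed

text \<open>The class of p is p plus the relation ideal, which acts as zero, so its image is a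
  singleton and \<open>the_elem\<close> picks the action of p.\<close>

lemma ract_A_class:
  assumes v: "v \<in> V"
  shows "v \<triangleleft>\<^bsub>B\<^esub> A_class q \<alpha> \<beta> \<gamma> p = free_act f v p"
proof -
  interpret ideal "relation_ideal q \<alpha> \<beta> \<gamma>" free_ring by (rule relation_ideal_ideal)
  have "0 \<in> relation_ideal q \<alpha> \<beta> \<gamma>"
    using additive_subgroup.zero_closed[OF is_additive_subgroup] by (simp add: free_ring_simps)
  moreover have "free_act f v ` A_class q \<alpha> \<beta> \<gamma> p = (\<lambda>h. free_act f v p) ` relation_ideal q \<alpha> \<beta> \<gamma>"
    unfolding A_class_eq image_image
    by (rule image_cong[OF refl]) (simp only: free_act_add_right free_act_relation_ideal[OF v] add_0_left)
  ultimately have "free_act f v ` A_class q \<alpha> \<beta> \<gamma> p = {free_act f v p}"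
    by (simp only: image_constant)
  then show ?thesis by (simp add: based_module_def)
qed

lemma B_simps: "carrier B = V" "u \<oplus>\<^bsub>B\<^esub> v = u + v" "\<zero>\<^bsub>B\<^esub> = 0"
  by (simp_all add: based_module_def)

lemma right_module_B: "right_module (A_alg q \<alpha> \<beta> \<gamma>) B"
proof (intro right_module.intro ring_A_alg)
  show "abelian_group B"
  proof (rule abelian_groupI)
    fix u assume u: "u \<in> carrier B"
    show "\<exists>v\<in>carrier B. v \<oplus>\<^bsub>B\<^esub> u = \<zero>\<^bsub>B\<^esub>"
      using u V_closed(3)[of u] by (intro bexI[of _ "- u"]) (simp_all add: B_simps)
  next
    fix u v assume "u \<in> carrier B" "v \<in> carrier B"
    then show "u \<oplus>\<^bsub>B\<^esub> v \<in> carrier B" using V_closed(1) by (simp add: B_simps)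
  qed (simp_all add: B_simps add.assoc add.commute)
  have A: "\<exists>p. a = A_class q \<alpha> \<beta> \<gamma> p" if "a \<in> carrier (A_alg q \<alpha> \<beta> \<gamma>)" for a
    using that by (auto simp: A_class_hom)
  show "right_module_axioms (A_alg q \<alpha> \<beta> \<gamma>) B"
  proof
    fix m a assume m: "m \<in> carrier B" and "a \<in> carrier (A_alg q \<alpha> \<beta> \<gamma>)"
    then obtain p where a: "a = A_class q \<alpha> \<beta> \<gamma> p" using A by blast
    show "m \<triangleleft>\<^bsub>B\<^esub> a \<in> carrier B"
      using m free_act_closed by (simp add: a ract_A_class B_simps)
    {
      fix m' assume "m' \<in> carrier B"
      then show "(m \<oplus>\<^bsub>B\<^esub> m') \<triangleleft>\<^bsub>B\<^esub> a = m \<triangleleft>\<^bsub>B\<^esub> a \<oplus>\<^bsub>B\<^esub> m' \<triangleleft>\<^bsub>B\<^esub> a"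
        using m V_closed(1) unfolding B_simps a by (simp only: ract_A_class free_act_add_left)
    }
    fix b assume "b \<in> carrier (A_alg q \<alpha> \<beta> \<gamma>)"
    then obtain r where b: "b = A_class q \<alpha> \<beta> \<gamma> r" using A by blast
    show "m \<triangleleft>\<^bsub>B\<^esub> (a \<oplus>\<^bsub>A_alg q \<alpha> \<beta> \<gamma>\<^esub> b) = m \<triangleleft>\<^bsub>B\<^esub> a \<oplus>\<^bsub>B\<^esub> m \<triangleleft>\<^bsub>B\<^esub> b"
      using m unfolding a b A_class_hom B_simps by (simp only: ract_A_class free_act_add_right)
    show "m \<triangleleft>\<^bsub>B\<^esub> (a \<otimes>\<^bsub>A_alg q \<alpha> \<beta> \<gamma>\<^esub> b) = m \<triangleleft>\<^bsub>B\<^esub> a \<triangleleft>\<^bsub>B\<^esub> b"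
      using m free_act_closed unfolding a b A_class_hom B_simps by (simp only: ract_A_class free_act_mult)
  next
    fix m assume "m \<in> carrier B"
    then show "m \<triangleleft>\<^bsub>B\<^esub> \<one>\<^bsub>A_alg q \<alpha> \<beta> \<gamma>\<^esub> = m"
      unfolding A_class_hom B_simps by (simp only: ract_A_class free_act_one)
  qed
qed

text \<open>
  If \<open>gen Gz\<close> acts diagonally with distinct eigenvalues, a submodule is the span of the basis vectors
  it contains.
\<close>

lemma simple_based_module:
  assumes n: "n > 0" and diag: "\<And>k. k < n \<Longrightarrow> f Gz k = Poly_Mapping.single k (\<nu> k)" and inj: "inj_on \<nu> {..<n}"
    and conn: "\<And>S. S \<subseteq> {..<n} \<Longrightarrow> S \<noteq> {} \<Longrightarrow>
      (\<And>k g. k \<in> S \<Longrightarrow> Poly_Mapping.keys (f g k) \<subseteq> S) \<Longrightarrow> S = {..<n}"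
  shows "simple_right_module (A_alg q \<alpha> \<beta> \<gamma>) B"
  unfolding simple_right_module_def
proof (intro conjI allI impI right_module_B)
  have "Poly_Mapping.single 0 (1::'k) \<in> V" using n by auto
  moreover have "Poly_Mapping.single 0 (1::'k) \<noteq> (0 :: nat \<Rightarrow>\<^sub>0 'k)" by (metis lookup_single_eq lookup_zero zero_neq_one)
  ultimately show "carrier B \<noteq> {\<zero>\<^bsub>B\<^esub>}" unfolding B_simps by blast
  fix N assume N: "right_submodule N (A_alg q \<alpha> \<beta> \<gamma>) B"
  interpret additive_subgroup N B using N by (simp add: right_submodule_def)
  have NV: "N \<subseteq> V" using a_subset by (simp add: B_simps)
  have Nadd: "u + v \<in> N" if "u \<in> N" "v \<in> N" for u v using a_closed[OF that] by (simp add: B_simps)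
  have N0: "0 \<in> N" using zero_closed by (simp add: B_simps)
  have Nact: "free_act f v p \<in> N" if "v \<in> N" for v p
  proof -
    have "v \<triangleleft>\<^bsub>B\<^esub> A_class q \<alpha> \<beta> \<gamma> p \<in> N" using N that by (simp add: right_submodule_def A_class_hom)
    then show ?thesis using ract_A_class NV that by auto
  qed
  have Nscale: "scale c v \<in> N" if "v \<in> N" for c v using Nact[OF that, of "const c"] by simp
  have graded: "Poly_Mapping.single j (Poly_Mapping.lookup v j) \<in> N" if "v \<in> N" for v j
    using that
  proof (induction "card (Poly_Mapping.keys v)" arbitrary: v rule: less_induct)
    case less
    show ?case
    proof (cases "Poly_Mapping.keys v \<subseteq> {j}")
      case True
      then have "Poly_Mapping.single j (Poly_Mapping.lookup v j) = v"
        by (intro poly_mapping_eqI) (auto simp: lookup_single when_def in_keys_iff)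
      then show ?thesis using less.prems by simp
    next
      case False
      then obtain k where k: "k \<in> Poly_Mapping.keys v" "k \<noteq> j" by blast
      show ?thesis
      proof (cases "j \<in> Poly_Mapping.keys v")
        case False
        then show ?thesis using N0 by (simp add: in_keys_iff)
      next
        case True
        have kn: "k < n" "j < n" using k True NV less.prems by auto
        \<comment> \<open>Subtracting \<open>\<nu> k\<close> from z removes the k-th coordinate and
          multiplies the j-th by \<open>\<nu> j - \<nu> k\<close>, which is nonzero; the support
          shrinks.\<close>
        define w where "w = free_act f v (gen Gz) + scale (- \<nu> k) v"
        have wN: "w \<in> N" unfolding w_def by (intro Nadd Nact Nscale less.prems)
        have lz: "Poly_Mapping.lookup (lin_ext (f Gz) v) i = \<nu> i * Poly_Mapping.lookup v i" for i
        proof -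
          have "Poly_Mapping.lookup (lin_ext (f Gz) v) i =
              (\<Sum>k\<in>Poly_Mapping.keys v. if k = i then \<nu> k * Poly_Mapping.lookup v k else 0)"
            unfolding lin_ext_def lookup_sum
          proof (intro sum.cong refl)
            fix k assume "k \<in> Poly_Mapping.keys v"
            then have "k < n" using NV less.prems by auto
            then show "Poly_Mapping.lookup (scale (Poly_Mapping.lookup v k) (f Gz k)) i =
                (if k = i then \<nu> k * Poly_Mapping.lookup v k else 0)"
              by (simp add: diag lookup_single when_def mult.commute)
          qed
          then show ?thesis by (simp add: in_keys_iff)
        qed
        have w: "Poly_Mapping.lookup w i = (\<nu> i - \<nu> k) * Poly_Mapping.lookup v i" for i
          by (simp add: w_def lookup_add lz algebra_simps)
        have "Poly_Mapping.keys w \<subset> Poly_Mapping.keys v"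
        proof
          show "Poly_Mapping.keys w \<subseteq> Poly_Mapping.keys v" by (auto simp: in_keys_iff w)
          show "Poly_Mapping.keys w \<noteq> Poly_Mapping.keys v"
            using k(1) w[of k] by (auto simp: in_keys_iff)
        qed
        then have "card (Poly_Mapping.keys w) < card (Poly_Mapping.keys v)"
          by (intro psubset_card_mono) auto
        then have "Poly_Mapping.single j (Poly_Mapping.lookup w j) \<in> N" using less.hyps wN by blast
        then have "scale (inverse (\<nu> j - \<nu> k)) (Poly_Mapping.single j (Poly_Mapping.lookup w j)) \<in> N"
          by (rule Nscale)
        moreover have "\<nu> j - \<nu> k \<noteq> 0" using inj kn k(2) by (auto simp: inj_on_def)
        ultimately show ?thesis by (simp add: w mult.assoc[symmetric])
      qed
    qed
  qed
  define S where "S = {k. k < n \<and> Poly_Mapping.single k 1 \<in> N}"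
  have S: "j \<in> S" if "v \<in> N" "j \<in> Poly_Mapping.keys v" for v j
  proof -
    have "scale (inverse (Poly_Mapping.lookup v j)) (Poly_Mapping.single j (Poly_Mapping.lookup v j)) \<in> N"
      by (intro Nscale graded that)
    then show ?thesis using that NV by (auto simp: S_def in_keys_iff)
  qed
  show "N = {\<zero>\<^bsub>B\<^esub>} \<or> N = carrier B"
  proof (cases "N \<subseteq> {0}")
    case True
    then show ?thesis using N0 by (auto simp: B_simps)
  next
    case False
    then obtain v where v: "v \<in> N" "v \<noteq> 0" by blast
    then have "Poly_Mapping.keys v \<noteq> {}" by simp
    then have "S \<noteq> {}" using S v by blast
    moreover have "Poly_Mapping.keys (f g k) \<subseteq> S" if "k \<in> S" for k g
    proof -
      have "free_act f (Poly_Mapping.single k 1) (gen g) \<in> N" using that by (intro Nact) (simp add: S_def)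
      then show ?thesis using S by (auto simp del: lin_ext_scale)
    qed
    ultimately have Sn: "S = {..<n}" by (intro conn) (auto simp: S_def)
    have sumN: "(\<Sum>k\<in>F. u k) \<in> N" if "\<And>k. k \<in> F \<Longrightarrow> u k \<in> N" for F :: "nat set" and u
      using that by (induction F rule: infinite_finite_induct) (auto simp: N0 Nadd)
    have "u \<in> N" if "u \<in> V" for u
    proof -
      have "scale (Poly_Mapping.lookup u k) (Poly_Mapping.single k 1) \<in> N" if "k \<in> Poly_Mapping.keys u" for k
        using that \<open>u \<in> V\<close> Sn by (intro Nscale) (auto simp: S_def)
      then have "(\<Sum>k\<in>Poly_Mapping.keys u. Poly_Mapping.single k (Poly_Mapping.lookup u k)) \<in> N"
        by (intro sumN) simp
      then show ?thesis using poly_mapping_sum_singles[of u] by simp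
    qed
    then show ?thesis using NV by (auto simp: B_simps)
  qed
qed

end


section \<open>Weight modules\<close>

text \<open>
  The basis vector \<open>k\<close> has \<open>z\<close>-eigenvalue \<open>\<nu> k\<close>, and \<open>xh\<close> and \<open>yh\<close> send it to \<open>A k\<close> times the basis
  vector \<open>\<sigma> k\<close> and to \<open>C k\<close> times the basis vector \<open>\<tau> k\<close>.
\<close>

fun weight_gen ::
    "'k::field \<Rightarrow> 'k \<Rightarrow> 'k \<Rightarrow> (nat \<Rightarrow> nat) \<Rightarrow> (nat \<Rightarrow> nat) \<Rightarrow> (nat \<Rightarrow> 'k) \<Rightarrow> (nat \<Rightarrow> 'k) \<Rightarrow> (nat \<Rightarrow> 'k) \<Rightarrow>
      gen \<Rightarrow> nat \<Rightarrow> (nat \<Rightarrow>\<^sub>0 'k)" where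
  "weight_gen t \<beta> \<gamma> \<sigma> \<tau> A C \<nu> Gx k =
     Poly_Mapping.single (\<sigma> k) (A k / \<nu> (\<sigma> k)) + Poly_Mapping.single k (x_shift t \<beta> / \<nu> k)"
| "weight_gen t \<beta> \<gamma> \<sigma> \<tau> A C \<nu> Gy k =
     Poly_Mapping.single (\<tau> k) (C k / \<nu> (\<tau> k)) + Poly_Mapping.single k (y_shift t \<gamma> / \<nu> k)"
| "weight_gen t \<beta> \<gamma> \<sigma> \<tau> A C \<nu> Gz k = Poly_Mapping.single k (\<nu> k)"

lemma weight_arith:
  fixes t v :: "'k::field"
  assumes "t \<noteq> 0" "v \<noteq> 0"
  shows "a / v * (c / (t * v)) = t * (a * c) / (t * v) ^ 2" "a * (d / v) = t * (d / (t * v) * a)"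
    "d / v * a = t * (a * (d / (t * v)))" "t * (c / (t * v) * (a / v)) = c * a / v ^ 2"
  using assms by (simp_all add: power2_eq_square)

text \<open>A vanishing \<open>A k\<close> or \<open>C k\<close> means that there is no arrow, and
  then \<open>\<sigma> k\<close> or \<open>\<tau> k\<close> is an arbitrary index below n; hence the
  conditional form of \<open>A\<close> and \<open>C\<close>. \<open>AC\<close> is the relation
  \<open>X_Y\<close> on the basis, and \<open>conn\<close> says that the graph of arrows is strongly
  connected.\<close>

locale weight_data =
  fixes n :: nat and \<sigma> \<tau> :: "nat \<Rightarrow> nat" and A C \<nu> :: "nat \<Rightarrow> 'k::field" and q \<alpha> \<beta> \<gamma> :: 'k
  assumes q: "q \<noteq> 0" "q ^ 2 \<noteq> 1" and n: "n > 0"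
    and \<sigma>: "k < n \<Longrightarrow> \<sigma> k < n" and \<tau>: "k < n \<Longrightarrow> \<tau> k < n" and \<nu>: "k < n \<Longrightarrow> \<nu> k \<noteq> 0"
    and A: "k < n \<Longrightarrow> A k \<noteq> 0 \<Longrightarrow> \<nu> k = q ^ 2 * \<nu> (\<sigma> k)" "k < n \<Longrightarrow> A k \<noteq> 0 \<Longrightarrow> C (\<sigma> k) \<noteq> 0 \<Longrightarrow> \<tau> (\<sigma> k) = k"
    and C: "k < n \<Longrightarrow> C k \<noteq> 0 \<Longrightarrow> \<nu> (\<tau> k) = q ^ 2 * \<nu> k" "k < n \<Longrightarrow> C k \<noteq> 0 \<Longrightarrow> A (\<tau> k) \<noteq> 0 \<Longrightarrow> \<sigma> (\<tau> k) = k"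
    and AC: "k < n \<Longrightarrow> q ^ 2 * (A k * C (\<sigma> k)) = C k * A (\<tau> k) + (\<alpha> * \<nu> k ^ 2 - comm_const (q ^ 2) \<beta> \<gamma>)"
    and inj: "inj_on \<nu> {..<n}"
    and conn: "S \<subseteq> {..<n} \<Longrightarrow> S \<noteq> {} \<Longrightarrow> (\<And>k. k \<in> S \<Longrightarrow> A k \<noteq> 0 \<Longrightarrow> \<sigma> k \<in> S) \<Longrightarrow>
      (\<And>k. k \<in> S \<Longrightarrow> C k \<noteq> 0 \<Longrightarrow> \<tau> k \<in> S) \<Longrightarrow> S = {..<n}"
begin

abbreviation "t \<equiv> q ^ 2"
abbreviation "f \<equiv> weight_gen t \<beta> \<gamma> \<sigma> \<tau> A C \<nu>"
abbreviation "b \<equiv> x_shift t \<beta>"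
abbreviation "d \<equiv> y_shift t \<gamma>"

lemma t: "t \<noteq> 0" "t \<noteq> 1"
  using q by simp_all

lemma powi: "q powi 2 = t" "q powi (-2) = inverse t"
  by (simp_all add: power_int_def power_inverse)

lemma weight_closed: "k < n \<Longrightarrow> Poly_Mapping.keys (f g k) \<subseteq> {..<n}"
  using \<sigma>[of k] \<tau>[of k]
  by (cases g) (auto split: if_splits dest!: subsetD[OF keys_add])

text \<open>The terms at \<open>\<sigma> k\<close> and at \<open>\<tau> k\<close> agree on both
  sides because each arrow changes the eigenvalue of z by a factor t or its inverse; the terms at
  \<open>k\<close> are assumption \<open>AC\<close> divided by \<open>\<nu> k ^ 2\<close>, with the
  product of the diagonal terms accounting for \<open>comm_const\<close>.\<close>

lemma relation_xy:
  assumes k: "k < n"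
  shows "lin_ext (f Gy) (f Gx k) = scale t (lin_ext (f Gx) (f Gy k)) + Poly_Mapping.single k \<alpha>"
proof -
  let ?a = "A k / \<nu> (\<sigma> k)" and ?c = "C k / \<nu> (\<tau> k)"
  have 1: "Poly_Mapping.single (\<tau> (\<sigma> k)) (?a * (C (\<sigma> k) / \<nu> (\<tau> (\<sigma> k)))) =
      Poly_Mapping.single k (t * (A k * C (\<sigma> k)) / \<nu> k ^ 2)"
  proof (cases "A k = 0 \<or> C (\<sigma> k) = 0")
    case False
    then have "\<tau> (\<sigma> k) = k" "\<nu> k = t * \<nu> (\<sigma> k)" using A[OF k] by auto
    then show ?thesis
      using weight_arith(1)[OF t(1) \<nu>[OF \<sigma>[OF k]], of "A k" "C (\<sigma> k)"] by (simp only:)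
  qed auto
  have 2: "Poly_Mapping.single (\<sigma> k) (?a * (d / \<nu> (\<sigma> k))) = Poly_Mapping.single (\<sigma> k) (t * (d / \<nu> k * ?a))"
  proof (cases "A k = 0")
    case False
    then show ?thesis
      using weight_arith(2)[OF t(1) \<nu>[OF \<sigma>[OF k]], of ?a d] by (simp only: A(1)[OF k False])
  qed simp
  have 3: "Poly_Mapping.single (\<tau> k) (b / \<nu> k * ?c) = Poly_Mapping.single (\<tau> k) (t * (?c * (b / \<nu> (\<tau> k))))"
  proof (cases "C k = 0")
    case False
    then show ?thesis
      using weight_arith(3)[OF t(1) \<nu>[OF k], of b ?c] by (simp only: C(1)[OF k False])
  qed simp
  have 4: "Poly_Mapping.single (\<sigma> (\<tau> k)) (t * (?c * (A (\<tau> k) / \<nu> (\<sigma> (\<tau> k))))) =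
      Poly_Mapping.single k (C k * A (\<tau> k) / \<nu> k ^ 2)"
  proof (cases "C k = 0 \<or> A (\<tau> k) = 0")
    case False
    then have "\<sigma> (\<tau> k) = k" "\<nu> (\<tau> k) = t * \<nu> k" using C[OF k] by auto
    then show ?thesis
      using weight_arith(4)[OF t(1) \<nu>[OF k], of "C k" "A (\<tau> k)"] by (simp only:)
  qed auto
  have "t * (A k * C (\<sigma> k)) + d * b = C k * A (\<tau> k) + t * (d * b) + \<alpha> * \<nu> k ^ 2"
    using AC[OF k] shift_eqs(3)[OF t, of \<beta> \<gamma>] by (simp add: algebra_simps)
  then have "(t * (A k * C (\<sigma> k)) + d * b) / \<nu> k ^ 2 = (C k * A (\<tau> k) + t * (d * b) + \<alpha> * \<nu> k ^ 2) / \<nu> k ^ 2"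
    by simp
  then have 5: "t * (A k * C (\<sigma> k)) / \<nu> k ^ 2 + b / \<nu> k * (d / \<nu> k) =
      C k * A (\<tau> k) / \<nu> k ^ 2 + t * (d / \<nu> k * (b / \<nu> k)) + \<alpha>"
    using \<nu>[OF k] by (simp add: add_divide_distrib power2_eq_square mult.commute)
  have "lin_ext (f Gy) (f Gx k) =
      Poly_Mapping.single (\<tau> (\<sigma> k)) (?a * (C (\<sigma> k) / \<nu> (\<tau> (\<sigma> k)))) + Poly_Mapping.single (\<sigma> k) (?a * (d / \<nu> (\<sigma> k)))
      + Poly_Mapping.single (\<tau> k) (b / \<nu> k * ?c) + Poly_Mapping.single k (b / \<nu> k * (d / \<nu> k))"
    by (simp add: add.assoc)
  also have "\<dots> = Poly_Mapping.single k (t * (A k * C (\<sigma> k)) / \<nu> k ^ 2 + b / \<nu> k * (d / \<nu> k))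
      + Poly_Mapping.single (\<sigma> k) (t * (d / \<nu> k * ?a)) + Poly_Mapping.single (\<tau> k) (t * (?c * (b / \<nu> (\<tau> k))))"
    unfolding 1 2 3 by (simp add: single_add add.assoc add.left_commute add.commute)
  also have "\<dots> = Poly_Mapping.single (\<sigma> (\<tau> k)) (t * (?c * (A (\<tau> k) / \<nu> (\<sigma> (\<tau> k)))))
      + Poly_Mapping.single (\<tau> k) (t * (?c * (b / \<nu> (\<tau> k)))) + Poly_Mapping.single (\<sigma> k) (t * (d / \<nu> k * ?a))
      + Poly_Mapping.single k (t * (d / \<nu> k * (b / \<nu> k))) + Poly_Mapping.single k \<alpha>"
    unfolding 4 5 by (simp only: single_add add.assoc add.left_commute add.commute)
  also have "\<dots> = scale t (lin_ext (f Gx) (f Gy k)) + Poly_Mapping.single k \<alpha>"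
    by (simp add: add.assoc)
  finally show ?thesis .
qed

lemma relation_xz:
  assumes k: "k < n"
  shows "lin_ext (f Gz) (f Gx k) = scale (inverse t) (lin_ext (f Gx) (f Gz k)) + Poly_Mapping.single k \<beta>"
proof -
  have 1: "Poly_Mapping.single (\<sigma> k) (A k / \<nu> (\<sigma> k) * \<nu> (\<sigma> k)) =
      Poly_Mapping.single (\<sigma> k) (inverse t * (\<nu> k * (A k / \<nu> (\<sigma> k))))"
    using A[OF k] \<nu>[OF \<sigma>[OF k]] t by (cases "A k = 0") (simp_all add: field_simps)
  have 2: "b / \<nu> k * \<nu> k = inverse t * (\<nu> k * (b / \<nu> k)) + \<beta>"
    using shift_eqs(1)[OF t, of \<beta>] \<nu>[OF k] by (simp add: algebra_simps)
  have "lin_ext (f Gz) (f Gx k) =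
      Poly_Mapping.single (\<sigma> k) (A k / \<nu> (\<sigma> k) * \<nu> (\<sigma> k)) + Poly_Mapping.single k (b / \<nu> k * \<nu> k)"
    by (simp only: weight_gen.simps lin_ext_add lin_ext_single scale_simps)
  also have "\<dots> = scale (inverse t) (lin_ext (f Gx) (f Gz k)) + Poly_Mapping.single k \<beta>"
    unfolding 1 2 by (simp only: weight_gen.simps lin_ext_add lin_ext_single scale_simps single_add add.assoc mult.assoc)
  finally show ?thesis .
qed

lemma relation_yz:
  assumes k: "k < n"
  shows "lin_ext (f Gz) (f Gy k) = scale t (lin_ext (f Gy) (f Gz k)) + Poly_Mapping.single k \<gamma>"
proof -
  have 1: "Poly_Mapping.single (\<tau> k) (C k / \<nu> (\<tau> k) * \<nu> (\<tau> k)) =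
      Poly_Mapping.single (\<tau> k) (t * (\<nu> k * (C k / \<nu> (\<tau> k))))"
    using C[OF k] \<nu>[OF k] t by (cases "C k = 0") (simp_all add: field_simps)
  have 2: "d / \<nu> k * \<nu> k = t * (\<nu> k * (d / \<nu> k)) + \<gamma>"
    using shift_eqs(2)[OF t, of \<gamma>] \<nu>[OF k] by (simp add: algebra_simps)
  have "lin_ext (f Gz) (f Gy k) =
      Poly_Mapping.single (\<tau> k) (C k / \<nu> (\<tau> k) * \<nu> (\<tau> k)) + Poly_Mapping.single k (d / \<nu> k * \<nu> k)"
    by (simp only: weight_gen.simps lin_ext_add lin_ext_single scale_simps)
  also have "\<dots> = scale t (lin_ext (f Gy) (f Gz k)) + Poly_Mapping.single k \<gamma>"
    unfolding 1 2 by (simp only: weight_gen.simps lin_ext_add lin_ext_single scale_simps single_add add.assoc mult.assoc)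
  finally show ?thesis .
qed

sublocale based_rep n f q \<alpha> \<beta> \<gamma>
proof
  fix k r assume k: "k < n" and r: "r \<in> relators q \<alpha> \<beta> \<gamma>"
  have s: "scale 1 v = v" for v :: "nat \<Rightarrow>\<^sub>0 'k" by simp
  from r consider "r = gen Gx * gen Gy - (const (q powi 2) * gen Gy * gen Gx + const \<alpha>)"
    | "r = gen Gx * gen Gz - (const (q powi (-2)) * gen Gz * gen Gx + const \<beta>)"
    | "r = gen Gy * gen Gz - (const (q powi 2) * gen Gz * gen Gy + const \<gamma>)"
    unfolding relators_def by blast
  then show "free_act f (Poly_Mapping.single k 1) r = 0"
  proof cases
    case 1
    show ?thesis
      unfolding 1 powi free_act_diff_right free_act_add_right free_act_mult free_act_gen free_act_const
        lin_ext_scale lin_ext_single s relation_xy[OF k] by simp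
  next
    case 2
    show ?thesis
      unfolding 2 powi free_act_diff_right free_act_add_right free_act_mult free_act_gen free_act_const
        lin_ext_scale lin_ext_single s relation_xz[OF k] by simp
  next
    case 3
    show ?thesis
      unfolding 3 powi free_act_diff_right free_act_add_right free_act_mult free_act_gen free_act_const
        lin_ext_scale lin_ext_single s relation_yz[OF k] by simp
  qed
qed (rule weight_closed)

text \<open>The eigenvalue changes along an arrow, since t is not 1. So the arrow and the diagonal
  term of \<open>weight_gen\<close> have different targets and cannot cancel.\<close>

lemma shift_neq:
  assumes k: "k < n"
  shows "A k \<noteq> 0 \<Longrightarrow> \<sigma> k \<noteq> k" and "C k \<noteq> 0 \<Longrightarrow> \<tau> k \<noteq> k"
  using A(1)[OF k] C(1)[OF k] \<nu>[OF k] t(2) by auto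

lemma simple_weight_module: "simple_right_module (A_alg q \<alpha> \<beta> \<gamma>) (based_module n f)"
proof (rule simple_based_module[OF n _ inj])
  fix S assume S: "S \<subseteq> {..<n}" "S \<noteq> {}" and cl: "\<And>k g. k \<in> S \<Longrightarrow> Poly_Mapping.keys (f g k) \<subseteq> S"
  show "S = {..<n}"
  proof (rule conn[OF S])
    fix k assume k: "k \<in> S" and A: "A k \<noteq> 0"
    then have kn: "k < n" using S by auto
    have "Poly_Mapping.lookup (f Gx k) (\<sigma> k) \<noteq> 0"
      using A shift_neq(1)[OF kn A] \<nu>[OF \<sigma>[OF kn]] by (simp add: lookup_add lookup_single when_def)
    then show "\<sigma> k \<in> S" using cl[OF k, of Gx] by (auto simp only: in_keys_iff)
  next
    fix k assume k: "k \<in> S" and C: "C k \<noteq> 0"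
    then have kn: "k < n" using S by auto
    have "Poly_Mapping.lookup (f Gy k) (\<tau> k) \<noteq> 0"
      using C shift_neq(2)[OF kn C] \<nu>[OF \<tau>[OF kn]] by (simp add: lookup_add lookup_single when_def)
    then show "\<tau> k \<in> S" using cl[OF k, of Gy] by (auto simp only: in_keys_iff)
  qed
qed simp

end

text \<open>Sending the basis vector k to the coset of \<open>V k\<close> commutes with the action,
  so whatever kills basis vector 0 kills the vector that \<open>V 0\<close> makes of m. With both
  modules simple this is enough; independence of the chain vectors is a consequence.\<close>

lemma isomorphic_if_chain:
  fixes q \<alpha> \<beta> \<gamma> :: "'k::alg_closed_field" and M :: "('k free_alg set, 'm) right_module"
    and V :: "nat \<Rightarrow> 'k free_alg" and m :: 'm
  defines "I \<equiv> {p. m \<triangleleft>\<^bsub>M\<^esub> A_class q \<alpha> \<beta> \<gamma> p = \<zero>\<^bsub>M\<^esub>}"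
  assumes S: "simple_right_module (A_alg q \<alpha> \<beta> \<gamma>) M" and m: "m \<in> carrier M"
    and W: "weyl_quotient I const (gen Gx) (gen Gy) (gen Gz) (q ^ 2) \<alpha> \<beta> \<gamma> l"
    and D: "weight_data n \<sigma> \<tau> A C \<nu> q \<alpha> \<beta> \<gamma>"
    and V0: "V 0 \<notin> I"
    and z: "\<And>k. k < n \<Longrightarrow> V k * gen Gz - const (\<nu> k) * V k \<in> I"
    and x: "\<And>k. k < n \<Longrightarrow> V k * (gen Gx * gen Gz - const (x_shift (q ^ 2) \<beta>)) - const (A k) * V (\<sigma> k) \<in> I"
    and y: "\<And>k. k < n \<Longrightarrow> V k * (gen Gy * gen Gz - const (y_shift (q ^ 2) \<gamma>)) - const (C k) * V (\<tau> k) \<in> I"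
  shows "isomorphic_right_modules (A_alg q \<alpha> \<beta> \<gamma>) M (based_module n (weight_gen (q ^ 2) \<beta> \<gamma> \<sigma> \<tau> A C \<nu>))"
proof -
  interpret M: A_module q \<alpha> \<beta> \<gamma> M by (rule A_moduleI[OF S])
  interpret D: weight_data n \<sigma> \<tau> A C \<nu> q \<alpha> \<beta> \<gamma> by (rule D)
  interpret W: weyl_quotient I const "gen Gx" "gen Gy" "gen Gz" "q ^ 2" \<alpha> \<beta> \<gamma> l by (rule W)
  let ?f = "weight_gen (q ^ 2) \<beta> \<gamma> \<sigma> \<tau> A C \<nu>"
  have const: "const c * p = W.smul c p" for c and p :: "'k free_alg" by (simp add: W.smul_def)
  define H where "H u = (\<Sum>j\<in>Poly_Mapping.keys u. W.smul (Poly_Mapping.lookup u j) (V j))" for u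
  have H_add: "H (u + v) = H u + H v" for u v
    unfolding H_def by (rule lincomb_add) (simp_all add: W.smul_distrib)
  have H_single: "H (Poly_Mapping.single k c) = W.smul c (V k)" for k c
    by (cases "c = 0") (simp_all add: H_def)
  have H_scale: "H (scale c u) = W.smul c (H u)" for c u
    by (induction u rule: poly_mapping_add_induct) (simp_all add: H_add H_single W.smul_distrib)
  have H_sum: "H (\<Sum>k\<in>F. u k) = (\<Sum>k\<in>F. H (u k))" for F :: "nat set" and u
    by (induction F rule: infinite_finite_induct) (simp_all add: H_add, simp_all add: H_def)
  have eig: "W.zeig (\<nu> k) (V k)" if "k < n" for k
    using z[OF that] by (simp add: W.zeig_def W.eqI_def const)
  have gen: "W.eqI (V k * gen g) (H (?f g k))" if k: "k < n" for k g
  proof (cases g)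
    case Gx
    have "A k / \<nu> (\<sigma> k) * \<nu> (\<sigma> k) = A k" using D.\<nu>[OF D.\<sigma>[OF k]] by simp
    then have "W.eqI (V k * (gen Gx * gen Gz - W.smul W.bx 1)) (W.smul (A k / \<nu> (\<sigma> k) * \<nu> (\<sigma> k)) (V (\<sigma> k)))"
      using x[OF k] by (simp only: W.eqI_def W.smul_def mult_1_right)
    from W.act_from_shift[OF eig[OF k] D.\<nu>[OF k] eig[OF D.\<sigma>[OF k]] D.\<nu>[OF D.\<sigma>[OF k]] this]
    show ?thesis by (simp add: Gx H_add H_single)
  next
    case Gy
    have "C k / \<nu> (\<tau> k) * \<nu> (\<tau> k) = C k" using D.\<nu>[OF D.\<tau>[OF k]] by simp
    then have "W.eqI (V k * (gen Gy * gen Gz - W.smul W.dy 1)) (W.smul (C k / \<nu> (\<tau> k) * \<nu> (\<tau> k)) (V (\<tau> k)))"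
      using y[OF k] by (simp only: W.eqI_def W.smul_def mult_1_right)
    from W.act_from_shift[OF eig[OF k] D.\<nu>[OF k] eig[OF D.\<tau>[OF k]] D.\<nu>[OF D.\<tau>[OF k]] this]
    show ?thesis by (simp add: Gy H_add H_single)
  next
    case Gz
    then show ?thesis using eig[OF k] by (simp add: W.zeig_def H_single)
  qed
  have step: "W.eqI (H u * gen g) (H (lin_ext (?f g) u))" if u: "u \<in> D.V" for u g
  proof -
    have "H u * gen g = (\<Sum>k\<in>Poly_Mapping.keys u. W.smul (Poly_Mapping.lookup u k) (V k * gen g))"
      by (simp add: H_def sum_distrib_right)
    also have "W.eqI \<dots> (\<Sum>k\<in>Poly_Mapping.keys u. W.smul (Poly_Mapping.lookup u k) (H (?f g k)))"
      using u by (intro W.eqI_sum W.eqI_smul gen) auto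
    also have "\<dots> = H (lin_ext (?f g) u)" by (simp add: lin_ext_def H_sum H_scale)
    finally show ?thesis .
  qed
  have hom: "W.eqI (H u * p) (H (free_act ?f u p))" if u: "u \<in> D.V" for u p
  proof -
    have "p \<in> {p. W.eqI (H u * p) (H (free_act ?f u p))}"
    proof (rule free_alg_generation)
      fix c show "const c \<in> {p. W.eqI (H u * p) (H (free_act ?f u p))}"
        using W.\<kappa>_comm[of "H u" c] by (simp add: H_scale const)
    next
      fix p r assume "p \<in> {p. W.eqI (H u * p) (H (free_act ?f u p))}" "r \<in> {p. W.eqI (H u * p) (H (free_act ?f u p))}"
      then show "p + r \<in> {p. W.eqI (H u * p) (H (free_act ?f u p))}"
        by (simp add: distrib_left H_add W.eqI_add)
    next
      fix p g assume "p \<in> {p. W.eqI (H u * p) (H (free_act ?f u p))}"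
      then have "W.eqI (H u * p * gen g) (H (free_act ?f u p) * gen g)" by (intro W.eqI_mult) simp
      also have "W.eqI \<dots> (H (lin_ext (?f g) (free_act ?f u p)))" by (rule step[OF D.free_act_closed[OF u]])
      finally show "p * gen g \<in> {p. W.eqI (H u * p) (H (free_act ?f u p))}"
        by (simp add: free_act_mult mult.assoc)
    qed
    then show ?thesis by simp
  qed
  let ?e = "Poly_Mapping.single (0::nat) (1::'k)"
  have e: "?e \<in> D.V" using D.n by auto
  have m': "M.act m (V 0) \<in> carrier M" "M.act m (V 0) \<noteq> \<zero>\<^bsub>M\<^esub>"
    using M.act_closed[OF m] V0 by (simp_all add: I_def M.act_def)
  show ?thesis
  proof (rule simple_modules_isomorphic[OF S D.simple_weight_module m'])
    show "?e \<in> carrier D.B" using e by (simp only: D.B_simps)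
    fix p assume "?e \<triangleleft>\<^bsub>D.B\<^esub> A_class q \<alpha> \<beta> \<gamma> p = \<zero>\<^bsub>D.B\<^esub>"
    then have "free_act ?f ?e p = 0" using D.ract_A_class[OF e, of p] by (simp only: D.B_simps)
    then have "W.eqI (H ?e * p) (H 0)" using hom[OF e, of p] by (simp only:)
    then have "V 0 * p \<in> I" by (simp add: H_single W.eqI_0_iff) (simp add: H_def W.eqI_0_iff)
    then have "M.act m (V 0 * p) = \<zero>\<^bsub>M\<^esub>" by (simp add: I_def M.act_def)
    then have "M.act (M.act m (V 0)) p = \<zero>\<^bsub>M\<^esub>" using m by (simp add: M.act_mult)
    then show "M.act m (V 0) \<triangleleft>\<^bsub>M\<^esub> A_class q \<alpha> \<beta> \<gamma> p = \<zero>\<^bsub>M\<^esub>" by (simp only: M.act_def)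
  qed
qed


section \<open>The three families\<close>

lemma powi_conv:
  fixes q :: "'k::field"
  assumes q: "q \<noteq> 0"
  shows "q powi 2 = q ^ 2" "q powi (-2) = inverse (q ^ 2)" "q powi (2 * int k) = (q ^ 2) ^ k"
    "q powi (-2 * int k) = inverse (q ^ 2) ^ k"
    "q powi (-2 * (int k - 1)) = q ^ 2 * inverse (q ^ 2) ^ k"
    "q powi (-2 * (int k + 1)) = inverse (q ^ 2) * inverse (q ^ 2) ^ k"
    "q powi (2 * (int k + 1)) = q ^ 2 * (q ^ 2) ^ k"
    "q powi (2 * int k - 2) = (q ^ 2) ^ k / q ^ 2"
    "q powi (2 * (int k - 1)) = (q ^ 2) ^ k / q ^ 2"
    "q powi (2 * int k + 2) = q ^ 2 * (q ^ 2) ^ k"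
proof -
  show 2: "q powi 2 = q ^ 2" by (simp add: power_int_def)
  show m2: "q powi (-2) = inverse (q ^ 2)" by (simp add: power_int_def power_inverse)
  have "q powi (int (2 * k)) = q ^ (2 * k)" by (rule power_int_of_nat)
  then show p: "q powi (2 * int k) = (q ^ 2) ^ k" by (simp add: power_mult)
  have "q powi (- (2 * int k)) = inverse (q powi (2 * int k))" by (rule power_int_minus)
  then show m: "q powi (-2 * int k) = inverse (q ^ 2) ^ k" by (simp add: p power_inverse)
  have a: "q powi (i + j) = q powi i * q powi j" for i j using q by (rule power_int_add[OF disjI1])
  show "q powi (-2 * (int k - 1)) = q ^ 2 * inverse (q ^ 2) ^ k"
    using a[of 2 "-2 * int k"] unfolding 2 m by (simp add: algebra_simps)
  show "q powi (-2 * (int k + 1)) = inverse (q ^ 2) * inverse (q ^ 2) ^ k"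
    using a[of "-2" "-2 * int k"] unfolding m2 m by (simp add: algebra_simps)
  show "q powi (2 * (int k + 1)) = q ^ 2 * (q ^ 2) ^ k"
    using a[of 2 "2 * int k"] unfolding 2 p by (simp add: algebra_simps)
  show "q powi (2 * int k - 2) = (q ^ 2) ^ k / q ^ 2"
    using a[of "2 * int k" "-2"] unfolding m2 p by (simp add: divide_inverse)
  then show "q powi (2 * (int k - 1)) = (q ^ 2) ^ k / q ^ 2" by (simp add: algebra_simps)
  show "q powi (2 * int k + 2) = q ^ 2 * (q ^ 2) ^ k"
    using a[of "2 * int k" 2] unfolding 2 p by (simp add: mult.commute)
qed

lemma cyclic_set:
  assumes S: "S \<subseteq> {..<l}" "S \<noteq> {}" and step: "\<And>k. k \<in> S \<Longrightarrow> (k + 1) mod l \<in> S"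
  shows "S = {..<l::nat}"
proof -
  obtain k where k: "k \<in> S" using S by blast
  have *: "(k + i) mod l \<in> S" for i
  proof (induction i)
    case 0
    then show ?case using k S by auto
  next
    case (Suc i)
    then show ?case using step[OF Suc.IH] by (simp add: mod_Suc_eq)
  qed
  \<comment> \<open>The number of steps from k to j is \<open>j + l - k\<close>; adding l keeps the
    subtraction exact.\<close>
  have "j \<in> S" if "j < l" for j
    using *[of "j + l - k"] that k S by auto
  then show ?thesis using S by blast
qed

text \<open>The explicit modules are treated over an arbitrary field, apart from any quotient by
  \<open>I\<close>; algebraic closure belongs to the construction of the chains.\<close>

locale root_data =
  fixes q \<alpha> \<beta> \<gamma> :: "'k::field" and l :: nat
  assumes q: "q \<noteq> 0" and l: "l > 1" and root: "primitive_root_of_unity l (q ^ 2)"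
begin

abbreviation "t \<equiv> q ^ 2"
abbreviation "c0 \<equiv> comm_const t \<beta> \<gamma>"
abbreviation "g \<equiv> g_seq t \<alpha> c0"
abbreviation "f \<equiv> f_seq t \<alpha> c0"

lemma t_root: "t ^ l = 1" "0 < j \<Longrightarrow> j < l \<Longrightarrow> t ^ j \<noteq> 1"
  using root by (auto simp: primitive_root_of_unity_def)

lemma t_neq: "t \<noteq> 0" "t \<noteq> 1"
  using q t_root(2)[of 1] l by auto

lemma t_power_mod: "t ^ (k mod l) = t ^ k"
proof -
  have "t ^ k = t ^ (l * (k div l) + k mod l)" by simp
  also have "\<dots> = t ^ (k mod l)" by (simp only: power_add power_mult t_root(1) power_one mult_1_left)
  finally show ?thesis by simp
qed

lemma t_power_pred: "t ^ (k + l - 1) = t ^ k / t"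
proof -
  have "t * t ^ (k + l - 1) = t ^ k * t ^ l"
    using l by (simp flip: power_Suc power_add)
  then show ?thesis using t_neq(1) t_root(1) by (simp add: field_simps)
qed

lemma inj_t_power: "inj_on (\<lambda>k. t ^ k) {..<l}"
proof -
  have "False" if "i < j" "j < l" "t ^ i = t ^ j" for i j
  proof -
    have "t ^ j = t ^ i * t ^ (j - i)"
      using that(1) by (metis le_add_diff_inverse less_imp_le power_add)
    then have "t ^ (j - i) = 1" using that(3) t_neq(1) by simp
    moreover have "0 < j - i" "j - i < l" using that by linarith+
    ultimately show False using t_root(2) by blast
  qed
  then show ?thesis by (intro inj_onI) (metis lessThan_iff linorder_neqE_nat)
qed

lemma inj_inverse_t_power: "inj_on (\<lambda>k. inverse t ^ k) {..<l}"
  using inj_t_power by (auto simp: inj_on_def power_inverse)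

lemma f_root: "f \<theta> l = 0"
  using t_root by (simp add: f_seq_def power_inverse)

abbreviation "weight1 \<mu>1 \<mu>2 \<mu>3 \<equiv>
  weight_gen t \<beta> \<gamma> (\<lambda>k. (k + l - 1) mod l) (\<lambda>k. (k + 1) mod l)
    (\<lambda>k. inverse \<mu>1 * g \<mu>2 \<mu>3 k) (\<lambda>_. \<mu>1) (\<lambda>k. t ^ k * \<mu>2)"

abbreviation "weight2 \<mu>1 \<mu>2 \<equiv>
  weight_gen t \<beta> \<gamma> (\<lambda>k. (k + 1) mod l) (\<lambda>k. k - 1)
    (\<lambda>_. \<mu>1) (\<lambda>k. inverse \<mu>1 * f \<mu>2 k) (\<lambda>k. inverse t ^ k * \<mu>2)"

text \<open>With \<open>inverse 1\<close> kept, the third family is the second one for \<open>\<mu>1 = 1\<close>, cut off at \<open>s\<close>.\<close>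

abbreviation "weight3 s \<mu> \<equiv>
  weight_gen t \<beta> \<gamma> (\<lambda>k. if k = s - 1 then 0 else k + 1) (\<lambda>k. k - 1)
    (\<lambda>k. if k = s - 1 then 0 else 1) (\<lambda>k. inverse 1 * f \<mu> k) (\<lambda>k. inverse t ^ k * \<mu>)"

lemma M1_gen_eq:
  assumes \<mu>: "\<mu>1 \<noteq> 0" "\<mu>2 \<noteq> 0"
  shows "M1_gen q l \<alpha> \<beta> \<gamma> \<mu>1 \<mu>2 \<mu>3 =
    weight1 \<mu>1 \<mu>2 \<mu>3"
proof (intro ext)
  fix h k
  have tk: "t ^ k \<noteq> 0" and t0: "t \<noteq> 0" using t_neq(1) by simp_all
  have inv: "inverse t ^ k = inverse (t ^ k)" by (simp only: power_inverse)
  show "M1_gen q l \<alpha> \<beta> \<gamma> \<mu>1 \<mu>2 \<mu>3 h k =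
    weight1 \<mu>1 \<mu>2 \<mu>3 h k"
  proof (cases h)
    case Gx
    have 1: "inverse \<mu>1 * inverse \<mu>2 * (t * inverse t ^ k) *
        (t ^ k * \<mu>3 - (t ^ k - 1) / (t - 1) * (t ^ k / t * \<alpha> * \<mu>2 ^ 2 - \<beta> * \<gamma> * t / (t - 1))) =
        inverse \<mu>1 * g \<mu>2 \<mu>3 k / (t ^ ((k + l - 1) mod l) * \<mu>2)"
      unfolding t_power_mod t_power_pred inv g_seq_def comm_const_def
      using tk t0 \<mu> by (simp add: divide_inverse ac_simps)
    have 2: "inverse \<mu>2 * \<beta> * t / (t - 1) * inverse t ^ k = x_shift t \<beta> / (t ^ k * \<mu>2)"
      unfolding x_shift_def inv by (simp add: divide_inverse ac_simps)
    show ?thesis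
      unfolding Gx M1_gen.simps powi_conv[OF q] weight_gen.simps 1 2 ..
  next
    case Gy
    have 1: "\<mu>1 * inverse \<mu>2 * (inverse t * inverse t ^ k) = \<mu>1 / (t ^ ((k + 1) mod l) * \<mu>2)"
      unfolding t_power_mod inv by (simp add: divide_inverse ac_simps)
    have 2: "Poly_Mapping.single k (y_shift t \<gamma> / (t ^ k * \<mu>2)) =
        - Poly_Mapping.single k (inverse \<mu>2 * \<gamma> / (t - 1) * inverse t ^ k)"
      unfolding y_shift_def inv single_uminus[symmetric] by (simp add: divide_inverse ac_simps)
    show ?thesis
      unfolding Gy M1_gen.simps powi_conv[OF q] weight_gen.simps 1 2 by simp
  next
    case Gz
    show ?thesis
      unfolding Gz M1_gen.simps powi_conv[OF q] weight_gen.simps ..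
  qed
qed

lemma M1_weight_data:
  assumes \<mu>: "\<mu>1 \<noteq> 0" "\<mu>2 \<noteq> 0"
  shows "weight_data l (\<lambda>k. (k + l - 1) mod l) (\<lambda>k. (k + 1) mod l)
      (\<lambda>k. inverse \<mu>1 * g \<mu>2 \<mu>3 k) (\<lambda>_. \<mu>1) (\<lambda>k. t ^ k * \<mu>2) q \<alpha> \<beta> \<gamma>"
proof
  show "q \<noteq> 0" "q ^ 2 \<noteq> 1" "l > 0" using q t_neq l by auto
  fix k assume k: "k < l"
  have \<sigma>\<tau>: "((k + l - 1) mod l + 1) mod l = k" "((k + 1) mod l + l - 1) mod l = k"
  proof -
    show "((k + l - 1) mod l + 1) mod l = k" using k by (simp add: mod_Suc_eq)
    have "((k + 1) mod l + l - 1) mod l = ((k + 1) mod l + (l - 1)) mod l" using l by simp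
    also have "\<dots> = (k + 1 + (l - 1)) mod l" by (rule mod_add_left_eq)
    finally show "((k + 1) mod l + l - 1) mod l = k" using k l by simp
  qed
  show "(k + l - 1) mod l < l" "(k + 1) mod l < l" using l by auto
  show "t ^ k * \<mu>2 \<noteq> 0" using t_neq \<mu> by simp
  show "t ^ k * \<mu>2 = t * (t ^ ((k + l - 1) mod l) * \<mu>2)"
    unfolding t_power_mod t_power_pred using t_neq(1) by simp
  show "t ^ ((k + 1) mod l) * \<mu>2 = t * (t ^ k * \<mu>2)" unfolding t_power_mod by simp
  show "((k + l - 1) mod l + 1) mod l = k" "((k + 1) mod l + l - 1) mod l = k" by (fact \<sigma>\<tau>)+
  \<comment> \<open>\<open>g\<close> depends on its index only through a power of t, so the
    recursion also holds across the wrap from l - 1 to 0.\<close>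
  have g_mod: "g \<mu>2 \<mu>3 (i mod l) = g \<mu>2 \<mu>3 i" for i by (simp only: g_seq_def t_power_mod)
  show "t * (inverse \<mu>1 * g \<mu>2 \<mu>3 k * \<mu>1) =
      \<mu>1 * (inverse \<mu>1 * g \<mu>2 \<mu>3 ((k + 1) mod l)) + (\<alpha> * (t ^ k * \<mu>2) ^ 2 - c0)"
    unfolding g_mod Suc_eq_plus1[symmetric] g_seq_simps(2)[OF t_neq] inverse_conj[OF \<mu>(1)]
      mult.assoc[symmetric] right_inverse[OF \<mu>(1)] mult_1_left diff_add_cancel ..
next
  show "inj_on (\<lambda>k. t ^ k * \<mu>2) {..<l}" using inj_t_power \<mu> by (auto simp: inj_on_def)
next
  fix S assume "S \<subseteq> {..<l}" "S \<noteq> {}" "\<And>k. k \<in> S \<Longrightarrow> \<mu>1 \<noteq> 0 \<Longrightarrow> (k + 1) mod l \<in> S"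
  then show "S = {..<l}" using \<mu> by (intro cyclic_set) auto
qed

text \<open>M2 and M3 have the same y, with \<mu>1 = 1 in M3. The case distinction at k = 0
  disappears because \<open>f\<close> vanishes there. The maps \<sigma> and \<open>A\<close> are
  free, as they concern x.\<close>

lemma lower_gen_eq:
  assumes \<mu>: "\<mu>1 \<noteq> 0" "\<mu> \<noteq> 0"
  shows "(if k = 0 then - Poly_Mapping.single 0 (\<gamma> * inverse \<mu> / (q powi 2 - 1))
      else
        Poly_Mapping.single (k - 1)
          (inverse \<mu>1 * inverse \<mu> * q powi (2 * (int k - 1)) *
            ((1 - q powi (-2 * int k)) / (1 - q powi (-2))) *
            (\<alpha> * \<mu> ^ 2 * q powi (-2 * int k) - \<beta> * \<gamma> / (q powi 2 - 1))) -
        Poly_Mapping.single k (\<gamma> * inverse \<mu> / (q powi 2 - 1) * q powi (2 * int k))) =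
    weight_gen t \<beta> \<gamma> \<sigma> (\<lambda>k. k - 1) A (\<lambda>k. inverse \<mu>1 * f \<mu> k) (\<lambda>k. inverse t ^ k * \<mu>) Gy k"
proof -
  have inv: "inverse t ^ k = inverse (t ^ k)" for k by (simp only: power_inverse)
  have 2: "Poly_Mapping.single k (y_shift t \<gamma> / (inverse t ^ k * \<mu>)) =
        - Poly_Mapping.single k (\<gamma> * inverse \<mu> / (t - 1) * t ^ k)"
    unfolding y_shift_def inv single_uminus[symmetric] by (simp add: divide_inverse ac_simps)
  show ?thesis
  proof (cases k)
    case 0
    then show ?thesis using 2 unfolding powi_conv[OF q] by (simp add: f_seq_simps[OF t_neq])
  next
    case (Suc j)
    have "inverse t ^ (k - 1) = t / t ^ k" unfolding inv Suc using t_neq(1) by (simp add: field_simps)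
    then have 1: "inverse \<mu>1 * inverse \<mu> * (t ^ k / t) * ((1 - inverse t ^ k) / (1 - inverse t)) *
        (\<alpha> * \<mu> ^ 2 * inverse t ^ k - \<beta> * \<gamma> / (t - 1)) = inverse \<mu>1 * f \<mu> k / (inverse t ^ (k - 1) * \<mu>)"
      unfolding f_seq_def comm_const_def using t_neq(1) by (simp add: divide_inverse ac_simps)
    show ?thesis unfolding powi_conv[OF q] weight_gen.simps 1 2 using Suc by simp
  qed
qed

lemma M2_gen_eq:
  assumes \<mu>: "\<mu>1 \<noteq> 0" "\<mu>2 \<noteq> 0"
  shows "M2_gen q l \<alpha> \<beta> \<gamma> \<mu>1 \<mu>2 =
    weight2 \<mu>1 \<mu>2"
proof (intro ext)
  fix h k
  have inv: "inverse t ^ k = inverse (t ^ k)" for k by (simp only: power_inverse)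
  show "M2_gen q l \<alpha> \<beta> \<gamma> \<mu>1 \<mu>2 h k =
    weight2 \<mu>1 \<mu>2 h k"
  proof (cases h)
    case Gx
    have 1: "\<mu>1 * inverse \<mu>2 * (t * t ^ k) = \<mu>1 / (inverse t ^ ((k + 1) mod l) * \<mu>2)"
      unfolding inv t_power_mod by (simp add: divide_inverse ac_simps)
    have 2: "\<beta> * inverse \<mu>2 * t / (t - 1) * t ^ k = x_shift t \<beta> / (inverse t ^ k * \<mu>2)"
      unfolding x_shift_def inv by (simp add: divide_inverse ac_simps)
    show ?thesis unfolding Gx M2_gen.simps powi_conv[OF q] weight_gen.simps 1 2 ..
  next
    case Gy
    show ?thesis unfolding Gy M2_gen.simps by (rule lower_gen_eq[OF \<mu>])
  next
    case Gz
    show ?thesis unfolding Gz M2_gen.simps powi_conv[OF q] weight_gen.simps ..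
  qed
qed

lemma M2_weight_data:
  assumes \<mu>: "\<mu>1 \<noteq> 0" "\<mu>2 \<noteq> 0"
  shows "weight_data l (\<lambda>k. (k + 1) mod l) (\<lambda>k. k - 1)
      (\<lambda>_. \<mu>1) (\<lambda>k. inverse \<mu>1 * f \<mu>2 k) (\<lambda>k. inverse t ^ k * \<mu>2) q \<alpha> \<beta> \<gamma>"
proof
  show "q \<noteq> 0" "q ^ 2 \<noteq> 1" "l > 0" using q t_neq l by auto
  have inv: "inverse t ^ k = inverse (t ^ k)" for k by (simp only: power_inverse)
  fix k assume k: "k < l"
  show "(k + 1) mod l < l" "k - 1 < l" using l k by auto
  show "inverse t ^ k * \<mu>2 \<noteq> 0" using t_neq \<mu> by simp
  show "inverse t ^ k * \<mu>2 = t * (inverse t ^ ((k + 1) mod l) * \<mu>2)"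
    unfolding inv t_power_mod using t_neq(1) by simp
  have k0: "k \<noteq> 0" if "inverse \<mu>1 * f \<mu>2 k \<noteq> 0"
    by (rule notI) (use that in \<open>simp add: f_seq_simps(1)[OF t_neq]\<close>)
  show "inverse t ^ (k - 1) * \<mu>2 = t * (inverse t ^ k * \<mu>2)" if "inverse \<mu>1 * f \<mu>2 k \<noteq> 0"
    using k0[OF that] t_neq(1) by (cases k) auto
  show "(k - 1 + 1) mod l = k" if "inverse \<mu>1 * f \<mu>2 k \<noteq> 0"
    using k0[OF that] k by (cases k) auto
  \<comment> \<open>At the wrap both sides are zero: \<open>f\<close> vanishes at 0 and, by
    \<open>f_root\<close>, at l.\<close>
  have "f \<mu>2 ((k + 1) mod l) = f \<mu>2 (Suc k)"
    using k f_root f_seq_simps(1)[OF t_neq] by (cases "Suc k = l") auto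
  then have "t * f \<mu>2 ((k + 1) mod l) = f \<mu>2 k + (\<alpha> * (inverse t ^ k * \<mu>2) ^ 2 - c0)"
    unfolding f_seq_simps(2)[OF t_neq] using t_neq(1) by simp
  moreover have "t * (\<mu>1 * (inverse \<mu>1 * f \<mu>2 ((k + 1) mod l))) = t * f \<mu>2 ((k + 1) mod l)"
    using \<mu> by simp
  ultimately show "t * (\<mu>1 * (inverse \<mu>1 * f \<mu>2 ((k + 1) mod l))) =
      inverse \<mu>1 * f \<mu>2 k * \<mu>1 + (\<alpha> * (inverse t ^ k * \<mu>2) ^ 2 - c0)"
    using \<mu> by simp
next
  fix k assume k: "k < l" and "inverse \<mu>1 * f \<mu>2 ((k + 1) mod l) \<noteq> 0"
  then have "(k + 1) mod l \<noteq> 0" by (intro notI) (simp add: f_seq_simps(1)[OF t_neq])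
  then have "Suc k \<noteq> l" by auto
  then show "(k + 1) mod l - 1 = k" using k by simp
next
  show "inj_on (\<lambda>k. inverse t ^ k * \<mu>2) {..<l}" using inj_inverse_t_power \<mu> by (auto simp: inj_on_def)
next
  fix S assume "S \<subseteq> {..<l}" "S \<noteq> {}" "\<And>k. k \<in> S \<Longrightarrow> \<mu>1 \<noteq> 0 \<Longrightarrow> (k + 1) mod l \<in> S"
  then show "S = {..<l}" using \<mu> by (intro cyclic_set) auto
qed

lemma M3_gen_eq:
  assumes \<mu>: "\<mu> \<noteq> 0" and s: "s > 0"
  shows "M3_gen q \<alpha> \<beta> \<gamma> \<mu> s =
    weight3 s \<mu>"
proof (intro ext)
  fix h k
  have inv: "inverse t ^ k = inverse (t ^ k)" for k by (simp only: power_inverse)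
  show "M3_gen q \<alpha> \<beta> \<gamma> \<mu> s h k =
    weight3 s \<mu> h k"
  proof (cases h)
    case Gx
    have 1: "inverse \<mu> * (t * t ^ k) = 1 / (inverse t ^ (k + 1) * \<mu>)"
      unfolding inv by (simp add: divide_inverse ac_simps)
    have 2: "\<beta> * inverse \<mu> / (t - 1) * (t * t ^ k) = x_shift t \<beta> / (inverse t ^ k * \<mu>)"
      unfolding x_shift_def inv by (simp add: divide_inverse ac_simps)
    show ?thesis
    proof (cases "k = s - 1")
      case True
      then have "t ^ s = t * t ^ k" using s by (simp flip: power_Suc)
      then show ?thesis
        unfolding Gx M3_gen.simps powi_conv[OF q] weight_gen.simps using 2 True by simp
    next
      case False
      then show ?thesis
        unfolding Gx M3_gen.simps powi_conv[OF q] weight_gen.simps 1 2 by simp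
    qed
  next
    case Gy
    have 1: "inverse 1 * inverse \<mu> = inverse \<mu>" by simp
    show ?thesis
      unfolding Gy M3_gen.simps by (rule lower_gen_eq[OF one_neq_zero \<mu>, unfolded 1])
  next
    case Gz
    show ?thesis unfolding Gz M3_gen.simps powi_conv[OF q] weight_gen.simps ..
  qed
qed

text \<open>The zero of \<open>f\<close> at s makes the relation hold at the top, where x has no
  arrow. Its nonvanishing below s lets y descend from any basis vector to the one with index 0, and
  x ascends from there to all of them.\<close>

lemma M3_weight_data:
  assumes \<mu>: "\<mu> \<noteq> 0" and s: "0 < s" "s \<le> l" "f \<mu> s = 0" and nz: "\<And>k. 0 < k \<Longrightarrow> k < s \<Longrightarrow> f \<mu> k \<noteq> 0"
  shows "weight_data s (\<lambda>k. if k = s - 1 then 0 else k + 1) (\<lambda>k. k - 1)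
      (\<lambda>k. if k = s - 1 then 0 else 1) (\<lambda>k. inverse 1 * f \<mu> k) (\<lambda>k. inverse t ^ k * \<mu>) q \<alpha> \<beta> \<gamma>"
proof
  show "q \<noteq> 0" "q ^ 2 \<noteq> 1" "s > 0" using q t_neq s by auto
  fix k assume k: "k < s"
  have k0: "k \<noteq> 0" if "inverse 1 * f \<mu> k \<noteq> 0"
    by (rule notI) (use that in \<open>simp add: f_seq_simps(1)[OF t_neq]\<close>)
  show "(if k = s - 1 then 0 else k + 1) < s" "k - 1 < s" using k by auto
  show "inverse t ^ k * \<mu> \<noteq> 0" using t_neq \<mu> by simp
  show "inverse t ^ k * \<mu> = t * (inverse t ^ (if k = s - 1 then 0 else k + 1) * \<mu>)"
    if "(if k = s - 1 then 0 else 1 :: 'k) \<noteq> 0"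
    using that t_neq(1) by (simp split: if_splits)
  show "(if k = s - 1 then 0 else k + 1) - 1 = k"
    if "(if k = s - 1 then 0 else 1 :: 'k) \<noteq> 0"
    using that by (simp split: if_splits)
  show "inverse t ^ (k - 1) * \<mu> = t * (inverse t ^ k * \<mu>)" if "inverse 1 * f \<mu> k \<noteq> 0"
    using k0[OF that] t_neq(1) by (cases k) auto
  show "(if k - 1 = s - 1 then 0 else k - 1 + 1) = k" if "inverse 1 * f \<mu> k \<noteq> 0"
    using k0[OF that] k by auto
  have step: "t * f \<mu> (Suc k) = f \<mu> k + (\<alpha> * (inverse t ^ k * \<mu>) ^ 2 - c0)"
    unfolding f_seq_simps(2)[OF t_neq] using t_neq(1) by simp
  have prev: "inverse 1 * f \<mu> k * (if k - 1 = s - 1 then 0 else 1) = f \<mu> k"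
  proof (cases k)
    case 0
    then show ?thesis by (simp add: f_seq_simps(1)[OF t_neq])
  qed (use k in auto)
  show "t * ((if k = s - 1 then 0 else 1) * (inverse 1 * f \<mu> (if k = s - 1 then 0 else k + 1))) =
      inverse 1 * f \<mu> k * (if k - 1 = s - 1 then 0 else 1) + (\<alpha> * (inverse t ^ k * \<mu>) ^ 2 - c0)"
  proof (cases "k = s - 1")
    case True
    then have "Suc k = s" using s by simp
    then show ?thesis unfolding prev step[symmetric] using s(3) True by simp
  next
    case False
    then show ?thesis unfolding prev step[symmetric] by simp
  qed
next
  have "inj_on (\<lambda>k. inverse t ^ k) {..<s}" using inj_inverse_t_power s(2) by (auto intro: inj_on_subset)
  then show "inj_on (\<lambda>k. inverse t ^ k * \<mu>) {..<s}" using \<mu> by (auto simp: inj_on_def)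
next
  fix S assume S: "S \<subseteq> {..<s}" "S \<noteq> {}"
    and up: "\<And>k. k \<in> S \<Longrightarrow> (if k = s - 1 then 0 else 1 :: 'k) \<noteq> 0 \<Longrightarrow> (if k = s - 1 then 0 else k + 1) \<in> S"
    and down: "\<And>k. k \<in> S \<Longrightarrow> inverse 1 * f \<mu> k \<noteq> 0 \<Longrightarrow> k - 1 \<in> S"
  have "0 \<in> S" if "k \<in> S" for k
    using that
  proof (induction k)
    case (Suc k)
    then have "k \<in> S" using down[of "Suc k"] nz[of "Suc k"] S by auto
    then show ?case by (rule Suc.IH)
  qed
  then have 0: "0 \<in> S" using S by blast
  have "k < s \<Longrightarrow> k \<in> S" for k
  proof (induction k)
    case (Suc k)
    then have "k \<in> S" "k \<noteq> s - 1" by auto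
    then show ?case using up[of k] by simp
  qed (use 0 in simp)
  then show "S = {..<s}" using S by blast
qed

section \<open>The dimension of M3\<close>

lemma f_eq_F_coeff:
  "f \<mu> k = (1 - inverse t ^ k) / (1 - inverse t) * F_coeff q \<alpha> \<beta> \<gamma> k \<mu>"
  unfolding f_seq_def F_coeff_def powi_conv[OF q] comm_const_def using t_neq(1)
  by (simp add: divide_inverse ac_simps)

lemma f_eq_0_iff:
  assumes "0 < k" "k < l"
  shows "f \<mu> k = 0 \<longleftrightarrow> F_coeff q \<alpha> \<beta> \<gamma> k \<mu> = 0"
  unfolding f_eq_F_coeff using t_root(2)[OF assms] t_neq(2) by (simp add: power_inverse)

text \<open>In every case s is the first positive zero of \<open>f\<close>, which is
  \<open>F_coeff\<close> times a q-number whose first positive zero is l. If \<alpha> and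
  \<beta>\<gamma> are both zero, \<open>F_coeff\<close> vanishes identically, which explains s =
  1.\<close>

lemma M3_dim_props:
  fixes \<mu> :: 'k
  defines "s \<equiv> M3_dim q l \<alpha> \<beta> \<gamma> \<mu>"
  assumes \<mu>: "\<mu> \<noteq> 0"
  shows "1 \<le> s" "s \<le> l" "f \<mu> s = 0" "\<And>k. 0 < k \<Longrightarrow> k < s \<Longrightarrow> f \<mu> k \<noteq> 0"
proof -
  let ?F = "\<lambda>k. F_coeff q \<alpha> \<beta> \<gamma> k \<mu>"
  have F: "?F k = \<alpha> * inverse t ^ k * \<mu> ^ 2 - \<beta> * \<gamma> / (t - 1)" for k
    unfolding F_coeff_def powi_conv[OF q] ..
  have tk: "inverse t ^ k \<noteq> 0" for k using t_neq by simp
  have t1: "t - 1 \<noteq> 0" using t_neq by simp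
  have "1 \<le> s \<and> s \<le> l \<and> f \<mu> s = 0 \<and> (\<forall>k. 0 < k \<and> k < s \<longrightarrow> f \<mu> k \<noteq> 0)"
  proof (cases "\<alpha> = 0 \<and> \<beta> * \<gamma> = 0")
    case True
    then have "s = 1" by (simp add: s_def M3_dim_def)
    moreover have "f \<mu> 1 = 0" using True unfolding f_eq_F_coeff F by simp
    ultimately show ?thesis using l by simp
  next
    case nt: False
    show ?thesis
    proof (cases "\<alpha> \<noteq> 0 \<and> \<beta> \<noteq> 0 \<and> \<gamma> \<noteq> 0 \<and> (\<exists>k\<in>{1..l}. ?F k = 0)")
      case True
      \<comment> \<open>A zero of \<open>F_coeff\<close> fixes the value of t^k, and the powers of t
        with exponents from 1 to l are distinct.\<close>
      have uniq: "i = j" if "i \<in> {1..l}" "?F i = 0" "j \<in> {1..l}" "?F j = 0" for i j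
      proof -
        have "\<alpha> * inverse t ^ i * \<mu> ^ 2 = \<alpha> * inverse t ^ j * \<mu> ^ 2" using that(2,4) unfolding F by simp
        then have "inverse t ^ i = inverse t ^ j" using True \<mu> by simp
        then have "t ^ i = t ^ j" by (simp add: power_inverse)
        moreover have "i = Suc (i - 1)" "j = Suc (j - 1)" using that by auto
        ultimately have "t ^ (i - 1) = t ^ (j - 1)" using t_neq(1) by (metis mult_cancel_left power_Suc)
        then have "i - 1 = j - 1" using inj_t_power that by (auto simp: inj_on_def)
        then show ?thesis using that by auto
      qed
      obtain k where k: "k \<in> {1..l}" "?F k = 0" using True by blast
      have "s = (THE k. k \<in> {1..l} \<and> ?F k = 0)" using nt True by (simp add: s_def M3_dim_def)
      also have "\<dots> = k" by (rule the_equality) (use k uniq in auto)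
      finally have sk: "s = k" .
      have "f \<mu> j \<noteq> 0" if "0 < j" "j < k" for j
        using f_eq_0_iff[of j \<mu>] that k uniq[of j k] by auto
      moreover have "f \<mu> k = 0" unfolding f_eq_F_coeff k(2) by simp
      ultimately show ?thesis using sk k by auto
    next
      case False
      then have sl: "s = l" using nt by (auto simp: s_def M3_dim_def)
      \<comment> \<open>If exactly one of \<alpha> and \<beta>\<gamma> is zero, a single nonzero
        term remains; if neither is, zeros are excluded by the case assumption.\<close>
      have "?F k \<noteq> 0" if "0 < k" "k < l" for k
      proof (cases "\<alpha> = 0 \<or> \<beta> * \<gamma> = 0")
        case True
        then show ?thesis using nt tk[of k] \<mu> t1 unfolding F by auto
      next
        case f: False
        then show ?thesis using False that by auto
      qed
      then show ?thesis using sl l f_root f_eq_0_iff by auto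
    qed
  qed
  then show "1 \<le> s" "s \<le> l" "f \<mu> s = 0" "\<And>k. 0 < k \<Longrightarrow> k < s \<Longrightarrow> f \<mu> k \<noteq> 0" by auto
qed

end

theorem theorem5p8:
  fixes q \<alpha> \<beta> \<gamma> :: "'k::alg_closed_field" and l :: nat
  assumes "q \<noteq> 0" and "l > 1" and "primitive_root_of_unity l (q ^ 2)"
  shows "(\<forall>\<mu>1 \<mu>2 \<mu>3. \<mu>1 \<noteq> 0 \<and> \<mu>2 \<noteq> 0 \<longrightarrow>
            simple_right_module (A_alg q \<alpha> \<beta> \<gamma>) (M1 q l \<alpha> \<beta> \<gamma> \<mu>1 \<mu>2 \<mu>3)) \<and>
         (\<forall>\<mu>1 \<mu>2. \<mu>1 \<noteq> 0 \<and> \<mu>2 \<noteq> 0 \<longrightarrow>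
            simple_right_module (A_alg q \<alpha> \<beta> \<gamma>) (M2 q l \<alpha> \<beta> \<gamma> \<mu>1 \<mu>2)) \<and>
         (\<forall>\<mu>. \<mu> \<noteq> 0 \<longrightarrow>
            1 \<le> M3_dim q l \<alpha> \<beta> \<gamma> \<mu> \<and> M3_dim q l \<alpha> \<beta> \<gamma> \<mu> \<le> l \<and>
            simple_right_module (A_alg q \<alpha> \<beta> \<gamma>) (M3 q \<alpha> \<beta> \<gamma> \<mu> (M3_dim q l \<alpha> \<beta> \<gamma> \<mu>))) \<and>
         (\<forall>M :: ('k free_alg set, 'm) right_module.
            simple_right_module (A_alg q \<alpha> \<beta> \<gamma>) M \<and>
            acts_invertibly M (A_class q \<alpha> \<beta> \<gamma> (gen Gz)) \<longrightarrow>
              (\<exists>\<mu>1 \<mu>2 \<mu>3. \<mu>1 \<noteq> 0 \<and> \<mu>2 \<noteq> 0 \<and>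
                 isomorphic_right_modules (A_alg q \<alpha> \<beta> \<gamma>) M (M1 q l \<alpha> \<beta> \<gamma> \<mu>1 \<mu>2 \<mu>3)) \<or>
              (\<exists>\<mu>1 \<mu>2. \<mu>1 \<noteq> 0 \<and> \<mu>2 \<noteq> 0 \<and>
                 isomorphic_right_modules (A_alg q \<alpha> \<beta> \<gamma>) M (M2 q l \<alpha> \<beta> \<gamma> \<mu>1 \<mu>2)) \<or>
              (\<exists>\<mu>. \<mu> \<noteq> 0 \<and>
                 isomorphic_right_modules (A_alg q \<alpha> \<beta> \<gamma>) M
                   (M3 q \<alpha> \<beta> \<gamma> \<mu> (M3_dim q l \<alpha> \<beta> \<gamma> \<mu>))))"
proof -
  interpret root_data q \<alpha> \<beta> \<gamma> l by unfold_locales (use assms in auto)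
  have M1: "M1 q l \<alpha> \<beta> \<gamma> \<mu>1 \<mu>2 \<mu>3 = based_module l (weight1 \<mu>1 \<mu>2 \<mu>3)"
    if "\<mu>1 \<noteq> 0" "\<mu>2 \<noteq> 0" for \<mu>1 \<mu>2 \<mu>3
    unfolding M1_def M1_gen_eq[OF that] ..
  have M2: "M2 q l \<alpha> \<beta> \<gamma> \<mu>1 \<mu>2 = based_module l (weight2 \<mu>1 \<mu>2)"
    if "\<mu>1 \<noteq> 0" "\<mu>2 \<noteq> 0" for \<mu>1 \<mu>2
    unfolding M2_def M2_gen_eq[OF that] ..
  define s where "s \<mu> = M3_dim q l \<alpha> \<beta> \<gamma> \<mu>" for \<mu>
  have s: "1 \<le> s \<mu>" "0 < s \<mu>" "s \<mu> \<le> l" "f \<mu> (s \<mu>) = 0" if "\<mu> \<noteq> 0" for \<mu>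
    using M3_dim_props[OF that] by (auto simp: s_def)
  have M3: "M3 q \<alpha> \<beta> \<gamma> \<mu> (s \<mu>) = based_module (s \<mu>) (weight3 (s \<mu>) \<mu>)"
    if "\<mu> \<noteq> 0" for \<mu>
    unfolding M3_def M3_gen_eq[OF that s(2)[OF that]] ..
  have D3: "weight_data (s \<mu>) (\<lambda>k. if k = s \<mu> - 1 then 0 else k + 1)
      (\<lambda>k. k - 1) (\<lambda>k. if k = s \<mu> - 1 then 0 else 1) (\<lambda>k. inverse 1 * f \<mu> k) (\<lambda>k. inverse t ^ k * \<mu>) q \<alpha> \<beta> \<gamma>"
    if "\<mu> \<noteq> 0" for \<mu>
    using M3_dim_props(4)[OF that] by (intro M3_weight_data that s) (simp_all add: s_def)
  have simple1: "simple_right_module (A_alg q \<alpha> \<beta> \<gamma>) (M1 q l \<alpha> \<beta> \<gamma> \<mu>1 \<mu>2 \<mu>3)" if "\<mu>1 \<noteq> 0" "\<mu>2 \<noteq> 0" for \<mu>1 \<mu>2 \<mu>3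
    unfolding M1[OF that] by (rule weight_data.simple_weight_module[OF M1_weight_data[OF that]])
  have simple2: "simple_right_module (A_alg q \<alpha> \<beta> \<gamma>) (M2 q l \<alpha> \<beta> \<gamma> \<mu>1 \<mu>2)" if "\<mu>1 \<noteq> 0" "\<mu>2 \<noteq> 0" for \<mu>1 \<mu>2
    unfolding M2[OF that] by (rule weight_data.simple_weight_module[OF M2_weight_data[OF that]])
  have simple3: "simple_right_module (A_alg q \<alpha> \<beta> \<gamma>) (M3 q \<alpha> \<beta> \<gamma> \<mu> (s \<mu>))" if "\<mu> \<noteq> 0" for \<mu>
    unfolding M3[OF that] by (rule weight_data.simple_weight_module[OF D3[OF that]])
  have classification: "(\<exists>\<mu>1 \<mu>2 \<mu>3. \<mu>1 \<noteq> 0 \<and> \<mu>2 \<noteq> 0 \<and> isomorphic_right_modules (A_alg q \<alpha> \<beta> \<gamma>) M (M1 q l \<alpha> \<beta> \<gamma> \<mu>1 \<mu>2 \<mu>3)) \<or>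
      (\<exists>\<mu>1 \<mu>2. \<mu>1 \<noteq> 0 \<and> \<mu>2 \<noteq> 0 \<and> isomorphic_right_modules (A_alg q \<alpha> \<beta> \<gamma>) M (M2 q l \<alpha> \<beta> \<gamma> \<mu>1 \<mu>2)) \<or>
      (\<exists>\<mu>. \<mu> \<noteq> 0 \<and> isomorphic_right_modules (A_alg q \<alpha> \<beta> \<gamma>) M (M3 q \<alpha> \<beta> \<gamma> \<mu> (s \<mu>)))"
    if S: "simple_right_module (A_alg q \<alpha> \<beta> \<gamma>) M" and z: "acts_invertibly M (A_class q \<alpha> \<beta> \<gamma> (gen Gz))"
    for M :: "('k free_alg set, 'm) right_module"
  proof -
    interpret M: A_module q \<alpha> \<beta> \<gamma> M by (rule A_moduleI[OF S])
    obtain m where m: "m \<in> carrier M" "m \<noteq> \<zero>\<^bsub>M\<^esub>"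
      using S M.M.zero_closed unfolding simple_right_module_def by blast
    define I where "I = {p. m \<triangleleft>\<^bsub>M\<^esub> A_class q \<alpha> \<beta> \<gamma> p = \<zero>\<^bsub>M\<^esub>}"
    have W: "weyl_quotient I const (gen Gx) (gen Gy) (gen Gz) t \<alpha> \<beta> \<gamma> l"
      unfolding I_def by (rule weyl_quotient_of_module[OF S z assms(2,3) m])
    then interpret W: weyl_quotient I const "gen Gx" "gen Gy" "gen Gz" t \<alpha> \<beta> \<gamma> l .
    \<comment> \<open>\<open>isomorphic_if_chain\<close> in the vocabulary of the chains; in each
      family it remains to match indices at the ends of the chain.\<close>
    have weight_iso: "isomorphic_right_modules (A_alg q \<alpha> \<beta> \<gamma>) M (based_module n (weight_gen t \<beta> \<gamma> \<sigma> \<tau> A C \<nu>))"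
      if D: "weight_data n \<sigma> \<tau> A C \<nu> q \<alpha> \<beta> \<gamma>" and V: "V 0 \<notin> I" "\<And>k. k < n \<Longrightarrow> W.zeig (\<nu> k) (V k)"
        "\<And>k. k < n \<Longrightarrow> W.eqI (V k * W.xh) (W.smul (A k) (V (\<sigma> k)))"
        "\<And>k. k < n \<Longrightarrow> W.eqI (V k * W.yh) (W.smul (C k) (V (\<tau> k)))" for n \<sigma> \<tau> A C \<nu> V
      by (rule isomorphic_if_chain[OF S m(1), folded I_def, OF W D])
        (use V in \<open>simp_all only: W.zeig_def W.eqI_def W.smul_def W.xh_def W.yh_def mult_1_right\<close>)
    consider (y) "\<exists>\<mu> \<theta> \<mu>' V. W.y_chain \<mu> \<theta> \<mu>' V"
      | (x) "\<exists>\<mu> \<theta> V. W.x_chain \<mu> \<theta> V \<and> W.eqI (V l) (V 0)"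
      | (nil) "\<exists>\<theta> V. W.x_chain 1 \<theta> V \<and> (\<forall>r. 0 < r \<and> f \<theta> r = 0 \<longrightarrow> V r \<in> I)"
      using W.chains_exhaustive by argo
    then show ?thesis
    proof cases
      case y
      then obtain \<mu> \<theta> \<mu>' V where "W.y_chain \<mu> \<theta> \<mu>' V" by (elim exE)
      then have \<mu>: "\<mu> \<noteq> 0" "\<theta> \<noteq> 0" and V0: "V 0 \<notin> I" and Vl: "W.eqI (V l) (V 0)"
        and zV: "W.zeig (t ^ k * \<theta>) (V k)" and yV: "W.eqI (V k * W.yh) (W.smul \<mu> (V (Suc k)))"
        and x0: "W.eqI (V 0 * W.xh) (W.smul (inverse \<mu> * \<mu>') (V (l - 1)))"
        and xV: "W.eqI (V (Suc k) * W.xh) (W.smul (inverse \<mu> * g \<theta> \<mu>' (Suc k)) (V k))" for k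
        unfolding W.y_chain_def by simp_all
      have "isomorphic_right_modules (A_alg q \<alpha> \<beta> \<gamma>) M (M1 q l \<alpha> \<beta> \<gamma> \<mu> \<theta> \<mu>')"
        unfolding M1[OF \<mu>]
      proof (rule weight_iso[of _ _ _ _ _ _ V, OF M1_weight_data[OF \<mu>] V0 zV])
        fix k assume k: "k < l"
        show "W.eqI (V k * W.xh) (W.smul (inverse \<mu> * g \<theta> \<mu>' k) (V ((k + l - 1) mod l)))"
        proof (cases k)
          \<comment> \<open>At k = 0 the index \<open>(k + l - 1) mod l\<close> is l - 1, and
            \<open>g\<close> takes the value \<open>\<mu>'\<close>.\<close>
          case 0
          then show ?thesis using x0 l by (simp add: g_seq_simps(1)[OF t_neq])
        next
          case (Suc j)
          then have "(k + l - 1) mod l = j" using k by simp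
          then show ?thesis using xV[of j] by (simp only: Suc)
        qed
        show "W.eqI (V k * W.yh) (W.smul \<mu> (V ((k + 1) mod l)))"
        proof (cases "Suc k = l")
          \<comment> \<open>The last arrow leads to \<open>V l\<close>, which is congruent to
            \<open>V 0\<close>.\<close>
          case True
          then show ?thesis using W.eqI_trans[OF yV[of k] W.eqI_smul[OF Vl[folded True]]] by simp
        next
          case False
          then show ?thesis using yV[of k] k by simp
        qed
      qed
      then show ?thesis using \<mu> by blast
    next
      case x
      then obtain \<mu> \<theta> V where ch: "W.x_chain \<mu> \<theta> V" "W.eqI (V l) (V 0)" by (elim exE conjE)
      from ch(1) have \<mu>: "\<mu> \<noteq> 0" "\<theta> \<noteq> 0" and V0: "V 0 \<notin> I"
        and zV: "W.zeig (inverse t ^ k * \<theta>) (V k)" and xV: "W.eqI (V k * W.xh) (W.smul \<mu> (V (Suc k)))"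
        and y0: "W.eqI (V 0 * W.yh) 0"
        and yV: "W.eqI (V (Suc k) * W.yh) (W.smul (inverse \<mu> * f \<theta> (Suc k)) (V k))" for k
        unfolding W.x_chain_def by simp_all
      have "isomorphic_right_modules (A_alg q \<alpha> \<beta> \<gamma>) M (M2 q l \<alpha> \<beta> \<gamma> \<mu> \<theta>)"
        unfolding M2[OF \<mu>]
      proof (rule weight_iso[of _ _ _ _ _ _ V, OF M2_weight_data[OF \<mu>] V0 zV])
        fix k assume k: "k < l"
        show "W.eqI (V k * W.yh) (W.smul (inverse \<mu> * f \<theta> k) (V (k - 1)))"
        proof (cases k)
          case 0
          then show ?thesis using y0 by (simp add: f_seq_simps(1)[OF t_neq])
        next
          case (Suc j)
          then show ?thesis using yV[of j] by (simp only: Suc diff_Suc_1)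
        qed
        show "W.eqI (V k * W.xh) (W.smul \<mu> (V ((k + 1) mod l)))"
        proof (cases "Suc k = l")
          case True
          then show ?thesis using W.eqI_trans[OF xV[of k] W.eqI_smul[OF ch(2)[folded True]]] by simp
        next
          case False
          then show ?thesis using xV[of k] k by simp
        qed
      qed
      then show ?thesis using \<mu> by blast
    next
      case nil
      then obtain \<theta> V where ch: "W.x_chain 1 \<theta> V" "\<forall>r. 0 < r \<and> f \<theta> r = 0 \<longrightarrow> V r \<in> I"
        by (elim exE conjE)
      from ch(1) have \<theta>: "\<theta> \<noteq> 0" and V0: "V 0 \<notin> I"
        and zV: "W.zeig (inverse t ^ k * \<theta>) (V k)" and xV: "W.eqI (V k * W.xh) (V (Suc k))"
        and y0: "W.eqI (V 0 * W.yh) 0"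
        and yV: "W.eqI (V (Suc k) * W.yh) (W.smul (inverse 1 * f \<theta> (Suc k)) (V k))" for k
        unfolding W.x_chain_def by simp_all
      have "isomorphic_right_modules (A_alg q \<alpha> \<beta> \<gamma>) M (M3 q \<alpha> \<beta> \<gamma> \<theta> (s \<theta>))"
        unfolding M3[OF \<theta>]
      proof (rule weight_iso[of _ _ _ _ _ _ V, OF D3[OF \<theta>] V0 zV])
        fix k assume k: "k < s \<theta>"
        show "W.eqI (V k * W.yh) (W.smul (inverse 1 * f \<theta> k) (V (k - 1)))"
        proof (cases k)
          case 0
          then show ?thesis using y0 by (simp add: f_seq_simps(1)[OF t_neq])
        next
          case (Suc j)
          then show ?thesis using yV[of j] by (simp only: Suc diff_Suc_1)
        qed
        show "W.eqI (V k * W.xh) (W.smul (if k = s \<theta> - 1 then 0 else 1) (V (if k = s \<theta> - 1 then 0 else k + 1)))"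
        proof (cases "k = s \<theta> - 1")
          \<comment> \<open>The arrow out of the top vector is absent: its target
            \<open>V (s \<theta>)\<close> lies in \<open>I\<close>, since \<open>f\<close> vanishes
            at \<open>s \<theta>\<close>.\<close>
          case True
          then have "Suc k = s \<theta>" using s(2)[OF \<theta>] by simp
          then have "V (Suc k) \<in> I" using ch(2) s(2,4)[OF \<theta>] by simp
          then have "W.eqI (V k * W.xh) 0" using W.eqI_mem[OF xV[of k]] by (simp add: W.eqI_0_iff)
          then show ?thesis using True by simp
        next
          case False
          then show ?thesis using xV[of k] by simp
        qed
      qed
      then show ?thesis using \<theta> by blast
    qed
  qed
  show ?thesis
    using simple1 simple2 simple3 s(1,3) classification unfolding s_def
    by (intro conjI allI impI; (elim conjE)?) simp_all
qed

end
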